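(* Suppose that for every $\varepsilon>0$ and every set $A$ of at most $n$ sources, a value between $\mathrm{cost}(A)$ and $(1+\varepsilon)\,\mathrm{cost}(A)$ (together with a corresponding placement of the Steiner vertex) can be computed in time $T_{\mathrm{Weber}}(n,\varepsilon)$, where $\mathrm{cost}(A)$ is the minimum cost of connecting all sources of $A$ to the sink through a single Steiner vertex. Then convex instances of FLaMECaST with one intermediate layer, one sink, unlimited capacity and $\alpha=0$, with $n$ sources, can be approximated within a factor of $1+\varepsilon$ (i.e., a layout of cost at most $(1+\varepsilon)$ times the minimum can be computed) in $O(n^6\cdot T_{\mathrm{Weber}}(n,\varepsilon))$ time.
   Context: FLaMECaST: an instance $I=(S,T,C,\alpha)$ consists of a finite set $S$ of sources and a finite set $T$ of sinks, each with a fixed position in $\mathbb{R}^2$, capacities $C=(c_0,\dots,c_{\lambda+1})$ ($\lambda$ = number of intermediate layers; here $\lambda=1$, $T=\{t\}$, and all capacities are $\infty$, i.e., no capacity constraints), and $\alpha\in[0,1]$ (here $\alpha=0$). A layout consists of a rooted forest (edges directed from child to parent) of height at most $\lambda+1$ whose leaves are exactly $S$ and whose roots lie in $T$ (other vertices are Steiner vertices), together with an embedding mapping sources and sinks to their positions and Steiner vertices to arbitrary points of $\mathbb{R}^2$. The cost of an edge $uv$ ($u$ child of $v$) is $\|\mathrm{pos}(u)-\mathrm{pos}(v)\|\cdot\ell(uv)^\alpha$, where $\ell(uv)$ is the number of sources in the subtree of $u$; for $\alpha=0$ this is the edge length. The cost of a layout is the sum of its edge costs; the goal is a layout of minimum cost.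 An instance is convex if all sources lie on the boundary of the convex hull of $S\cup T$. *)

theory Defs
  imports "HOL-Analysis.Analysis"
begin

type_synonym point = "real \<times> real"

text \<open>
  Sources and sinks are list positions, so distinct sources may share a point.  Capacities are not
  part of the record: only the uncapacitated problem is considered.
\<close>

record flamecast =
  sources :: "point list"
  sinks :: "point list"
  layers :: nat
  alpha :: real

datatype vertex = Source nat | Sink nat | Steiner nat

record layout =
  verts :: "vertex set"
  parent :: "vertex \<Rightarrow> vertex option"
  pos :: "vertex \<Rightarrow> point"

definition arcs :: "layout \<Rightarrow> (vertex \<times> vertex) set" where
  "arcs L = {(u, v). u \<in> verts L \<and> parent L u = Some v}"

definition rooted_forest :: "layout \<Rightarrow> bool" where
  "rooted_forest L \<longleftrightarrow> finite (verts L) \<and> arcs L \<subseteq> verts L \<times> verts L \<and> acyclic (arcs L)"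

definition leaves :: "layout \<Rightarrow> vertex set" where
  "leaves L = {v \<in> verts L. \<forall>u. (u, v) \<notin> arcs L}"

definition roots :: "layout \<Rightarrow> vertex set" where
  "roots L = {v \<in> verts L. parent L v = None}"

definition height_at_most :: "layout \<Rightarrow> nat \<Rightarrow> bool" where
  "height_at_most L h \<longleftrightarrow> (\<forall>u v d. (u, v) \<in> arcs L ^^ d \<longrightarrow> d \<le> h)"

definition is_layout :: "flamecast \<Rightarrow> layout \<Rightarrow> bool" where
  "is_layout I L \<longleftrightarrow>
     rooted_forest L \<and>
     height_at_most L (layers I + 1) \<and>
     leaves L = Source ` {..<length (sources I)} \<and>
     roots L \<subseteq> Sink ` {..<length (sinks I)} \<and>
     verts L - leaves L - roots L \<subseteq> range Steiner \<and>
     (\<forall>i<length (sources I). pos L (Source i) = sources I ! i) \<and>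
     (\<forall>j<length (sinks I). pos L (Sink j) = sinks I ! j)"

definition load :: "layout \<Rightarrow> vertex \<Rightarrow> nat" where
  "load L u = card {w \<in> leaves L. (w, u) \<in> (arcs L)\<^sup>*}"

definition layout_cost :: "flamecast \<Rightarrow> layout \<Rightarrow> real" where
  "layout_cost I L =
     (\<Sum>(u, v)\<in>arcs L. dist (pos L u) (pos L v) * real (load L u) powr alpha I)"

definition min_cost :: "flamecast \<Rightarrow> real" where
  "min_cost I = Inf {layout_cost I L |L. is_layout I L}"

definition convex_instance :: "flamecast \<Rightarrow> bool" where
  "convex_instance I \<longleftrightarrow>
     set (sources I) \<subseteq> frontier (convex hull (set (sources I) \<union> set (sinks I)))"

definition star_cost :: "point \<Rightarrow> point list \<Rightarrow> point \<Rightarrow> real" where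
  "star_cost t A p = dist p t + (\<Sum>a\<leftarrow>A. dist a p)"

definition weber_cost :: "point \<Rightarrow> point list \<Rightarrow> real" where
  "weber_cost t A = (INF p. star_cost t A p)"


text \<open>
  The real RAM, as a structured language over arrays of naturals (used for control and indirect
  addressing) and arrays of exact reals.  Arrays are numbered and unbounded; a scalar is cell 0 of
  an array.  Reals support the field operations, square roots and comparison, but there is no
  rounding from reals to naturals and there are no real constants other than naturals.
\<close>

datatype nexp =
    NConst nat
  | NCell nat nexp
  | NAdd nexp nexp
  | NSub nexp nexp
  | NMul nexp nexp

datatype rexp =
    RNat nexp
  | RCell nat nexp
  | RAdd rexp rexp
  | RSub rexp rexp
  | RMul rexp rexp
  | RDiv rexp rexp
  | RSqrt rexp

datatype bexp =
    NLess nexp nexp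
  | RLess rexp rexp
  | BNot bexp
  | BAnd bexp bexp

datatype com =
    SKIP
  | NAssign nat nexp nexp
  | RAssign nat nexp rexp
  | Seq com com
  | If bexp com com
  | While bexp com

record state =
  nmem :: "nat \<Rightarrow> nat \<Rightarrow> nat"
  rmem :: "nat \<Rightarrow> nat \<Rightarrow> real"

fun nval :: "nexp \<Rightarrow> state \<Rightarrow> nat" where
  "nval (NConst k) s = k"
| "nval (NCell a i) s = nmem s a (nval i s)"
| "nval (NAdd e f) s = nval e s + nval f s"
| "nval (NSub e f) s = nval e s - nval f s"
| "nval (NMul e f) s = nval e s * nval f s"

fun rval :: "rexp \<Rightarrow> state \<Rightarrow> real" where
  "rval (RNat e) s = real (nval e s)"
| "rval (RCell a i) s = rmem s a (nval i s)"
| "rval (RAdd e f) s = rval e s + rval f s"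
| "rval (RSub e f) s = rval e s - rval f s"
| "rval (RMul e f) s = rval e s * rval f s"
| "rval (RDiv e f) s = rval e s / rval f s"
| "rval (RSqrt e) s = sqrt (rval e s)"

fun bval :: "bexp \<Rightarrow> state \<Rightarrow> bool" where
  "bval (NLess e f) s = (nval e s < nval f s)"
| "bval (RLess e f) s = (rval e s < rval f s)"
| "bval (BNot b) s = (\<not> bval b s)"
| "bval (BAnd b c) s = (bval b s \<and> bval c s)"

definition nupd :: "nat \<Rightarrow> nat \<Rightarrow> nat \<Rightarrow> state \<Rightarrow> state" where
  "nupd a i x s = s\<lparr>nmem := (nmem s)(a := (nmem s a)(i := x))\<rparr>"

definition rupd :: "nat \<Rightarrow> nat \<Rightarrow> real \<Rightarrow> state \<Rightarrow> state" where
  "rupd a i x s = s\<lparr>rmem := (rmem s)(a := (rmem s a)(i := x))\<rparr>"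

text \<open>
  \<open>exec c s k s'\<close>: started in \<open>s\<close>, program \<open>c\<close> halts in \<open>s'\<close> after \<open>k\<close> steps.  Every assignment and
  every test is one step; as the expressions of a given program have bounded size, this agrees with
  unit cost per operation up to a constant factor.
\<close>

inductive exec :: "com \<Rightarrow> state \<Rightarrow> nat \<Rightarrow> state \<Rightarrow> bool" where
  Skip: "exec SKIP s 1 s"
| NAssign: "exec (NAssign a i e) s 1 (nupd a (nval i s) (nval e s) s)"
| RAssign: "exec (RAssign a i e) s 1 (rupd a (nval i s) (rval e s) s)"
| Seq: "exec c s j s' \<Longrightarrow> exec d s' k s'' \<Longrightarrow> exec (Seq c d) s (j + k) s''"
| IfTrue: "bval b s \<Longrightarrow> exec c s k s' \<Longrightarrow> exec (If b c d) s (k + 1) s'"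
| IfFalse: "\<not> bval b s \<Longrightarrow> exec d s k s' \<Longrightarrow> exec (If b c d) s (k + 1) s'"
| WhileFalse: "\<not> bval b s \<Longrightarrow> exec (While b c) s 1 s"
| WhileTrue: "bval b s \<Longrightarrow> exec c s j s' \<Longrightarrow> exec (While b c) s' k s'' \<Longrightarrow>
    exec (While b c) s (j + k + 1) s''"

text \<open>
  Memory outside the input cells is unconstrained: programs may not rely on it being initialised.
\<close>

definition holds_input :: "real \<Rightarrow> point \<Rightarrow> point list \<Rightarrow> state \<Rightarrow> bool" where
  "holds_input \<epsilon> t A s \<longleftrightarrow>
     nmem s 0 0 = length A \<and>
     rmem s 0 0 = \<epsilon> \<and> rmem s 0 1 = fst t \<and> rmem s 0 2 = snd t \<and>
     (\<forall>i<length A. rmem s 1 i = fst (A ! i) \<and> rmem s 2 i = snd (A ! i))"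

text \<open>
  A Weber program leaves its value and the coordinates of its Steiner vertex in cells 0, 1, 2 of
  real array 3.
\<close>

definition weber_program :: "com \<Rightarrow> (nat \<Rightarrow> real \<Rightarrow> real) \<Rightarrow> bool" where
  "weber_program W T \<longleftrightarrow>
     (\<forall>n. \<forall>\<epsilon>>0. \<forall>t A s. length A \<le> n \<and> holds_input \<epsilon> t A s \<longrightarrow>
        (\<exists>k s'. exec W s k s' \<and> real k \<le> T n \<epsilon> \<and>
           (let v = rmem s' 3 0; p = (rmem s' 3 1, rmem s' 3 2) in
              weber_cost t A \<le> v \<and> v \<le> (1 + \<epsilon>) * weber_cost t A \<and> star_cost t A p \<le> v)))"

text \<open>
  A layout for \<open>n\<close> sources with \<open>m\<close> Steiner vertices is output as a parent array.  The codes are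
  \<open>0, \<dots>, n - 1\<close> for the sources, \<open>n, \<dots>, n + m - 1\<close> for the Steiner vertices and then the sinks.
  Natural array 1 holds \<open>m\<close> in cell 0, natural array 2 maps the code of each source and each Steiner
  vertex to the code of its parent, and real arrays 3 and 4 hold the coordinates of the Steiner
  vertices.
\<close>

definition vertex_of_code :: "nat \<Rightarrow> nat \<Rightarrow> nat \<Rightarrow> vertex" where
  "vertex_of_code n m c =
     (if c < n then Source c else if c < n + m then Steiner (c - n) else Sink (c - n - m))"

definition output_parent :: "nat \<Rightarrow> state \<Rightarrow> vertex \<Rightarrow> vertex option" where
  "output_parent n s v =
     (let m = nmem s 1 0 in
      case v of
        Source i \<Rightarrow> if i < n then Some (vertex_of_code n m (nmem s 2 i)) else None
      | Steiner j \<Rightarrow> if j < m then Some (vertex_of_code n m (nmem s 2 (n + j))) else None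
      | Sink j \<Rightarrow> None)"

definition output_layout :: "flamecast \<Rightarrow> state \<Rightarrow> layout" where
  "output_layout I s =
     (let par = output_parent (length (sources I)) s in
      \<lparr>verts = {v. par v \<noteq> None} \<union> {v. \<exists>u. par u = Some v},
       parent = par,
       pos = (\<lambda>v. case v of
                Source i \<Rightarrow> sources I ! i
              | Sink j \<Rightarrow> sinks I ! j
              | Steiner j \<Rightarrow> (rmem s 3 j, rmem s 4 j))\<rparr>)"

end

theory Submission
  imports Defs
begin

text \<open>
  A layout is a choice of Steiner points (the sink counts as one), and its cost only drops if the
  Steiner points are projected to the hull of the instance and every source moves to its nearest
  Steiner point. The groups are then Voronoi cells of points on a convex curve, so they do not cross
  in the cyclic order of the sources. If the cell of \<open>p\<close> were interrupted four times, by sources of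
  the cells of \<open>q\<^sub>1, \<dots>, q\<^sub>4\<close>, then any two of these would be seen from \<open>p\<close> under an angle of at
  least 90 degrees: otherwise the path from a source of \<open>q\<^sub>i\<close> via \<open>q\<^sub>i\<close> and \<open>q\<^sub>j\<close> to a source of \<open>q\<^sub>j\<close>
  separates two sources of \<open>p\<close> and yet avoids the convex cell of \<open>p\<close>. With lexicographic
  tie-breaking four such points do not exist in the plane, so every group consists of at most three
  cyclic intervals. Hence \<open>O(n\<^sup>6)\<close> calls of the Weber program suffice for an interval dynamic program
  that computes for \<open>u \<le> v\<close> a solution on the positions \<open>u, \<dots>, v - 1\<close>, from one group with at most
  two gaps and solutions on the gaps. The linear overhead of each call is absorbed because a Weber
  program has to read its whole input.
\<close>

section \<open>The order of the sources along the hull\<close>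

text \<open>A cut of the cycle inside one of the three cyclic intervals of a group would turn them
  into four linear ones, hence into three gaps. The cut must fall between sources of different
  cells; as the optimum is unknown, all windows of \<open>n\<close> consecutive positions are
  compared. The exponent 6 counts the free indices of a candidate: the length of the interval, its
  left end and the four ends of the two gaps. The factor \<open>1 + \<epsilon>\<close> enters once
  per group and the costs of groups add up, so errors do not accumulate over the recursion. Table
  entries hold entire solutions instead of back pointers, so the layout is read off without a
  traceback; copying a solution is linear, like collecting a group. Most of the work on the order
  goes into degenerate inputs: sources may coincide, many may lie on one edge of the hull, and the
  hull may be a segment or a point. Orientations along the order are therefore weak inequalities,
  and collinear points are told apart lexicographically.\<close>

definition lex_less :: "point \<Rightarrow> point \<Rightarrow> bool" where
  "lex_less a b \<longleftrightarrow> fst a < fst b \<or> fst a = fst b \<and> snd a < snd b"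

text \<open>\<open>det2 (c - a) (b - a)\<close> is positive iff \<open>b\<close> lies to the left of
  the line directed from \<open>a\<close> to \<open>c\<close>; if \<open>a\<close> is
  lexicographically smaller than \<open>c\<close>, left means above.\<close>

definition det2 :: "point \<Rightarrow> point \<Rightarrow> real" where
  "det2 u v = fst u * snd v - snd u * fst v"

lemma lex_less_irrefl [simp]: "\<not> lex_less a a"
  by (simp add: lex_less_def)

lemma lex_less_trans: "lex_less a b \<Longrightarrow> lex_less b c \<Longrightarrow> lex_less a c"
  by (auto simp: lex_less_def)

lemma lex_less_asym: "lex_less a b \<Longrightarrow> \<not> lex_less b a"
  by (auto simp: lex_less_def)

lemma lex_less_total: "a \<noteq> b \<Longrightarrow> lex_less a b \<or> lex_less b a"
  by (auto simp: lex_less_def prod_eq_iff)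

lemma lex_less_diff: "lex_less a b \<longleftrightarrow> lex_less 0 (b - a)"
  by (auto simp: lex_less_def)

lemma lex_pos_add: "lex_less 0 u \<Longrightarrow> lex_less 0 v \<Longrightarrow> lex_less 0 (u + v)"
  by (auto simp: lex_less_def)

lemma lex_pos_scale: "lex_less 0 u \<Longrightarrow> c > 0 \<Longrightarrow> lex_less 0 (c *\<^sub>R u)"
  by (auto simp: lex_less_def)

text \<open>A convex set without interior lies in a hyperplane, whose normal serves at every
  frontier point; this covers collinear instances. Otherwise \<open>x\<close> is separated from the
  interior, and the inequality passes to the closure.\<close>

lemma supporting_normal_frontier:
  fixes S :: "'a::euclidean_space set"
  assumes "convex S" "x \<in> frontier S"
  obtains m where "m \<noteq> 0" "\<And>y. y \<in> S \<Longrightarrow> m \<bullet> y \<le> m \<bullet> x"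
proof (cases "interior S = {}")
  case True
  then obtain a b where ab: "a \<noteq> 0" "S \<subseteq> {x. a \<bullet> x = b}"
    using empty_interior_subset_hyperplane assms by metis
  have "closure S \<subseteq> {x. a \<bullet> x = b}"
    using ab by (intro closure_minimal closed_hyperplane)
  then have "a \<bullet> x = b" using assms by (auto simp: frontier_def)
  then show ?thesis using ab that by force
next
  case False
  have "x \<notin> interior S" using assms by (simp add: frontier_def)
  then obtain a b where ab: "a \<noteq> 0" "\<forall>y\<in>interior S. a \<bullet> y \<le> b" "a \<bullet> x \<ge> b"
    using separating_hyperplane_sets[of "interior S" "{x}"] False assms(1) by auto
  have "closure (interior S) \<subseteq> {y. a \<bullet> y \<le> b}"
    using ab by (intro closure_minimal closed_halfspace_le) auto
  then have "closure S \<subseteq> {y. a \<bullet> y \<le> b}"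
    using convex_closure_interior[OF assms(1) False] by simp
  then have "a \<bullet> y \<le> a \<bullet> x" if "y \<in> S" for y
    using that ab closure_subset[of S] by fastforce
  then show ?thesis using ab that by blast
qed

text \<open>A point on the line through \<open>a\<close> and \<open>c\<close> counts only if it lies
  on the segment: mere collinearity would not force a path from \<open>b\<close> to \<open>d\<close>
  to meet the chord.\<close>

definition separated :: "point \<Rightarrow> point \<Rightarrow> point \<Rightarrow> point \<Rightarrow> bool" where
  "separated a c b d \<longleftrightarrow> b \<in> closed_segment a c \<or> d \<in> closed_segment a c \<or>
     det2 (c - a) (b - a) * det2 (c - a) (d - a) < 0"

lemma det2_eq_0D:
  assumes "det2 (c - a) (b - a) = 0" "a \<noteq> c"
  obtains r where "b = a + r *\<^sub>R (c - a)"
proof (cases "fst c = fst a")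
  case True
  then have "snd c \<noteq> snd a" using assms by (auto simp: prod_eq_iff)
  then have "b = a + ((snd b - snd a) / (snd c - snd a)) *\<^sub>R (c - a)"
    using assms(1) True by (auto simp: prod_eq_iff det2_def)
  then show ?thesis using that by blast
next
  case False
  then have "snd b - snd a = (fst b - fst a) / (fst c - fst a) * (snd c - snd a)"
    using assms(1) by (simp add: det2_def divide_simps) (simp add: algebra_simps)
  then have "b = a + ((fst b - fst a) / (fst c - fst a)) *\<^sub>R (c - a)"
    using False by (simp add: prod_eq_iff)
  then show ?thesis using that by blast
qed

lemma closed_segmentI2: "0 \<le> r \<Longrightarrow> r \<le> 1 \<Longrightarrow> a + r *\<^sub>R (c - a) \<in> closed_segment a c"
  for a c :: point
  by (auto simp: in_segment algebra_simps intro!: exI[of _ r])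

lemma collinear_lex_between:
  assumes "det2 (c - a) (b - a) = 0" "lex_less a b" "lex_less b c"
  shows "b \<in> closed_segment a c"
proof -
  have "a \<noteq> c" using assms(2,3) by (auto dest: lex_less_asym)
  then obtain r where r: "b = a + r *\<^sub>R (c - a)" using det2_eq_0D assms by metis
  have ac: "lex_less 0 (c - a)" using assms lex_less_trans lex_less_diff by blast
  have "0 \<le> r"
  proof (rule ccontr)
    assume "\<not> 0 \<le> r"
    then have "lex_less 0 ((-r) *\<^sub>R (c - a))" using lex_pos_scale[OF ac, of "- r"] by simp
    moreover have "(-r) *\<^sub>R (c - a) = a - b" by (simp add: r algebra_simps)
    ultimately have "lex_less b a" using lex_less_diff by metis
    then show False using assms lex_less_asym by blast
  qed
  moreover have "r \<le> 1"
  proof (rule ccontr)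
    assume "\<not> r \<le> 1"
    then have "lex_less 0 ((r - 1) *\<^sub>R (c - a))" using lex_pos_scale[OF ac] by simp
    moreover have "(r - 1) *\<^sub>R (c - a) = b - c" by (simp add: r algebra_simps)
    ultimately have "lex_less c b" using lex_less_diff by metis
    then show False using assms lex_less_asym by blast
  qed
  ultimately show ?thesis using r closed_segmentI2 by blast
qed

text \<open>The diagonals of a clockwise quadrilateral cross. If \<open>b\<close> or
  \<open>d\<close> lies on the line through \<open>a\<close> and \<open>c\<close>, the triangle
  \<open>a b d\<close> bounds its parameter \<open>r\<close> on one side, and the two ways of
  cutting the quadrilateral (\<open>area\<close>) on the other. For four collinear points the weak
  inequalities carry no information, hence \<open>nc\<close>.\<close>

lemma clockwise_separated:
  assumes "a \<noteq> c"
    and abc: "det2 (b - a) (c - a) \<le> 0" and abd: "det2 (b - a) (d - a) \<le> 0"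
    and acd: "det2 (c - a) (d - a) \<le> 0" and bcd: "det2 (c - b) (d - b) \<le> 0"
    and nc: "\<not> (det2 (c - a) (b - a) = 0 \<and> det2 (c - a) (d - a) = 0)"
  shows "separated a c b d"
proof -
  have area: "det2 (b - a) (c - a) + det2 (c - a) (d - a) = det2 (b - a) (d - a) + det2 (c - b) (d - b)"
    by (simp add: det2_def algebra_simps)
  have anti: "det2 (c - a) (b - a) = - det2 (b - a) (c - a)"
    by (simp add: det2_def)
  consider "det2 (b - a) (c - a) < 0" "det2 (c - a) (d - a) < 0"
    | "det2 (b - a) (c - a) = 0" "det2 (c - a) (d - a) < 0"
    | "det2 (b - a) (c - a) < 0" "det2 (c - a) (d - a) = 0"
    using abc acd nc anti by fastforce
  then show ?thesis
  proof cases
    case 1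
    then show ?thesis unfolding separated_def anti by (simp add: mult_neg_neg)
  next
    case 2
    then obtain r where r: "b = a + r *\<^sub>R (c - a)" using det2_eq_0D assms(1) anti by (metis neg_equal_0_iff_equal)
    have e1: "det2 (b - a) (d - a) = r * det2 (c - a) (d - a)"
      by (simp add: r det2_def algebra_simps)
    have "0 \<le> r" using abd 2 unfolding e1 by (simp add: mult_le_0_iff)
    moreover have "det2 (c - b) (d - b) = (1 - r) * det2 (c - a) (d - a)"
      using area e1 2 by (simp add: algebra_simps)
    then have "r \<le> 1" using bcd 2 by (simp add: mult_le_0_iff)
    ultimately show ?thesis using closed_segmentI2 r separated_def by auto
  next
    case 3
    then obtain r where r: "d = a + r *\<^sub>R (c - a)" using det2_eq_0D assms(1) by metis
    have e1: "det2 (b - a) (d - a) = r * det2 (b - a) (c - a)"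
      by (simp add: r det2_def algebra_simps)
    have "0 \<le> r" using abd 3 unfolding e1 by (simp add: mult_le_0_iff)
    moreover have "det2 (c - b) (d - b) = (1 - r) * det2 (b - a) (c - a)"
      using area e1 3 by (simp add: algebra_simps)
    then have "r \<le> 1" using bcd 3 by (simp add: mult_le_0_iff)
    ultimately show ?thesis using closed_segmentI2 r separated_def by auto
  qed
qed

text \<open>
  Along the hull, the points below no chord come first, from left to right, and then the others, from
  right to left. A point inside an edge of the hull counts as below a chord iff the rest of the hull is
  above that edge, so the definition is right for such points, too.
\<close>

definition below_chord :: "point set \<Rightarrow> point \<Rightarrow> bool" where
  "below_chord S b \<longleftrightarrow> (\<exists>a\<in>S. \<exists>c\<in>S. lex_less a b \<and> lex_less b c \<and> det2 (c - a) (b - a) < 0)"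

definition hull_less :: "point set \<Rightarrow> point \<Rightarrow> point \<Rightarrow> bool" where
  "hull_less S a b \<longleftrightarrow> (if below_chord S a then below_chord S b \<and> lex_less b a
     else below_chord S b \<or> lex_less a b)"

lemma hull_less_irrefl [simp]: "\<not> hull_less S a a"
  by (simp add: hull_less_def)

lemma hull_less_trans: "hull_less S a b \<Longrightarrow> hull_less S b c \<Longrightarrow> hull_less S a c"
  by (auto simp: hull_less_def split: if_splits dest: lex_less_trans)

lemma hull_less_total: "a \<noteq> b \<Longrightarrow> hull_less S a b \<or> hull_less S b a"
  using lex_less_total by (auto simp: hull_less_def)

text \<open>The lexicographically positive vectors form a convex cone without 0. If the conclusion
  failed, the Cramer identity \<open>id\<close> would write 0 as a nonnegative combination of cone
  vectors with a positive coefficient at \<open>d\<close>.\<close>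

lemma lex_pos_det2:
  assumes "lex_less 0 d" "lex_less 0 u" "lex_less 0 w" "det2 d u \<ge> 0" "det2 d w \<le> 0"
  shows "det2 w u \<ge> 0"
proof (rule ccontr)
  assume "\<not> 0 \<le> det2 w u"
  then have neg: "lex_less 0 ((- det2 w u) *\<^sub>R d)"
    using lex_pos_scale[OF assms(1), of "- det2 w u"] by simp
  have id: "(- det2 w u) *\<^sub>R d + (det2 d u *\<^sub>R w + (- det2 d w) *\<^sub>R u) = 0"
    by (simp add: prod_eq_iff det2_def algebra_simps)
  have nn: "lex_less 0 (c *\<^sub>R x) \<or> c *\<^sub>R x = 0" if "c \<ge> 0" "lex_less 0 x" for c x
    using that lex_pos_scale[of x c] by (cases "c = 0") auto
  have add: "lex_less 0 (x + y)" if "lex_less 0 x" "lex_less 0 y \<or> y = 0" for x y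
    using that lex_pos_add[of x y] by auto
  have "lex_less 0 (((- det2 w u) *\<^sub>R d + det2 d u *\<^sub>R w) + (- det2 d w) *\<^sub>R u)"
    using nn[of "det2 d u" w] nn[of "- det2 d w" u] assms neg by (intro add) auto
  then have "lex_less 0 ((- det2 w u) *\<^sub>R d + (det2 d u *\<^sub>R w + (- det2 d w) *\<^sub>R u))"
    by (simp only: add.assoc)
  then show False unfolding id by simp
qed

locale convex_boundary =
  fixes S H :: "point set"
  assumes conv: "convex H" and S_H: "S \<subseteq> H" and bd: "S \<subseteq> frontier H"
begin

lemma normal:
  assumes "x \<in> S"
  obtains m where "m \<noteq> 0" "\<And>y. y \<in> H \<Longrightarrow> m \<bullet> (y - x) \<le> 0"
proof -
  obtain m where "m \<noteq> 0" "\<And>y. y \<in> H \<Longrightarrow> m \<bullet> y \<le> m \<bullet> x"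
    using supporting_normal_frontier[OF conv] bd assms by (metis subsetD)
  then show ?thesis using that by (simp add: inner_diff_right)
qed

lemma not_below_chord:
  assumes "a \<in> S" "c \<in> S" "lex_less a b" "lex_less b c" "\<not> below_chord S b"
  shows "det2 (c - a) (b - a) \<ge> 0"
  using assms unfolding below_chord_def by fastforce

text \<open>Turn the normal at \<open>b\<close> into a direction \<open>d0\<close> of the supporting
  line. If \<open>d0\<close> is lexicographically positive, \<open>H\<close> lies below that line,
  so no chord can pass above \<open>b\<close>, contrary to \<open>below_chord\<close>. Otherwise
  \<open>H\<close> lies above it, and no chord passes strictly below \<open>b\<close>.\<close>

lemma below_chord_le:
  assumes "a \<in> S" "b \<in> S" "c \<in> S" "lex_less a b" "lex_less b c" "below_chord S b"
  shows "det2 (c - a) (b - a) \<le> 0"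
proof (rule ccontr)
  assume pos: "\<not> ?thesis"
  obtain a' c' where ac': "a' \<in> S" "c' \<in> S" "lex_less a' b" "lex_less b c'" "det2 (c' - a') (b - a') < 0"
    using assms unfolding below_chord_def by blast
  obtain m where m: "m \<noteq> 0" "\<And>y. y \<in> H \<Longrightarrow> m \<bullet> (y - b) \<le> 0"
    using normal assms(2) by blast
  define d0 :: point where "d0 = (snd m, - fst m)"
  have d0: "d0 \<noteq> 0" using m(1) by (auto simp: d0_def prod_eq_iff)
  have md: "m \<bullet> x = det2 d0 x" for x by (simp add: d0_def det2_def inner_prod_def)
  have lp: "lex_less 0 (b - a)" "lex_less 0 (c - b)" "lex_less 0 (b - a')" "lex_less 0 (c' - b)"
    using assms ac' lex_less_diff by blast+
  have neg: "det2 d (- x) = - det2 d x" "det2 (- d) x = - det2 d x" for d x by (simp_all add: det2_def)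
  have s: "det2 d0 (b - a) \<ge> 0" "det2 d0 (c - b) \<le> 0" "det2 d0 (b - a') \<ge> 0" "det2 d0 (c' - b) \<le> 0"
    using m(2)[of a] m(2)[of c] m(2)[of a'] m(2)[of c'] S_H assms ac' neg(1)[of d0 "b - a"] neg(1)[of d0 "b - a'"]
    unfolding md by auto
  have e1: "det2 (c - a) (b - a) = det2 (c - b) (b - a)" "det2 (c' - a') (b - a') = det2 (c' - b) (b - a')"
    by (simp_all add: det2_def algebra_simps)
  from lex_less_total[OF d0] show False
  proof
    assume "lex_less 0 d0"
    then have "det2 (c' - b) (b - a') \<ge> 0" using lex_pos_det2 lp s by blast
    then show False using ac' e1 by simp
  next
    assume "lex_less d0 0"
    then have "lex_less 0 (- d0)" by (simp add: lex_less_def)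
    then have "det2 (b - a) (c - b) \<ge> 0" using lex_pos_det2[of "- d0" "c - b" "b - a"] lp s neg by simp
    moreover have "det2 (b - a) (c - b) = - det2 (c - b) (b - a)" by (simp add: det2_def)
    ultimately show False using pos e1 by simp
  qed
qed

text \<open>Only the lexicographically middle one of the three points matters. In every case the
  hull order tells whether it is below a chord, and this fixes its side of the chord between the
  other two.\<close>

lemma hull_less_clockwise:
  assumes S: "a \<in> S" "b \<in> S" "c \<in> S" and ord: "hull_less S a b" "hull_less S b c"
  shows "det2 (b - a) (c - a) \<le> 0"
proof -
  have id: "det2 (b - a) (c - a) = - det2 (c - a) (b - a)"
    "det2 (b - a) (c - a) = - det2 (b - c) (a - c)"
    "det2 (b - a) (c - a) = det2 (a - c) (b - c)"
    by (simp_all add: det2_def algebra_simps)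
  note up = not_below_chord and low = below_chord_le
  have ne: "a \<noteq> b" "b \<noteq> c" "a \<noteq> c"
    using ord hull_less_trans[OF ord] by auto
  show ?thesis
  proof (cases "below_chord S b")
    case b: True
    then have c: "below_chord S c" "lex_less c b" using ord by (auto simp: hull_less_def)
    show ?thesis
    proof (cases "lex_less b a")
      case True
      then show ?thesis using low[OF S(3,2,1) c(2) True b] id by linarith
    next
      case False
      then have ab: "lex_less a b" "\<not> below_chord S a"
        using lex_less_total[OF ne(1)] ord b by (auto simp: hull_less_def split: if_splits)
      show ?thesis
      proof (cases "lex_less a c")
        case True
        then show ?thesis using low[OF S(1,3,2) True c(2) c(1)] by linarith
      next
        case False
        then have "lex_less c a" using lex_less_total[OF ne(3)] by blast
        then show ?thesis using up[OF S(3,2) _ ab] id by linarith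
      qed
    qed
  next
    case b: False
    then have a: "\<not> below_chord S a" "lex_less a b" using ord by (auto simp: hull_less_def split: if_splits)
    show ?thesis
    proof (cases "lex_less b c")
      case True
      then show ?thesis using up[OF S(1,3) a(2) True b] id by linarith
    next
      case False
      then have cb: "lex_less c b" "below_chord S c"
        using lex_less_total[OF ne(2)] ord b by (auto simp: hull_less_def split: if_splits)
      show ?thesis
      proof (cases "lex_less a c")
        case True
        then show ?thesis using low[OF S(1,3,2) True cb] by linarith
      next
        case False
        then have "lex_less c a" using lex_less_total[OF ne(3)] by blast
        then show ?thesis using up[OF S(3,2) _ a(2,1)] id by linarith
      qed
    qed
  qed
qed

text \<open>A chord that passes above \<open>b\<close> has an endpoint \<open>y\<close> strictly
  above the line \<open>z w\<close>, and then a chord from \<open>y\<close> to \<open>z\<close> or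
  to \<open>w\<close> passes above \<open>x\<close>. So all sources strictly inside a chord through
  them belong to the same pass along the hull, which settles collinear quadruples.\<close>

lemma below_chord_collinear:
  assumes "z \<in> S" "w \<in> S" "lex_less z b" "lex_less b w" "det2 (w - z) (b - z) = 0" "below_chord S b"
    and "lex_less z x" "lex_less x w" "det2 (w - z) (x - z) = 0"
  shows "below_chord S x"
proof -
  obtain a c where ac: "a \<in> S" "c \<in> S" "lex_less a b" "lex_less b c" "det2 (c - a) (b - a) < 0"
    using assms(6) unfolding below_chord_def by blast
  have zw: "lex_less 0 (w - z)" using assms lex_less_trans lex_less_diff by blast
  have ab: "lex_less 0 (b - a)" "lex_less 0 (c - b)" using ac lex_less_diff by auto
  have "det2 (w - z) (a - z) > 0 \<or> det2 (w - z) (c - z) > 0"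
  proof (rule ccontr)
    assume "\<not> ?thesis"
    then have "det2 (w - z) (b - a) \<ge> 0" "det2 (w - z) (c - b) \<le> 0"
      using assms(5) by (auto simp: det2_def algebra_simps)
    then have "det2 (c - b) (b - a) \<ge> 0" using lex_pos_det2 zw ab by blast
    then show False using ac by (simp add: det2_def algebra_simps)
  qed
  then obtain y where y: "y \<in> S" "det2 (w - z) (y - z) > 0" using ac by blast
  have "y \<noteq> x" using y assms by auto
  have xr: "\<exists>r. x = z + r *\<^sub>R (w - z) \<and> 0 < r \<and> r < 1"
  proof -
    have "x \<in> closed_segment z w" using collinear_lex_between assms by blast
    then obtain r where r: "0 \<le> r" "r \<le> 1" "x = z + r *\<^sub>R (w - z)"
      by (auto simp: in_segment algebra_simps)
    moreover have "r \<noteq> 0" "r \<noteq> 1" using r assms by auto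
    ultimately show ?thesis by force
  qed
  then obtain r where r: "x = z + r *\<^sub>R (w - z)" "0 < r" "r < 1" by blast
  from lex_less_total[OF \<open>y \<noteq> x\<close>] show ?thesis
  proof
    assume "lex_less y x"
    moreover have "det2 (w - y) (x - y) = - ((1 - r) * det2 (w - z) (y - z))"
      by (simp add: r det2_def algebra_simps)
    then have "det2 (w - y) (x - y) < 0" using y r(2,3) by simp
    ultimately show ?thesis using y assms unfolding below_chord_def by blast
  next
    assume "lex_less x y"
    moreover have "det2 (y - z) (x - z) = - (r * det2 (w - z) (y - z))"
      by (simp add: r det2_def algebra_simps)
    then have "det2 (y - z) (x - z) < 0" using y r(2,3) by simp
    ultimately show ?thesis using y assms unfolding below_chord_def by blast
  qed
qed


lemma hull_less_separated:
  assumes S: "a \<in> S" "b \<in> S" "c \<in> S" "d \<in> S"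
    and ord: "hull_less S a b" "hull_less S b c" "hull_less S c d"
  shows "separated a c b d" "separated b d c a"
proof -
  have ord': "hull_less S a c" "hull_less S b d" "hull_less S a d"
    using ord hull_less_trans by blast+
  have ne: "a \<noteq> b" "a \<noteq> c" "a \<noteq> d" "b \<noteq> c" "b \<noteq> d" "c \<noteq> d" using ord ord' by auto
  have t: "det2 (b - a) (c - a) \<le> 0" "det2 (b - a) (d - a) \<le> 0" "det2 (c - a) (d - a) \<le> 0"
    "det2 (c - b) (d - b) \<le> 0"
    using hull_less_clockwise ord ord' S by blast+
  have cyc: "det2 (c - b) (a - b) = det2 (b - a) (c - a)" "det2 (d - b) (a - b) = det2 (b - a) (d - a)"
    "det2 (d - c) (a - c) = det2 (c - a) (d - a)"
    by (simp_all add: det2_def algebra_simps)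
  have col: "det2 (y - z) (w - z) = 0"
    if l: "det2 (v - u) (y - u) = 0" "det2 (v - u) (z - u) = 0" "det2 (v - u) (w - u) = 0" "u \<noteq> v"
    for u v w y z
  proof -
    obtain i j k where e: "y = u + i *\<^sub>R (v - u)" "z = u + j *\<^sub>R (v - u)" "w = u + k *\<^sub>R (v - u)"
      using det2_eq_0D[OF l(1,4)] det2_eq_0D[OF l(2,4)] det2_eq_0D[OF l(3,4)] by metis
    show ?thesis by (simp add: e det2_def algebra_simps)
  qed
  have seg: "x \<in> closed_segment y z" if "det2 (z - y) (x - y) = 0"
    "lex_less y x \<and> lex_less x z \<or> lex_less z x \<and> lex_less x y" for x y z
  proof -
    have "det2 (y - z) (x - z) = 0" using that(1) by (simp add: det2_def algebra_simps)
    then show ?thesis using that collinear_lex_between closed_segment_commute by metis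
  qed
  have tot: "lex_less x y \<or> lex_less y x" if "x \<noteq> y" for x y
    using lex_less_total[OF that] .
  note fl = ord[unfolded hull_less_def]
  show "separated a c b d"
  proof (cases "det2 (c - a) (b - a) = 0 \<and> det2 (c - a) (d - a) = 0")
    case False
    then show ?thesis using clockwise_separated t ne by metis
  next
    case True
    have z: "det2 (c - a) (a - a) = 0" "det2 (c - a) (c - a) = 0" by (simp_all add: det2_def)
    have cl: "det2 (b - d) (c - d) = 0" "det2 (b - d) (a - d) = 0"
      using col True z ne by blast+
    \<comment> \<open>All four points are collinear here. If neither \<open>b\<close> nor
      \<open>d\<close> were between \<open>a\<close> and \<open>c\<close>, the hull order would
      place both \<open>a\<close> and \<open>c\<close> strictly between \<open>d\<close> and
      \<open>b\<close>, with \<open>c\<close> below a chord and \<open>a\<close> not.\<close>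
    have "(lex_less a b \<and> lex_less b c \<or> lex_less c b \<and> lex_less b a) \<or>
      (lex_less a d \<and> lex_less d c \<or> lex_less c d \<and> lex_less d a)"
    proof (rule ccontr)
      assume n: "\<not> ?thesis"
      then have "lex_less d a" "lex_less a b" "lex_less d c" "lex_less c b" "below_chord S c" "\<not> below_chord S a"
        using fl tot[OF ne(1)] tot[OF ne(2)] tot[OF ne(3)] tot[OF ne(4)] tot[OF ne(5)] tot[OF ne(6)]
        by (auto split: if_splits dest: lex_less_trans lex_less_asym)
      then show False using below_chord_collinear[of d b c a] S cl by blast
    qed
    then show ?thesis using seg[of c a b] seg[of c a d] True unfolding separated_def by blast
  qed
  show "separated b d c a"
  proof (cases "det2 (d - b) (c - b) = 0 \<and> det2 (d - b) (a - b) = 0")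
    case False
    then show ?thesis using clockwise_separated[of b d c a] t ne unfolding cyc by metis
  next
    case True
    have z: "det2 (d - b) (b - b) = 0" "det2 (d - b) (d - b) = 0" by (simp_all add: det2_def)
    have cl: "det2 (c - a) (d - a) = 0" "det2 (c - a) (b - a) = 0"
      using col True z ne by blast+
    have "(lex_less b c \<and> lex_less c d \<or> lex_less d c \<and> lex_less c b) \<or>
      (lex_less b a \<and> lex_less a d \<or> lex_less d a \<and> lex_less a b)"
    proof (rule ccontr)
      assume n: "\<not> ?thesis"
      then have "lex_less a b" "lex_less b c" "lex_less a d" "lex_less d c" "below_chord S d" "\<not> below_chord S b"
        using fl tot[OF ne(1)] tot[OF ne(2)] tot[OF ne(3)] tot[OF ne(4)] tot[OF ne(5)] tot[OF ne(6)]
        by (auto split: if_splits dest: lex_less_trans lex_less_asym)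
      then show False using below_chord_collinear[of a c d b] S cl by blast
    qed
    then show ?thesis using seg[of d b c] seg[of d b a] True unfolding separated_def by blast
  qed
qed

text \<open>If \<open>y\<close> were in \<open>H\<close> beyond \<open>c\<close>, the supporting
  line at \<open>c\<close> would have \<open>a\<close> and \<open>y\<close> on opposite sides of
  \<open>c\<close>, so it would be the line through the chord; but \<open>H\<close> has points
  strictly on both sides of that line. The argument at \<open>a\<close> is the same.\<close>

lemma chord_Int:
  assumes "a \<in> S" "c \<in> S" "b \<in> H" "d \<in> H" "a \<noteq> c"
    and opp: "det2 (c - a) (b - a) * det2 (c - a) (d - a) < 0"
    and y: "y \<in> H" "det2 (c - a) (y - a) = 0"
  shows "y \<in> closed_segment a c"
proof -
  obtain r where r: "y = a + r *\<^sub>R (c - a)" using det2_eq_0D y assms by metis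
  \<comment> \<open>A vector \<open>m\<close> orthogonal to the chord is a multiple of its quarter
    turn, so \<open>m \<bullet> x\<close> is proportional to \<open>det2 (c - a) x\<close> and takes
    opposite signs at \<open>b\<close> and \<open>d\<close>.\<close>
  have flat: False if "m \<noteq> 0" "m \<bullet> (c - a) = 0" "m \<bullet> (b - a) \<le> 0" "m \<bullet> (d - a) \<le> 0" for m :: point
  proof -
    have "fst m * fst (c - a) + snd m * snd (c - a) = 0" using that by (simp add: inner_prod_def)
    moreover define k where "k = (c - a) \<bullet> (c - a)"
    have kk: "k > 0" unfolding k_def using assms by simp
    define l where "l = snd m * fst (c - a) - fst m * snd (c - a)"
    have "k *\<^sub>R m = l *\<^sub>R (- snd (c - a), fst (c - a))"
      unfolding k_def l_def prod_eq_iff using calculation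
      by (simp add: inner_prod_def) algebra
    then have "(k *\<^sub>R m) \<bullet> x = (l *\<^sub>R (- snd (c - a), fst (c - a))) \<bullet> x" for x
      by simp
    moreover have "(l *\<^sub>R (- snd (c - a), fst (c - a))) \<bullet> x = l * det2 (c - a) x" for x
      by (simp add: inner_prod_def det2_def algebra_simps)
    ultimately have km: "k * (m \<bullet> x) = l * det2 (c - a) x" for x
      by simp
    have "l * det2 (c - a) (b - a) \<le> 0" "l * det2 (c - a) (d - a) \<le> 0"
      using that kk by (auto simp: km[symmetric] mult_le_0_iff)
    then have "0 \<le> (l * det2 (c - a) (b - a)) * (l * det2 (c - a) (d - a))" by (rule mult_nonpos_nonpos)
    also have "\<dots> = l^2 * (det2 (c - a) (b - a) * det2 (c - a) (d - a))" by (simp add: power2_eq_square)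
    finally have "l = 0" using opp by (smt (verit) mult_pos_neg zero_less_power2)
    then have "k *\<^sub>R m = 0"
      using \<open>k *\<^sub>R m = l *\<^sub>R (- snd (c - a), fst (c - a))\<close> by (simp add: prod_eq_iff)
    then show False using that kk by simp
  qed
  have "r \<le> 1"
  proof (rule ccontr)
    assume r1: "\<not> r \<le> 1"
    obtain m where m: "m \<noteq> 0" "\<And>y. y \<in> H \<Longrightarrow> m \<bullet> (y - c) \<le> 0" using normal assms by metis
    have "m \<bullet> (a - c) \<le> 0" using m assms S_H by blast
    moreover have "m \<bullet> (y - c) = (1 - r) * (m \<bullet> (a - c))" by (simp add: r algebra_simps)
    then have "(1 - r) * (m \<bullet> (a - c)) \<le> 0" using m y by metis
    ultimately have z: "m \<bullet> (a - c) = 0" using r1 by (simp add: mult_le_0_iff)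
    have "m \<bullet> (b - a) \<le> 0" "m \<bullet> (d - a) \<le> 0" "m \<bullet> (c - a) = 0"
      using m(2)[of b] m(2)[of d] z assms by (auto simp: inner_diff_right)
    then show False using flat m by blast
  qed
  moreover have "0 \<le> r"
  proof (rule ccontr)
    assume r1: "\<not> 0 \<le> r"
    obtain m where m: "m \<noteq> 0" "\<And>y. y \<in> H \<Longrightarrow> m \<bullet> (y - a) \<le> 0" using normal assms by metis
    have "m \<bullet> (c - a) \<le> 0" using m assms S_H by blast
    moreover have "m \<bullet> (y - a) = r * (m \<bullet> (c - a))" by (simp add: r)
    then have "r * (m \<bullet> (c - a)) \<le> 0" using m y by metis
    ultimately have z: "m \<bullet> (c - a) = 0" using r1 by (simp add: mult_le_0_iff)
    then show False using flat m assms by blast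
  qed
  ultimately show ?thesis using r closed_segmentI2 by blast
qed


end

section \<open>Nearest Steiner points\<close>

text \<open>
  Ties are broken lexicographically, since of two sites on opposite sides of \<open>p\<close> one is smaller than
  \<open>p\<close>. This excludes four sites seen from \<open>p\<close> at right angles.
\<close>

definition nearest_site :: "point set \<Rightarrow> point \<Rightarrow> point \<Rightarrow> bool" where
  "nearest_site Q x p \<longleftrightarrow> p \<in> Q \<and>
     (\<forall>q\<in>Q. dist x p \<le> dist x q \<and> (dist x p = dist x q \<longrightarrow> q = p \<or> lex_less p q))"

text \<open>The squared distance of \<open>x\<close> to \<open>p\<close> minus that to
  \<open>q\<close>, so it is positive iff \<open>x\<close> is nearer to \<open>q\<close>. The
  squares of \<open>x\<close> cancel: the function is affine and controlled on a segment by the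
  ends.\<close>

definition bisect :: "point \<Rightarrow> point \<Rightarrow> point \<Rightarrow> real" where
  "bisect p q x = 2 * ((x - p) \<bullet> (q - p)) - (q - p) \<bullet> (q - p)"

lemma bisect_dist: "(dist x q)\<^sup>2 = (dist x p)\<^sup>2 - bisect p q x"
proof -
  have "(dist x q)\<^sup>2 = (x - q) \<bullet> (x - q)" "(dist x p)\<^sup>2 = (x - p) \<bullet> (x - p)"
    by (simp_all add: dist_norm power2_norm_eq_inner)
  then show ?thesis
    by (simp add: bisect_def inner_diff_left inner_diff_right inner_commute)
qed

lemma bisect_le_iff: "bisect p q x \<le> 0 \<longleftrightarrow> dist x p \<le> dist x q"
proof -
  have "dist x p \<le> dist x q \<longleftrightarrow> (dist x p)\<^sup>2 \<le> (dist x q)\<^sup>2"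
    by (simp add: abs_le_square_iff[symmetric])
  then show ?thesis using bisect_dist[of x q p] by linarith
qed

lemma bisect_eq_iff: "bisect p q x = 0 \<longleftrightarrow> dist x p = dist x q"
proof -
  have "dist x p = dist x q \<longleftrightarrow> (dist x p)\<^sup>2 = (dist x q)\<^sup>2"
    by simp
  then show ?thesis using bisect_dist[of x q p] by linarith
qed

lemma bisect_affine: "bisect p q ((1 - r) *\<^sub>R x + r *\<^sub>R y) = (1 - r) * bisect p q x + r * bisect p q y"
  by (simp add: bisect_def algebra_simps)

lemma det2_affine: "det2 (c - a) (((1 - r) *\<^sub>R x + r *\<^sub>R y) - a) =
  (1 - r) * det2 (c - a) (x - a) + r * det2 (c - a) (y - a)"
  by (simp add: det2_def algebra_simps)

lemma det2_sign_change:
  assumes "det2 (c - a) (x - a) * det2 (c - a) (y - a) \<le> 0"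
  obtains z where "z \<in> closed_segment x y" "det2 (c - a) (z - a) = 0"
proof (cases "det2 (c - a) (x - a) = det2 (c - a) (y - a)")
  case True
  then have "det2 (c - a) (x - a) * det2 (c - a) (x - a) \<le> 0" using assms by simp
  then have "det2 (c - a) (x - a) = 0" by (metis mult_eq_0_iff not_square_less_zero order_le_less)
  then show ?thesis using that by blast
next
  case False
  define f g where "f = det2 (c - a) (x - a)" and "g = det2 (c - a) (y - a)"
  define r where "r = f / (f - g)"
  have fg: "f * g \<le> 0" "f \<noteq> g" using assms False by (auto simp: f_def g_def)
  have "0 \<le> r \<and> r \<le> 1"
  proof (cases "f > g")
    case True
    then have "f \<ge> 0" "g \<le> 0" using fg by (auto simp: mult_le_0_iff)
    then show ?thesis using True by (simp add: r_def divide_simps)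
  next
    case False
    then have "f \<le> 0" "g \<ge> 0" using fg by (auto simp: mult_le_0_iff)
    then show ?thesis using False fg by (auto simp: r_def divide_simps)
  qed
  moreover have "(1 - r) * f + r * g = 0"
    using fg by (simp add: r_def divide_simps)
  ultimately show ?thesis
    using that[of "(1 - r) *\<^sub>R x + r *\<^sub>R y"] by (auto simp: det2_affine in_segment f_def g_def)
qed

text \<open>Being no farther from \<open>p\<close> than from \<open>q\<close> pushes
  \<open>y\<close> at least half way towards \<open>q'\<close>, and conversely, as the inner product
  \<open>c\<close> is nonnegative. So \<open>y\<close> is the midpoint, and there the inequalities
  leave only \<open>c = 0\<close>. This equality case is the one that the tie-breaking has to
  exclude.\<close>

lemma bisect_between:
  assumes "bisect p q y \<le> 0" "bisect p q' y \<le> 0" "y \<in> closed_segment q q'" "p \<noteq> q" "p \<noteq> q'"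
    "(q - p) \<bullet> (q' - p) \<ge> 0"
  shows "(q - p) \<bullet> (q' - p) = 0 \<and> bisect p q y = 0 \<and> bisect p q' y = 0"
proof -
  obtain r where r: "0 \<le> r" "r \<le> 1" "y = (1 - r) *\<^sub>R q + r *\<^sub>R q'" using assms by (auto simp: in_segment)
  define N N' c where "N = (q - p) \<bullet> (q - p)" and "N' = (q' - p) \<bullet> (q' - p)" and "c = (q - p) \<bullet> (q' - p)"
  have pos: "N > 0" "N' > 0" "c \<ge> 0" using assms by (auto simp: N_def N'_def c_def)
  have y: "y - p = (1 - r) *\<^sub>R (q - p) + r *\<^sub>R (q' - p)" by (simp add: r algebra_simps)
  have b1: "bisect p q y = 2 * ((1 - r) * N + r * c) - N"
    unfolding bisect_def y by (simp add: inner_add_left N_def c_def inner_commute[of "q' - p" "q - p"])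
  have b2: "bisect p q' y = 2 * ((1 - r) * c + r * N') - N'"
    unfolding bisect_def y by (simp add: inner_add_left N'_def c_def)
  have "(1 - 2 * r) * N \<le> - 2 * (r * c)" using assms(1) b1 by (simp add: algebra_simps)
  moreover have rc: "r * c \<ge> 0" using r pos by simp
  ultimately have "(1 - 2 * r) * N \<le> 0" by linarith
  then have "r \<ge> 1/2" using pos by (simp add: mult_le_0_iff)
  have "(2 * r - 1) * N' \<le> - 2 * ((1 - r) * c)" using assms(2) b2 by (simp add: algebra_simps)
  moreover have "(1 - r) * c \<ge> 0" using r pos by simp
  ultimately have "(2 * r - 1) * N' \<le> 0" by linarith
  then have "r \<le> 1/2" using pos by (simp add: mult_le_0_iff)
  then have r2: "r = 1/2" using \<open>r \<ge> 1/2\<close> by simp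
  show ?thesis using assms(1,2) pos unfolding b1 b2 c_def[symmetric] unfolding r2 by simp
qed

context convex_boundary
begin

text \<open>
  The polyline \<open>b, q, q', d\<close> connects the two sides of the chord \<open>a c\<close>. It avoids the cell of \<open>p\<close>,
  which contains the chord, unless \<open>q\<close> and \<open>q'\<close> are seen from \<open>p\<close> under an angle of at least 90 degrees.
\<close>

lemma separated_sites:
  assumes S: "a \<in> S" "b \<in> S" "c \<in> S" "d \<in> S" and sep: "separated a c b d" and "a \<noteq> c" and Q: "Q \<subseteq> H"
    and p: "nearest_site Q a p" "nearest_site Q c p"
    and q: "nearest_site Q b q" "nearest_site Q d q'" and ne: "p \<noteq> q" "p \<noteq> q'"
  shows "(q - p) \<bullet> (q' - p) \<le> 0" "lex_less q p \<or> lex_less q' p \<Longrightarrow> (q - p) \<bullet> (q' - p) < 0"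
proof -
  have mem: "p \<in> Q" "q \<in> Q" "q' \<in> Q" using p q by (auto simp: nearest_site_def)
  \<comment> \<open>Ties go to the smaller site, so a site smaller than \<open>p\<close> cannot even
    tie with \<open>p\<close> at an end of the chord; this gives the strict version.\<close>
  have chord: "bisect p r y \<le> 0 \<and> (lex_less r p \<longrightarrow> bisect p r y < 0)"
    if r: "r \<in> Q" "r \<noteq> p" and y: "y \<in> closed_segment a c" for r y
  proof -
    have "bisect p r x \<le> 0" "lex_less r p \<longrightarrow> bisect p r x \<noteq> 0" if "nearest_site Q x p" for x
      using that \<open>r \<in> Q\<close> \<open>r \<noteq> p\<close> unfolding nearest_site_def bisect_le_iff bisect_eq_iff
      by (auto dest: lex_less_asym)
    then have b: "bisect p r a \<le> 0" "bisect p r c \<le> 0"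
      "lex_less r p \<Longrightarrow> bisect p r a < 0" "lex_less r p \<Longrightarrow> bisect p r c < 0"
      using p by (meson order_le_imp_less_or_eq)+
    obtain l where l: "0 \<le> l" "l \<le> 1" "y = (1 - l) *\<^sub>R a + l *\<^sub>R c"
      using y by (auto simp: in_segment)
    have "(1 - l) * bisect p r a \<le> 0" "l * bisect p r c \<le> 0"
      using l b by (auto simp: mult_le_0_iff)
    moreover have "(1 - l) * bisect p r a < 0 \<or> l * bisect p r c < 0" if "lex_less r p"
      using l b that by (cases "l = 0") (auto simp: mult_pos_neg)
    ultimately show ?thesis unfolding l bisect_affine by linarith
  qed
  have spoke: "bisect p r y \<ge> 0 \<and> (\<not> lex_less r p \<longrightarrow> bisect p r y > 0)"
    if x: "nearest_site Q x r" "r \<noteq> p" and y: "y \<in> closed_segment x r" for x r y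
  proof -
    have "bisect p r x \<ge> 0 \<and> (\<not> lex_less r p \<longrightarrow> bisect p r x > 0)"
    proof -
      have "dist x r \<le> dist x p" "dist x r = dist x p \<longrightarrow> p = r \<or> lex_less r p"
        using x(1) mem unfolding nearest_site_def by auto
      then show ?thesis using x(2) bisect_le_iff[of p r x] bisect_eq_iff[of p r x]
        by (cases "dist x r = dist x p") auto
    qed
    moreover have "bisect p r r > 0" using x by (simp add: bisect_def)
    moreover obtain l where l: "0 \<le> l" "l \<le> 1" "y = (1 - l) *\<^sub>R x + l *\<^sub>R r"
      using y by (auto simp: in_segment)
    moreover have "(1 - l) * bisect p r x \<ge> 0" "l * bisect p r r \<ge> 0" using calculation by auto
    moreover have "(1 - l) * bisect p r x > 0 \<or> l * bisect p r r > 0" if "\<not> lex_less r p"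
      using calculation that by (cases "l = 0") auto
    ultimately show ?thesis unfolding l bisect_affine by linarith
  qed
  \<comment> \<open>On the chord \<open>bisect\<close> is at most 0, strictly if the other site is
    smaller than \<open>p\<close>; on a spoke it is at least 0, strictly if it is not smaller. One
    of the two is always strict.\<close>
  have disj: "y \<notin> closed_segment a c" if "y \<in> closed_segment b q \<or> y \<in> closed_segment d q'" for y
    using that chord[of q y] chord[of q' y] spoke[OF q(1), of y] spoke[OF q(2), of y] ne mem by force
  \<comment> \<open>The segment from \<open>b\<close> to \<open>q\<close> cannot cross the line
    through \<open>a\<close> and \<open>c\<close>: the crossing would be in \<open>H\<close>, hence
    on the chord, which the spokes avoid. So \<open>q\<close> is on the side of \<open>b\<close>,
    likewise \<open>q'\<close> on the side of \<open>d\<close>, and the segment between the sites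
    has to cross the chord.\<close>
  have "\<exists>y \<in> closed_segment a c. y \<in> closed_segment q q'"
  proof -
    define f where "f x = det2 (c - a) (x - a)" for x
    have opp: "f b * f d < 0"
      using sep disj[of b] disj[of d] unfolding separated_def f_def by auto
    have H: "closed_segment x y \<subseteq> H" if "x \<in> H" "y \<in> H" for x y
      using that conv by (simp add: closed_segment_subset)
    have inH: "a \<in> H" "b \<in> H" "c \<in> H" "d \<in> H" "q \<in> H" "q' \<in> H" using S S_H Q mem by auto
    have cross: "\<exists>z \<in> closed_segment x y. z \<in> closed_segment a c" if "x \<in> H" "y \<in> H" "f x * f y \<le> 0" for x y
      using det2_sign_change[of c a x y] chord_Int[OF S(1,3) inH(2,4) \<open>a \<noteq> c\<close>] opp that H[OF that(1,2)]
      unfolding f_def by (metis subsetD)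
    have "\<not> f b * f q \<le> 0" "\<not> f d * f q' \<le> 0" using cross inH disj by blast+
    then have "f q * f q' \<le> 0" using opp
      by (smt (verit) mult_less_0_iff zero_less_mult_iff)
    then show ?thesis using cross inH by blast
  qed
  then obtain y where y: "y \<in> closed_segment a c" "y \<in> closed_segment q q'" by blast
  have b: "bisect p q y \<le> 0" "bisect p q' y \<le> 0" using chord y mem ne by auto
  show "(q - p) \<bullet> (q' - p) \<le> 0"
    using bisect_between[OF b y(2) ne] by linarith
  show "(q - p) \<bullet> (q' - p) < 0" if "lex_less q p \<or> lex_less q' p"
    using bisect_between[OF b y(2) ne] chord[of q y] chord[of q' y] y mem ne that by force
qed

end

text \<open>Three vectors of the plane are dependent. If the coefficients of a relation have the
  same sign up to zeros, the cone \<open>C\<close> would contain 0. If one coefficient has the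
  opposite sign, take the inner product with its vector: no term compensates the nonzero square. For
  parallel \<open>u\<close> and \<open>v\<close> the Cramer relation may be trivial, so a relation
  is given directly.\<close>

lemma obtuse_triple:
  fixes u v w :: point
  assumes C: "C u" "C v" "C w" "\<not> C 0"
    and add: "\<And>x y. C x \<Longrightarrow> C y \<Longrightarrow> C (x + y)" and scale: "\<And>x r. C x \<Longrightarrow> 0 < r \<Longrightarrow> C (r *\<^sub>R x)"
    and le: "u \<bullet> v \<le> 0" "v \<bullet> w \<le> 0" "u \<bullet> w \<le> 0"
  shows False
proof -
  have nz: "u \<noteq> 0" "v \<noteq> 0" "w \<noteq> 0" using C by auto
  have id: "det2 v w *\<^sub>R u + det2 w u *\<^sub>R v + det2 u v *\<^sub>R w = 0"
    by (simp add: prod_eq_iff det2_def algebra_simps)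
  have pull: False if "r *\<^sub>R x + s *\<^sub>R y + k *\<^sub>R z = 0" "x \<bullet> z \<le> 0" "y \<bullet> z \<le> 0" "z \<noteq> 0"
    "r \<ge> 0 \<and> s \<ge> 0 \<and> k < 0 \<or> r \<le> 0 \<and> s \<le> 0 \<and> k > 0" for x y z :: point and r s k
  proof -
    have "(r *\<^sub>R x + s *\<^sub>R y + k *\<^sub>R z) \<bullet> z = 0" using that(1) by simp
    then have e: "r * (x \<bullet> z) + s * (y \<bullet> z) + k * (z \<bullet> z) = 0" by (simp add: inner_add_left)
    have z: "z \<bullet> z > 0" using that(4) by simp
    from that(5) show False
    proof
      assume a: "r \<ge> 0 \<and> s \<ge> 0 \<and> k < 0"
      then have "r * (x \<bullet> z) \<le> 0" "s * (y \<bullet> z) \<le> 0" "k * (z \<bullet> z) < 0"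
        using that(2,3) z by (simp_all add: mult_le_0_iff mult_neg_pos)
      then show False using e by linarith
    next
      assume a: "r \<le> 0 \<and> s \<le> 0 \<and> k > 0"
      then have "r * (x \<bullet> z) \<ge> 0" "s * (y \<bullet> z) \<ge> 0" "k * (z \<bullet> z) > 0"
        using that(2,3) z by (simp_all add: mult_nonpos_nonpos)
      then show False using e by linarith
    qed
  qed
  have comb: "C (x + r *\<^sub>R y)" if "C x" "C y" "0 \<le> r" for x y :: point and r
    using add[OF that(1) scale[OF that(2), of r]] that by (cases "r = 0") auto
  have sum: False
    if "r *\<^sub>R x + s *\<^sub>R y + k *\<^sub>R z = 0" "r > 0" "s \<ge> 0" "k \<ge> 0" "C x" "C y" "C z" for x y z :: point and r s k
    using comb[OF comb[OF scale[OF that(5,2)] that(6,3)] that(7,4)] C(4) that(1) by simp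
  have rel: False
    if "r *\<^sub>R u + s *\<^sub>R v + k *\<^sub>R w = 0" "r \<noteq> 0 \<or> s \<noteq> 0 \<or> k \<noteq> 0" for r s k
  proof -
    have p: "s *\<^sub>R v + r *\<^sub>R u + k *\<^sub>R w = 0" "k *\<^sub>R w + r *\<^sub>R u + s *\<^sub>R v = 0"
      "r *\<^sub>R u + k *\<^sub>R w + s *\<^sub>R v = 0" "s *\<^sub>R v + k *\<^sub>R w + r *\<^sub>R u = 0"
      using that(1) by (simp_all add: algebra_simps)
    have "- (r *\<^sub>R u + s *\<^sub>R v + k *\<^sub>R w) = 0" using that(1) by simp
    then have n: "(- r) *\<^sub>R u + (- s) *\<^sub>R v + (- k) *\<^sub>R w = 0" by simp
    then have n': "(- s) *\<^sub>R v + (- r) *\<^sub>R u + (- k) *\<^sub>R w = 0" "(- k) *\<^sub>R w + (- r) *\<^sub>R u + (- s) *\<^sub>R v = 0"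
      by (simp_all add: algebra_simps)
    have sym: "v \<bullet> u \<le> 0" "w \<bullet> v \<le> 0" "w \<bullet> u \<le> 0" using le by (simp_all add: inner_commute)
    have mixed: "\<not> (r \<ge> 0 \<and> s \<ge> 0 \<and> k < 0 \<or> r \<le> 0 \<and> s \<le> 0 \<and> k > 0)"
      "\<not> (r \<ge> 0 \<and> k \<ge> 0 \<and> s < 0 \<or> r \<le> 0 \<and> k \<le> 0 \<and> s > 0)"
      "\<not> (s \<ge> 0 \<and> k \<ge> 0 \<and> r < 0 \<or> s \<le> 0 \<and> k \<le> 0 \<and> r > 0)"
      using pull[OF that(1) le(3,2) nz(3)] pull[OF p(3) le(1) sym(2) nz(2)] pull[OF p(4) sym(1,3) nz(1)]
      by blast+
    have pos: "\<not> (r > 0 \<and> s \<ge> 0 \<and> k \<ge> 0)" "\<not> (s > 0 \<and> r \<ge> 0 \<and> k \<ge> 0)" "\<not> (k > 0 \<and> r \<ge> 0 \<and> s \<ge> 0)"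
      using sum[OF that(1) _ _ _ C(1,2,3)] sum[OF p(1) _ _ _ C(2,1,3)] sum[OF p(2) _ _ _ C(3,1,2)]
      by blast+
    have neg: "\<not> (r < 0 \<and> s \<le> 0 \<and> k \<le> 0)" "\<not> (s < 0 \<and> r \<le> 0 \<and> k \<le> 0)" "\<not> (k < 0 \<and> r \<le> 0 \<and> s \<le> 0)"
      using sum[OF n _ _ _ C(1,2,3)] sum[OF n'(1) _ _ _ C(2,1,3)] sum[OF n'(2) _ _ _ C(3,1,2)]
      by auto
    show False using mixed pos neg that(2)
      by (cases r "0::real" rule: linorder_cases; cases s "0::real" rule: linorder_cases;
          cases k "0::real" rule: linorder_cases) auto
  qed
  show False
  proof (cases "det2 u v = 0")
    case True
    then obtain r where r: "v = r *\<^sub>R u" using det2_eq_0D[of u 0 v] nz by auto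
    then show False using rel[of "- r" 1 0] by simp
  next
    case False
    then show False using rel[OF id] by blast
  qed
qed

definition obtuse :: "point \<Rightarrow> point \<Rightarrow> point \<Rightarrow> bool" where
  "obtuse p q r \<longleftrightarrow> (q - p) \<bullet> (r - p) \<le> 0 \<and>
     (lex_less q p \<or> lex_less r p \<longrightarrow> (q - p) \<bullet> (r - p) < 0)"

lemma obtuse_commute: "obtuse p r q \<longleftrightarrow> obtuse p q r"
  by (auto simp: obtuse_def inner_commute)

text \<open>The borderline case is a cross of right angles. A site smaller than \<open>p\<close> has
  strictly obtuse angles with the other three, which then lie in an open half plane. If three of the
  sites are not smaller, these three lie in the cone of lexicographically positive vectors. Either
  way three pairwise non-acute directions share a convex cone without 0.\<close>

lemma four_obtuse_False:
  assumes ob: "obtuse p q0 q1" "obtuse p q0 q2" "obtuse p q0 q3" "obtuse p q1 q2" "obtuse p q1 q3" "obtuse p q2 q3"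
    and ne: "q0 \<noteq> p" "q1 \<noteq> p" "q2 \<noteq> p" "q3 \<noteq> p"
  shows False
proof -
  have lower: False if ob: "obtuse p x y" "obtuse p x z" "obtuse p x w" "obtuse p y z" "obtuse p z w" "obtuse p y w"
    and x: "lex_less x p" for x y z w
    using obtuse_triple[of "\<lambda>y. (x - p) \<bullet> y < 0" "y - p" "z - p" "w - p"] that
    by (simp add: obtuse_def inner_add_right mult_pos_neg)
  have "\<not> lex_less q0 p" "\<not> lex_less q1 p" "\<not> lex_less q2 p"
    using lower[of q0 q1 q2 q3] lower[of q1 q0 q2 q3] lower[of q2 q0 q1 q3] ob obtuse_commute by blast+
  then have "lex_less 0 (q0 - p)" "lex_less 0 (q1 - p)" "lex_less 0 (q2 - p)"
    using ne lex_less_total[of q0 p] lex_less_total[of q1 p] lex_less_total[of q2 p]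
    by (simp_all add: lex_less_diff[of p])
  then show False
    using obtuse_triple[of "lex_less 0" "q0 - p" "q1 - p" "q2 - p"] ob lex_pos_add lex_pos_scale
    by (simp add: obtuse_def)
qed

section \<open>Cyclic alternation of the sources\<close>

lemma separated_commute:
  "separated c a b d = separated a c b d" "separated a c d b = separated a c b d"
proof -
  have "det2 (a - c) (x - c) = - det2 (c - a) (x - a)" for x
    by (simp add: det2_def algebra_simps)
  then show "separated c a b d = separated a c b d"
    by (simp add: separated_def closed_segment_commute)
qed (auto simp: separated_def mult.commute)

text \<open>Convex position, stated for positions because several of them may carry the same point:
  only cyclic neighbours within a quadruple are assumed to differ. Both diagonals are included,
  since a rotation exchanges them.\<close>

definition alternating :: "(nat \<Rightarrow> point) \<Rightarrow> nat \<Rightarrow> nat \<Rightarrow> bool" where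
  "alternating X u v \<longleftrightarrow> (\<forall>i j k l. u \<le> i \<and> i < j \<and> j < k \<and> k < l \<and> l < v \<and>
     X i \<noteq> X j \<and> X j \<noteq> X k \<and> X k \<noteq> X l \<and> X l \<noteq> X i \<longrightarrow>
     X i \<noteq> X k \<and> X j \<noteq> X l \<and> separated (X i) (X k) (X j) (X l) \<and> separated (X j) (X l) (X i) (X k))"

lemma alternating_rotate:
  assumes "alternating X 0 n" "\<And>p. X (p + n) = X p"
  shows "alternating X r (r + n)"
proof (induction r)
  case 0
  then show ?case using assms by simp
next
  case (Suc r)
  show ?case unfolding alternating_def
  proof (intro allI impI, elim conjE)
    fix i j k l
    assume *: "Suc r \<le> i" "i < j" "j < k" "k < l" "l < Suc r + n"
      "X i \<noteq> X j" "X j \<noteq> X k" "X k \<noteq> X l" "X l \<noteq> X i"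
    show "X i \<noteq> X k \<and> X j \<noteq> X l \<and> separated (X i) (X k) (X j) (X l) \<and> separated (X j) (X l) (X i) (X k)"
    \<comment> \<open>The new last position repeats the point of \<open>r\<close>, so the quadruple
      is cyclically \<open>r, i, j, k\<close>, which the induction hypothesis covers with the
      diagonals exchanged.\<close>
    proof (cases "l = r + n")
      case True
      then have Xl: "X l = X r" using assms by simp
      show ?thesis
        using Suc[unfolded alternating_def, rule_format, of r i j k] * True Xl
        by (auto simp: separated_commute)
    next
      case False
      then show ?thesis using Suc[unfolded alternating_def, rule_format, of i j k l] * by simp
    qed
  qed
qed

context convex_boundary
begin

lemma alternating_sorted:
  assumes "\<And>i. i < n \<Longrightarrow> X i \<in> S"
    and "\<And>i j. i < j \<Longrightarrow> j < n \<Longrightarrow> X i = X j \<or> hull_less S (X i) (X j)"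
  shows "alternating X 0 n"
  unfolding alternating_def
proof (intro allI impI, elim conjE)
  fix i j k l
  assume *: "0 \<le> i" "i < j" "j < k" "k < l" "l < n"
    "X i \<noteq> X j" "X j \<noteq> X k" "X k \<noteq> X l" "X l \<noteq> X i"
  have h: "hull_less S (X i) (X j)" "hull_less S (X j) (X k)" "hull_less S (X k) (X l)"
    using assms(2)[of i j] assms(2)[of j k] assms(2)[of k l] * by auto
  then have "hull_less S (X i) (X k)" "hull_less S (X j) (X l)" using hull_less_trans by blast+
  then show "X i \<noteq> X k \<and> X j \<noteq> X l \<and> separated (X i) (X k) (X j) (X l) \<and> separated (X j) (X l) (X i) (X k)"
    using hull_less_separated[OF _ _ _ _ h] assms(1)[of i] assms(1)[of j] assms(1)[of k] assms(1)[of l] *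
    by (auto simp: separated_commute(2)[of "X j" "X l" "X k" "X i"])
qed

end

section \<open>Voronoi cells along the cyclic order\<close>

locale voronoi_cells = convex_boundary +
  fixes Q :: "point set" and g :: "point \<Rightarrow> point" and X :: "nat \<Rightarrow> point" and u v :: nat
  assumes Q: "Q \<subseteq> H" and g: "\<And>x. x \<in> S \<Longrightarrow> nearest_site Q x (g x)"
    and X: "\<And>i. i < v \<Longrightarrow> X i \<in> S" and alt: "alternating X u v"
begin

lemma four_points:
  assumes "u \<le> i" "i < j" "j < k" "k < l" "l < v"
    and "g (X i) = p" "g (X k) = p" "g (X j) \<noteq> p" "g (X l) \<noteq> p"
  shows "obtuse p (g (X j)) (g (X l))"
proof -
  have ne: "X i \<noteq> X j" "X j \<noteq> X k" "X k \<noteq> X l" "X l \<noteq> X i" using assms by metis+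
  then have "X i \<noteq> X k \<and> separated (X i) (X k) (X j) (X l)"
    using alt assms unfolding alternating_def by blast
  moreover have "X i \<in> S" "X j \<in> S" "X k \<in> S" "X l \<in> S" using X assms by auto
  moreover have "nearest_site Q (X i) p" "nearest_site Q (X k) p" using calculation g assms by metis+
  ultimately show ?thesis
    using separated_sites[of "X i" "X j" "X k" "X l" Q p "g (X j)" "g (X l)"] g Q assms(8,9)
    by (auto simp: obtuse_def)
qed

lemma four_points':
  assumes "u \<le> i" "i < j" "j < k" "k < l" "l < v"
    and "g (X j) = p" "g (X l) = p" "g (X i) \<noteq> p" "g (X k) \<noteq> p"
  shows "obtuse p (g (X i)) (g (X k))"
proof -
  have ne: "X i \<noteq> X j" "X j \<noteq> X k" "X k \<noteq> X l" "X l \<noteq> X i" using assms by metis+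
  then have "X j \<noteq> X l \<and> separated (X j) (X l) (X i) (X k)"
    using alt assms unfolding alternating_def by blast
  moreover have "X i \<in> S" "X j \<in> S" "X k \<in> S" "X l \<in> S" using X assms by auto
  moreover have "nearest_site Q (X j) p" "nearest_site Q (X l) p" using calculation g assms by metis+
  ultimately show ?thesis
    using separated_sites[of "X j" "X i" "X l" "X k" Q p "g (X i)" "g (X k)"] g Q assms(8,9)
    by (auto simp: obtuse_def)
qed

text \<open>Two crossing cells are the case in which both sites seen from \<open>p\<close> coincide:
  a site would be seen at an obtuse angle to itself, so its squared distance to \<open>p\<close>
  would be at most 0.\<close>

lemma cells_noncrossing:
  assumes "u \<le> i" "i < j" "j < k" "k < l" "l < v" "g (X i) = g (X k)" "g (X j) = g (X l)"
  shows "g (X i) = g (X j)"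
proof (rule ccontr)
  assume ne: "g (X i) \<noteq> g (X j)"
  then have "(g (X j) - g (X i)) \<bullet> (g (X j) - g (X i)) \<le> 0"
    using four_points[OF assms(1-5) refl] assms(6,7) unfolding obtuse_def by metis
  then show False using ne by (metis eq_iff_diff_eq_0 inner_eq_zero_iff inner_ge_zero order_antisym)
qed

text \<open>Between any two of the four interruptions, and before the first of them, there is a
  source of \<open>p\<close>, so each pair gives an obtuse angle. As the cycle is cut open, it also
  has to be considered with an interruption in front, which is the primed version.\<close>

lemma no_four_alternations:
  assumes "u \<le> a0" "a0 < b0" "b0 < a1" "a1 < b1" "b1 < a2" "a2 < b2" "b2 < a3" "a3 < b3" "b3 < v"
    and "g (X a0) = p" "g (X a1) = p" "g (X a2) = p" "g (X a3) = p"
    and "g (X b0) \<noteq> p" "g (X b1) \<noteq> p" "g (X b2) \<noteq> p" "g (X b3) \<noteq> p"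
  shows False
proof (rule four_obtuse_False)
  show "obtuse p (g (X b0)) (g (X b1))" "obtuse p (g (X b0)) (g (X b2))" "obtuse p (g (X b0)) (g (X b3))"
    using assms by (auto intro: four_points[of a0 b0 a1])
  show "obtuse p (g (X b1)) (g (X b2))" "obtuse p (g (X b1)) (g (X b3))"
    using assms by (auto intro: four_points[of a0 b1 a2])
  show "obtuse p (g (X b2)) (g (X b3))"
    using assms by (auto intro: four_points[of a0 b2 a3])
qed (use assms in auto)

lemma no_four_alternations':
  assumes "u \<le> b0" "b0 < a0" "a0 < b1" "b1 < a1" "a1 < b2" "b2 < a2" "a2 < b3" "b3 < a3" "a3 < v"
    and "g (X a0) = p" "g (X a1) = p" "g (X a2) = p" "g (X a3) = p"
    and "g (X b0) \<noteq> p" "g (X b1) \<noteq> p" "g (X b2) \<noteq> p" "g (X b3) \<noteq> p"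
  shows False
proof (rule four_obtuse_False)
  show "obtuse p (g (X b0)) (g (X b1))" "obtuse p (g (X b0)) (g (X b2))" "obtuse p (g (X b0)) (g (X b3))"
    using assms by (auto intro: four_points'[of b0 a0 _ a3])
  show "obtuse p (g (X b1)) (g (X b2))" "obtuse p (g (X b1)) (g (X b3))"
    using assms by (auto intro: four_points'[of b1 a1 _ a3])
  show "obtuse p (g (X b2)) (g (X b3))"
    using assms by (auto intro: four_points'[of b2 a2 _ a3])
qed (use assms in auto)

end

section \<open>Execution of programs\<close>

lemma nmem_nupd [simp]: "nmem (nupd a i x s) = (nmem s)(a := (nmem s a)(i := x))"
  and rmem_nupd [simp]: "rmem (nupd a i x s) = rmem s"
  and nmem_rupd [simp]: "nmem (rupd a i y s) = nmem s"
  and rmem_rupd [simp]: "rmem (rupd a i y s) = (rmem s)(a := (rmem s a)(i := y))"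
  by (simp_all add: nupd_def rupd_def)

inductive_cases SkipE: "exec SKIP s k s'"
inductive_cases NAssignE: "exec (NAssign a i e) s k s'"
inductive_cases RAssignE: "exec (RAssign a i e) s k s'"
inductive_cases SeqE: "exec (Seq c d) s k s'"
inductive_cases IfE: "exec (If b c d) s k s'"
inductive_cases WhileE: "exec (While b c) s k s'"

lemma exec_deterministic:
  "exec c s k s' \<Longrightarrow> exec c s l t \<Longrightarrow> k = l \<and> s' = t"
proof (induction arbitrary: l t rule: exec.induct)
  case (Seq c s j s' d k s'')
  from Seq.prems show ?case by (rule SeqE) (use Seq.IH in blast)
next
  case (IfTrue b s c k s' d)
  from IfTrue.prems obtain i where "l = i + 1" "exec c s i t"
    by (rule IfE) (use IfTrue.hyps in auto)
  then show ?case using IfTrue.IH by blast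
next
  case (IfFalse b s d k s' c)
  from IfFalse.prems obtain i where "l = i + 1" "exec d s i t"
    by (rule IfE) (use IfFalse.hyps in auto)
  then show ?case using IfFalse.IH by blast
next
  case (WhileFalse b s c)
  from WhileFalse.prems show ?case by (rule WhileE) (use WhileFalse.hyps in auto)
next
  case (WhileTrue b s c j s' k s'')
  from WhileTrue.prems obtain i u m where "l = i + m + 1" "exec c s i u" "exec (While b c) u m t"
    by (rule WhileE) (use WhileTrue.hyps in auto)
  then show ?case using WhileTrue.IH by blast
qed (auto elim: SkipE NAssignE RAssignE)

lemma exec_pos: "exec c s k s' \<Longrightarrow> 1 \<le> k"
  by (induction rule: exec.induct) auto

fun nmods :: "com \<Rightarrow> nat set" where
  "nmods SKIP = {}"
| "nmods (NAssign a i e) = {a}"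
| "nmods (RAssign a i e) = {}"
| "nmods (Seq c d) = nmods c \<union> nmods d"
| "nmods (If b c d) = nmods c \<union> nmods d"
| "nmods (While b c) = nmods c"

fun rmods :: "com \<Rightarrow> nat set" where
  "rmods SKIP = {}"
| "rmods (NAssign a i e) = {}"
| "rmods (RAssign a i e) = {a}"
| "rmods (Seq c d) = rmods c \<union> rmods d"
| "rmods (If b c d) = rmods c \<union> rmods d"
| "rmods (While b c) = rmods c"

definition frame :: "com \<Rightarrow> state \<Rightarrow> state \<Rightarrow> bool" where
  "frame c s s' \<longleftrightarrow> (\<forall>a. a \<notin> nmods c \<longrightarrow> nmem s' a = nmem s a) \<and>
     (\<forall>a. a \<notin> rmods c \<longrightarrow> rmem s' a = rmem s a)"

lemma exec_frame: "exec c s k s' \<Longrightarrow> frame c s s'"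
  by (induction rule: exec.induct) (auto simp: frame_def)

lemma finite_nmods: "finite (nmods c)" and finite_rmods: "finite (rmods c)"
  by (induction c) auto

section \<open>A program inspects at most a constant number of cells per step\<close>

fun rsize :: "rexp \<Rightarrow> nat" where
  "rsize (RNat e) = 0"
| "rsize (RCell a i) = 1"
| "rsize (RAdd e f) = rsize e + rsize f"
| "rsize (RSub e f) = rsize e + rsize f"
| "rsize (RMul e f) = rsize e + rsize f"
| "rsize (RDiv e f) = rsize e + rsize f"
| "rsize (RSqrt e) = rsize e"

fun bsize :: "bexp \<Rightarrow> nat" where
  "bsize (NLess e f) = 0"
| "bsize (RLess e f) = rsize e + rsize f"
| "bsize (BNot b) = bsize b"
| "bsize (BAnd b c) = bsize b + bsize c"

fun csize :: "com \<Rightarrow> nat" where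
  "csize SKIP = 0"
| "csize (NAssign a i e) = 0"
| "csize (RAssign a i e) = rsize e"
| "csize (Seq c d) = csize c + csize d"
| "csize (If b c d) = bsize b + csize c + csize d"
| "csize (While b c) = bsize b + csize c"

fun rcells :: "nat \<Rightarrow> rexp \<Rightarrow> state \<Rightarrow> nat set" where
  "rcells r (RNat e) s = {}"
| "rcells r (RCell a i) s = (if a = r then {nval i s} else {})"
| "rcells r (RAdd e f) s = rcells r e s \<union> rcells r f s"
| "rcells r (RSub e f) s = rcells r e s \<union> rcells r f s"
| "rcells r (RMul e f) s = rcells r e s \<union> rcells r f s"
| "rcells r (RDiv e f) s = rcells r e s \<union> rcells r f s"
| "rcells r (RSqrt e) s = rcells r e s"

fun bcells :: "nat \<Rightarrow> bexp \<Rightarrow> state \<Rightarrow> nat set" where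
  "bcells r (NLess e f) s = {}"
| "bcells r (RLess e f) s = rcells r e s \<union> rcells r f s"
| "bcells r (BNot b) s = bcells r b s"
| "bcells r (BAnd b c) s = bcells r b s \<union> bcells r c s"

lemma rcells_card: "finite (rcells r e s) \<and> card (rcells r e s) \<le> rsize e"
  by (induction e) (auto intro!: order_trans[OF card_Un_le] add_mono)

lemma bcells_card: "finite (bcells r b s) \<and> card (bcells r b s) \<le> bsize b"
proof (induction b)
  case (RLess e f)
  then show ?case using rcells_card[of r e s] rcells_card[of r f s]
    by (auto intro!: order_trans[OF card_Un_le] add_mono)
qed (auto intro!: order_trans[OF card_Un_le] add_mono)

lemma nval_rupd [simp]: "nval e (rupd a i x s) = nval e s"
  by (induction e) auto

lemma rval_unread: "i \<notin> rcells r e s \<Longrightarrow> rval e (rupd r i x s) = rval e s"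
  by (induction e) (auto split: if_splits)

lemma bval_unread: "i \<notin> bcells r b s \<Longrightarrow> bval b (rupd r i x s) = bval b s"
  by (induction b) (auto simp: rval_unread)

lemma rupd_twice: "rupd a i x (rupd a i y s) = rupd a i x s"
  by (simp add: rupd_def)

lemma rupd_commute: "(a, i) \<noteq> (b, j) \<Longrightarrow> rupd a i x (rupd b j y s) = rupd b j y (rupd a i x s)"
  by (auto simp: rupd_def fun_upd_twist)

lemma nupd_rupd_commute: "nupd a i x (rupd b j y s) = rupd b j y (nupd a i x s)"
  by (simp add: nupd_def rupd_def)

text \<open>\<open>R\<close> collects the cells of real array \<open>r\<close> that the run reads.
  The final content \<open>y\<close> is existential because the program may overwrite the cell
  without reading it. Natural expressions never depend on reals, so both runs use the same
  addresses, and they branch alike because the cells compared in tests are in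
  \<open>R\<close>.\<close>

lemma exec_unread:
  "exec c s k s' \<Longrightarrow> \<exists>R. finite R \<and> card R \<le> csize c * k \<and>
     (\<forall>i x. i \<notin> R \<longrightarrow> (\<exists>y. exec c (rupd r i x s) k (rupd r i y s')))"
proof (induction rule: exec.induct)
  case (Skip s)
  then show ?case by (intro exI[of _ "{}"]) (auto intro: exec.Skip[simplified])
next
  case (NAssign a i e s)
  have "exec (NAssign a i e) (rupd r j x s) 1 (rupd r j x (nupd a (nval i s) (nval e s) s))" for j x
    using exec.NAssign[of a i e "rupd r j x s"] by (simp add: nupd_rupd_commute)
  then show ?case by (auto intro!: exI[of _ "{}"])
next
  case (RAssign a i e s)
  show ?case
  proof (intro exI[of _ "rcells r e s"] conjI allI impI)
    fix j x assume j: "j \<notin> rcells r e s"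
    have *: "exec (RAssign a i e) (rupd r j x s) 1 (rupd a (nval i s) (rval e s) (rupd r j x s))"
      using exec.RAssign[of a i e "rupd r j x s"] rval_unread[OF j, of x] by simp
    show "\<exists>y. exec (RAssign a i e) (rupd r j x s) 1 (rupd r j y (rupd a (nval i s) (rval e s) s))"
    proof (cases "a = r \<and> nval i s = j")
      case True
      then show ?thesis using * by (auto simp: rupd_twice intro!: exI[of _ "rval e s"])
    next
      case False
      then show ?thesis using * rupd_commute[of a "nval i s" r j "rval e s" x s] by auto
    qed
  qed (use rcells_card in auto)
next
  case (Seq c s j s' d k s'')
  then obtain R1 R2 where R: "finite R1" "card R1 \<le> csize c * j" "finite R2" "card R2 \<le> csize d * k"
    "\<And>i x. i \<notin> R1 \<Longrightarrow> \<exists>y. exec c (rupd r i x s) j (rupd r i y s')"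
    "\<And>i x. i \<notin> R2 \<Longrightarrow> \<exists>y. exec d (rupd r i x s') k (rupd r i y s'')" by metis
  have "card (R1 \<union> R2) \<le> csize c * j + csize d * k" using R card_Un_le[of R1 R2] by linarith
  also have "\<dots> \<le> csize (Seq c d) * (j + k)" by (simp add: algebra_simps)
  finally have "card (R1 \<union> R2) \<le> csize (Seq c d) * (j + k)" .
  moreover have "\<exists>y. exec (Seq c d) (rupd r i x s) (j + k) (rupd r i y s'')" if "i \<notin> R1 \<union> R2" for i x
    using R(5)[of i x] R(6)[of i] that exec.Seq by (metis UnCI)
  ultimately show ?case using R by (intro exI[of _ "R1 \<union> R2"]) auto
next
  case (IfTrue b s c k s' d)
  then obtain R where R: "finite R" "card R \<le> csize c * k"
    "\<And>i x. i \<notin> R \<Longrightarrow> \<exists>y. exec c (rupd r i x s) k (rupd r i y s')" by metis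
  have "card (R \<union> bcells r b s) \<le> csize c * k + bsize b"
    using R card_Un_le[of R "bcells r b s"] bcells_card[of r b s] by linarith
  also have "\<dots> \<le> csize (If b c d) * (k + 1)" by (simp add: algebra_simps)
  finally have "card (R \<union> bcells r b s) \<le> csize (If b c d) * (k + 1)" .
  moreover have "\<exists>y. exec (If b c d) (rupd r i x s) (k + 1) (rupd r i y s')" if "i \<notin> R \<union> bcells r b s" for i x
    using R(3)[of i x] that exec.IfTrue bval_unread IfTrue.hyps by (metis UnCI)
  ultimately show ?case using R bcells_card[of r b s] by (intro exI[of _ "R \<union> bcells r b s"]) auto
next
  case (IfFalse b s d k s' c)
  then obtain R where R: "finite R" "card R \<le> csize d * k"
    "\<And>i x. i \<notin> R \<Longrightarrow> \<exists>y. exec d (rupd r i x s) k (rupd r i y s')" by metis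
  have "card (R \<union> bcells r b s) \<le> csize d * k + bsize b"
    using R card_Un_le[of R "bcells r b s"] bcells_card[of r b s] by linarith
  also have "\<dots> \<le> csize (If b c d) * (k + 1)" by (simp add: algebra_simps)
  finally have "card (R \<union> bcells r b s) \<le> csize (If b c d) * (k + 1)" .
  moreover have "\<exists>y. exec (If b c d) (rupd r i x s) (k + 1) (rupd r i y s')" if "i \<notin> R \<union> bcells r b s" for i x
    using R(3)[of i x] that exec.IfFalse bval_unread IfFalse.hyps by (metis UnCI)
  ultimately show ?case using R bcells_card[of r b s] by (intro exI[of _ "R \<union> bcells r b s"]) auto
next
  case (WhileFalse b s c)
  have "\<exists>y. exec (While b c) (rupd r i x s) 1 (rupd r i y s)" if "i \<notin> bcells r b s" for i x
    using that exec.WhileFalse bval_unread WhileFalse.hyps by metis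
  then show ?case using bcells_card[of r b s] by (intro exI[of _ "bcells r b s"]) auto
next
  case (WhileTrue b s c j s' k s'')
  then obtain R1 R2 where R: "finite R1" "card R1 \<le> csize c * j" "finite R2" "card R2 \<le> csize (While b c) * k"
    "\<And>i x. i \<notin> R1 \<Longrightarrow> \<exists>y. exec c (rupd r i x s) j (rupd r i y s')"
    "\<And>i x. i \<notin> R2 \<Longrightarrow> \<exists>y. exec (While b c) (rupd r i x s') k (rupd r i y s'')" by metis
  let ?R = "R1 \<union> R2 \<union> bcells r b s"
  have "card ?R \<le> csize c * j + csize (While b c) * k + bsize b"
    using R card_Un_le[of R1 R2] card_Un_le[of "R1 \<union> R2" "bcells r b s"] bcells_card[of r b s] by linarith
  also have "\<dots> \<le> csize (While b c) * (j + k + 1)" by (simp add: algebra_simps)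
  finally have "card ?R \<le> csize (While b c) * (j + k + 1)" .
  moreover have "\<exists>y. exec (While b c) (rupd r i x s) (j + k + 1) (rupd r i y s'')" if "i \<notin> ?R" for i x
    using R(5)[of i x] R(6)[of i] that exec.WhileTrue bval_unread WhileTrue.hyps by (metis UnCI)
  ultimately show ?case using R bcells_card[of r b s] by (intro exI[of _ ?R]) auto
qed

lemma star_cost_nonneg: "0 \<le> star_cost t A p"
  unfolding star_cost_def by (intro add_nonneg_nonneg sum_list_nonneg) auto

lemma weber_cost_le: "weber_cost t A \<le> star_cost t A p"
  unfolding weber_cost_def by (rule cINF_lower[OF bdd_belowI2[OF star_cost_nonneg]]) simp

lemma weber_cost_geI: "(\<And>p. x \<le> star_cost t A p) \<Longrightarrow> x \<le> weber_cost t A"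
  unfolding weber_cost_def by (auto intro!: cINF_greatest)

lemma weber_cost_nonneg: "0 \<le> weber_cost t A"
  by (simp add: weber_cost_geI star_cost_nonneg)

text \<open>A source that is never read could be moved away without any effect on the output.\<close>

lemma weber_program_linear_time:
  assumes W: "weber_program W T" and "\<epsilon> > 0"
  shows "real n \<le> real (csize W) * T n \<epsilon>" "1 \<le> T n \<epsilon>"
proof -
  \<comment> \<open>All sources are put on the sink. The optimum is 0, so a relative error leaves no
    slack and the value returned is at most 0, whereas a single source at distance 1 forces at least
    1. Moving it along the first axis changes just one cell of array 1.\<close>
  define s0 where "s0 = \<lparr>nmem = (\<lambda>a i. n), rmem = (\<lambda>a i. if a = 0 \<and> i = 0 then \<epsilon> else 0)\<rparr>"
  let ?A = "replicate n (0, 0) :: point list" and ?t = "(0, 0) :: point"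
  have inp: "holds_input \<epsilon> ?t ?A s0" by (simp add: holds_input_def s0_def)
  obtain k s' where ks: "exec W s0 k s'" "real k \<le> T n \<epsilon>" "rmem s' 3 0 \<le> (1 + \<epsilon>) * weber_cost ?t ?A"
    using W inp assms(2) unfolding weber_program_def Let_def by (metis length_replicate order_refl)
  have "star_cost ?t ?A ?t = 0" by (simp add: star_cost_def sum_list_replicate)
  then have "weber_cost ?t ?A = 0"
    using weber_cost_le[of ?t ?A ?t] weber_cost_nonneg[of ?t ?A] by simp
  then have v0: "rmem s' 3 0 \<le> 0" using ks by simp
  obtain R where R: "finite R" "card R \<le> csize W * k"
    "\<And>i x. i \<notin> R \<Longrightarrow> \<exists>y. exec W (rupd 1 i x s0) k (rupd 1 i y s')"
    using exec_unread[OF ks(1), of 1] by metis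
  have "{..<n} \<subseteq> R"
  proof
    fix i assume i: "i \<in> {..<n}"
    show "i \<in> R"
    proof (rule ccontr)
      assume "i \<notin> R"
      then obtain y where y: "exec W (rupd 1 i 1 s0) k (rupd 1 i y s')" using R by blast
      let ?A' = "?A[i := (1, 0)]"
      have "holds_input \<epsilon> ?t ?A' (rupd 1 i 1 s0)"
        using i by (auto simp: holds_input_def s0_def rupd_def nth_list_update)
      moreover have "length ?A' \<le> n" by simp
      ultimately obtain k' s'' where "exec W (rupd 1 i 1 s0) k' s''" "weber_cost ?t ?A' \<le> rmem s'' 3 0"
        using W assms(2) unfolding weber_program_def Let_def by metis
      then have "weber_cost ?t ?A' \<le> rmem (rupd 1 i y s') 3 0"
        using exec_deterministic[OF y] by metis
      then have "weber_cost ?t ?A' \<le> rmem s' 3 0" by simp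
      moreover have "1 \<le> weber_cost ?t ?A'"
      proof (rule weber_cost_geI)
        fix p :: point
        have "(1, 0) \<in> set ?A'" using i by (simp add: set_update_memI)
        then have "dist (1, 0) p \<le> (\<Sum>a\<leftarrow>?A'. dist a p)"
          by (intro member_le_sum_list) auto
        moreover have "dist (1, 0) ?t \<le> dist (1, 0) p + dist p ?t" by (rule dist_triangle)
        moreover have "dist (1, 0) ?t = 1" by (simp add: dist_prod_def)
        ultimately show "1 \<le> star_cost ?t ?A' p" unfolding star_cost_def by linarith
      qed
      ultimately show False using v0 by simp
    qed
  qed
  then have "n \<le> card R" using R card_mono[of R "{..<n}"] by simp
  then have "real n \<le> real (csize W) * real k" using R by (metis of_nat_le_iff of_nat_mult order_trans)
  also have "\<dots> \<le> real (csize W) * T n \<epsilon>" using ks by (simp add: mult_left_mono)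
  finally show "real n \<le> real (csize W) * T n \<epsilon>" .
  show "1 \<le> T n \<epsilon>" using exec_pos[OF ks(1)] ks(2) by linarith
qed

section \<open>Total correctness with time bounds\<close>

definition runs :: "com \<Rightarrow> real \<Rightarrow> (state \<Rightarrow> bool) \<Rightarrow> state \<Rightarrow> bool" where
  "runs c B Q s \<longleftrightarrow> (\<exists>k s'. exec c s k s' \<and> real k \<le> B \<and> Q s')"

lemma runs_mono:
  assumes "runs c B Q s" "B \<le> B'" "\<And>s'. frame c s s' \<Longrightarrow> Q s' \<Longrightarrow> Q' s'"
  shows "runs c B' Q' s"
  using assms exec_frame unfolding runs_def by (meson order_trans)

lemma runs_NAssign: "Q (nupd a (nval i s) (nval e s) s) \<Longrightarrow> runs (NAssign a i e) 1 Q s"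
  unfolding runs_def using exec.NAssign by fastforce

lemma runs_Seq:
  assumes "runs c B (\<lambda>s'. runs d B' Q s') s"
  shows "runs (Seq c d) (B + B') Q s"
proof -
  obtain j s' k s'' where "exec c s j s'" "real j \<le> B" "exec d s' k s''" "real k \<le> B'" "Q s''"
    using assms unfolding runs_def by blast
  then show ?thesis unfolding runs_def
    by (intro exI[of _ "j + k"] exI[of _ s'']) (auto intro: exec.Seq)
qed

lemma runs_If:
  assumes "bval b s \<Longrightarrow> runs c B Q s" "\<not> bval b s \<Longrightarrow> runs d B Q s"
  shows "runs (If b c d) (B + 1) Q s"
proof (cases "bval b s")
  case True
  then obtain k s' where "exec c s k s'" "real k \<le> B" "Q s'" using assms unfolding runs_def by blast
  then show ?thesis using True exec.IfTrue unfolding runs_def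
    by (intro exI[of _ "k + 1"] exI[of _ s']) auto
next
  case False
  then obtain k s' where "exec d s k s'" "real k \<le> B" "Q s'" using assms unfolding runs_def by blast
  then show ?thesis using False exec.IfFalse unfolding runs_def
    by (intro exI[of _ "k + 1"] exI[of _ s']) auto
qed

definition For :: "nat \<Rightarrow> nexp \<Rightarrow> com \<Rightarrow> com" where
  "For a h c = Seq (NAssign a (NConst 0) (NConst 0))
     (While (NLess (NCell a (NConst 0)) h)
       (Seq c (NAssign a (NConst 0) (NAdd (NCell a (NConst 0)) (NConst 1)))))"

lemma nmods_For [simp]: "nmods (For a h c) = insert a (nmods c)"
  and rmods_For [simp]: "rmods (For a h c) = rmods c"
  by (auto simp: For_def)

text \<open>A round costs the body, the test and the increment; the initialisation and the failing
  test account for the final 2. The bound \<open>h\<close> is evaluated anew in each round, so its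
  value must survive the frame of the loop. The proof is by induction on the number of remaining
  rounds.\<close>

lemma runs_For:
  assumes a: "a \<notin> nmods c"
    and h: "\<And>s'. frame (For a h c) s s' \<Longrightarrow> nval h s' = n"
    and init: "J 0 (nupd a 0 0 s)"
    and step: "\<And>i s'. i < n \<Longrightarrow> frame (For a h c) s s' \<Longrightarrow> nmem s' a 0 = i \<Longrightarrow> J i s' \<Longrightarrow>
      runs c B (\<lambda>s''. J (Suc i) (nupd a 0 (Suc i) s'')) s'"
  shows "runs (For a h c) (real n * (B + 2) + 2) (J n) s"
proof -
  define L where "L = While (NLess (NCell a (NConst 0)) h)
       (Seq c (NAssign a (NConst 0) (NAdd (NCell a (NConst 0)) (NConst 1))))"
  have loop: "runs L (real k * (B + 2) + 1) (J n) s'"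
    if "frame (For a h c) s s'" "nmem s' a 0 = n - k" "k \<le> n" "J (n - k) s'" for k s'
    using that
  proof (induction k arbitrary: s')
    case 0
    then have "exec L s' 1 s'" unfolding L_def using h[of s'] by (intro exec.WhileFalse) auto
    then show ?case using 0 unfolding runs_def by fastforce
  next
    case (Suc k)
    have lt: "n - Suc k < n" using Suc by simp
    obtain j s'' where j: "exec c s' j s''" "real j \<le> B" "J (Suc (n - Suc k)) (nupd a 0 (Suc (n - Suc k)) s'')"
      using step[OF lt Suc.prems(1,2,4)] unfolding runs_def by blast
    have e: "Suc (n - Suc k) = n - k" using Suc by simp
    have fr: "frame c s' s''" using exec_frame[OF j(1)] .
    then have "nmem s'' a 0 = n - Suc k" using a Suc by (simp add: frame_def)
    then have "exec (NAssign a (NConst 0) (NAdd (NCell a (NConst 0)) (NConst 1))) s'' 1 (nupd a 0 (n - k) s'')"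
      using exec.NAssign[of a "NConst 0" "NAdd (NCell a (NConst 0)) (NConst 1)" s''] e by simp
    from exec.Seq[OF j(1) this]
    have body: "exec (Seq c (NAssign a (NConst 0) (NAdd (NCell a (NConst 0)) (NConst 1)))) s' (j + 1) (nupd a 0 (n - k) s'')" .
    have fr': "frame (For a h c) s (nupd a 0 (n - k) s'')"
      using Suc.prems(1) fr by (auto simp: frame_def)
    obtain l t where l: "exec L (nupd a 0 (n - k) s'') l t" "real l \<le> real k * (B + 2) + 1" "J n t"
      using Suc.IH[OF fr'] j(3) Suc.prems e unfolding runs_def by auto
    have "bval (NLess (NCell a (NConst 0)) h) s'" using h[OF Suc.prems(1)] Suc.prems lt by simp
    from exec.WhileTrue[OF this body l(1)[unfolded L_def]]
    have "exec L s' (j + 1 + l + 1) t" unfolding L_def .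
    moreover have "real (j + 1 + l + 1) \<le> real (Suc k) * (B + 2) + 1"
      using j(2) l(2) by (simp add: algebra_simps)
    ultimately show ?case using l(3) unfolding runs_def by blast
  qed
  have "runs L (real n * (B + 2) + 1) (J n) (nupd a 0 0 s)"
    using loop[of "nupd a 0 0 s" n] init by (auto simp: frame_def)
  then have "runs (NAssign a (NConst 0) (NConst 0)) 1 (\<lambda>s'. runs L (real n * (B + 2) + 1) (J n) s') s"
    by (intro runs_NAssign) simp
  from runs_Seq[OF this] show ?thesis unfolding For_def L_def by (simp add: add.commute)
qed

text \<open>Rule for an exhaustive search: \<open>\<tau>\<close> is the part of the state that
  ignores the counter, \<open>R\<close> is the way in which it may evolve, and what round
  \<open>i\<close> has achieved is stable under \<open>R\<close>, so that in the end it holds for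
  all rounds at once.\<close>

lemma runs_For_all:
  fixes \<tau> :: "state \<Rightarrow> 'v"
  assumes a: "a \<notin> nmods c"
    and h: "\<And>s'. frame (For a h c) s s' \<Longrightarrow> nval h s' = n"
    and \<tau>: "\<And>s x. \<tau> (nupd a 0 x s) = \<tau> s"
    and I: "I (\<tau> s)" and refl: "\<And>x. R x x" and trans: "\<And>x y z. R x y \<Longrightarrow> R y z \<Longrightarrow> R x z"
    and stable: "\<And>i x y. P i x \<Longrightarrow> R x y \<Longrightarrow> P i y"
    and step: "\<And>i s'. i < n \<Longrightarrow> frame (For a h c) s s' \<Longrightarrow> nmem s' a 0 = i \<Longrightarrow> I (\<tau> s') \<Longrightarrow>
      runs c B (\<lambda>s''. I (\<tau> s'') \<and> R (\<tau> s') (\<tau> s'') \<and> P i (\<tau> s'')) s'"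
  shows "runs (For a h c) (real n * (B + 2) + 2)
    (\<lambda>s'. I (\<tau> s') \<and> R (\<tau> s) (\<tau> s') \<and> (\<forall>i<n. P i (\<tau> s'))) s"
proof (rule runs_For[where J = "\<lambda>k s'. I (\<tau> s') \<and> R (\<tau> s) (\<tau> s') \<and> (\<forall>i<k. P i (\<tau> s'))"])
  fix i s'
  assume s': "i < n" "frame (For a h c) s s'" "nmem s' a 0 = i" "I (\<tau> s') \<and> R (\<tau> s) (\<tau> s') \<and> (\<forall>j<i. P j (\<tau> s'))"
  show "runs c B (\<lambda>s''. I (\<tau> (nupd a 0 (Suc i) s'')) \<and> R (\<tau> s) (\<tau> (nupd a 0 (Suc i) s'')) \<and>
      (\<forall>j<Suc i. P j (\<tau> (nupd a 0 (Suc i) s'')))) s'"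
    by (rule runs_mono[OF step[OF s'(1-3)] order_refl])
      (use s' trans stable in \<open>auto simp: \<tau> less_Suc_eq\<close>)
qed (use assms in auto)

section \<open>Interval decompositions of a noncrossing partition\<close>

lemma maximal_run:
  fixes c v :: nat
  assumes "c \<le> v"
  obtains w where "c \<le> w" "w \<le> v" "\<And>p. c \<le> p \<Longrightarrow> p < w \<Longrightarrow> R p" "w < v \<Longrightarrow> \<not> R w"
proof -
  define w where "w = (LEAST p. c \<le> p \<and> (p < v \<longrightarrow> \<not> R p))"
  have w: "c \<le> w \<and> (w < v \<longrightarrow> \<not> R w)" unfolding w_def by (rule LeastI[of _ v]) (use assms in auto)
  moreover have "w \<le> v" unfolding w_def by (rule Least_le) (use assms in auto)
  moreover have "R p" if "c \<le> p" "p < w" for p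
    using not_less_Least[of p "\<lambda>p. c \<le> p \<and> (p < v \<longrightarrow> \<not> R p)"] that by (auto simp: w_def)
  ultimately show ?thesis using that by blast
qed

text \<open>Maximal runs from the left, alternately inside and outside of \<open>P\<close>, give the
  four bounds. A further position outside \<open>P\<close> would complete the excluded pattern, as
  \<open>P\<close> holds at \<open>v - 1\<close>. If there are fewer gaps, the remaining bounds
  collapse to \<open>v\<close>, whence the conditions \<open>v1 < v\<close> and
  \<open>v2 < v\<close>.\<close>

lemma two_gaps:
  fixes u v :: nat
  assumes uv: "u < v" and P: "P u" "P (v - 1)"
    and pattern: "\<And>b0 a1 b1 a2 b2. u < b0 \<Longrightarrow> b0 < a1 \<Longrightarrow> a1 < b1 \<Longrightarrow> b1 < a2 \<Longrightarrow> a2 < b2 \<Longrightarrow> b2 < v - 1 \<Longrightarrow>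
      P a1 \<Longrightarrow> P a2 \<Longrightarrow> \<not> P b0 \<Longrightarrow> \<not> P b1 \<Longrightarrow> \<not> P b2 \<Longrightarrow> False"
  obtains u1 v1 u2 v2 where "u < u1" "u1 \<le> v1" "v1 \<le> u2" "u2 \<le> v2" "v2 \<le> v" "v1 < v \<Longrightarrow> P v1" "v2 < v \<Longrightarrow> P v2"
    "\<And>p. u \<le> p \<Longrightarrow> p < v \<Longrightarrow> P p \<longleftrightarrow> \<not> (u1 \<le> p \<and> p < v1) \<and> \<not> (u2 \<le> p \<and> p < v2)"
proof -
  obtain u1 where u1: "u \<le> u1" "u1 \<le> v" "\<And>p. u \<le> p \<Longrightarrow> p < u1 \<Longrightarrow> P p" "u1 < v \<Longrightarrow> \<not> P u1"
    using maximal_run[of u v P] uv by auto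
  obtain v1 where v1: "u1 \<le> v1" "v1 \<le> v" "\<And>p. u1 \<le> p \<Longrightarrow> p < v1 \<Longrightarrow> \<not> P p" "v1 < v \<Longrightarrow> P v1"
    using maximal_run[of u1 v "\<lambda>p. \<not> P p"] u1 by auto
  obtain u2 where u2: "v1 \<le> u2" "u2 \<le> v" "\<And>p. v1 \<le> p \<Longrightarrow> p < u2 \<Longrightarrow> P p" "u2 < v \<Longrightarrow> \<not> P u2"
    using maximal_run[of v1 v P] v1 by auto
  obtain v2 where v2: "u2 \<le> v2" "v2 \<le> v" "\<And>p. u2 \<le> p \<Longrightarrow> p < v2 \<Longrightarrow> \<not> P p" "v2 < v \<Longrightarrow> P v2"
    using maximal_run[of u2 v "\<lambda>p. \<not> P p"] u2 by auto
  have uu1: "u < u1" using u1 uv P by (cases "u = u1") auto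
  have rest: "P p" if p: "v2 \<le> p" "p < v" for p
  proof (rule ccontr)
    assume np: "\<not> P p"
    have "P v2" "\<not> P u2" "P v1" "\<not> P u1" using p v2 u2 v1 u1 by auto
    then have "v2 \<noteq> p" "u2 \<noteq> v2" "v1 \<noteq> u2" "u1 \<noteq> v1" "p \<noteq> v - 1" using np P by auto
    then have "u1 < v1" "v1 < u2" "u2 < v2" "v2 < p" "p < v - 1" using v1(1) u2(1) v2(1) p by linarith+
    then show False by (rule pattern[OF uu1 _ _ _ _ _ \<open>P v1\<close> \<open>P v2\<close> \<open>\<not> P u1\<close> \<open>\<not> P u2\<close> np])
  qed
  have iff: "P p \<longleftrightarrow> \<not> (u1 \<le> p \<and> p < v1) \<and> \<not> (u2 \<le> p \<and> p < v2)" if "u \<le> p" "p < v" for p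
  proof -
    consider "p < u1" | "u1 \<le> p" "p < v1" | "v1 \<le> p" "p < u2" | "u2 \<le> p" "p < v2" | "v2 \<le> p" by linarith
    then show ?thesis
      by cases (use that u1 v1 u2 v2 rest in auto)
  qed
  show ?thesis
    by (rule that[of u1 v1 u2 v2]) (use uu1 v1 u2 v2 iff in auto)
qed

text \<open>
  A group consists of the positions from \<open>u\<close> to \<open>v - 1\<close> outside of two gaps. It may be empty: this is
  how an interval is split in two.
\<close>

definition in_group :: "nat \<Rightarrow> nat \<Rightarrow> nat \<Rightarrow> nat \<Rightarrow> nat \<Rightarrow> nat \<Rightarrow> nat \<Rightarrow> bool" where
  "in_group u v u1 v1 u2 v2 p \<longleftrightarrow> u \<le> p \<and> p < v \<and> \<not> (u1 \<le> p \<and> p < v1) \<and> \<not> (u2 \<le> p \<and> p < v2)"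

definition gaps :: "nat \<Rightarrow> nat \<Rightarrow> nat \<Rightarrow> nat \<Rightarrow> nat \<Rightarrow> nat \<Rightarrow> bool" where
  "gaps u v u1 v1 u2 v2 \<longleftrightarrow> u \<le> u1 \<and> u1 \<le> v1 \<and> v1 \<le> u2 \<and> u2 \<le> v2 \<and> v2 \<le> v \<and>
     v1 - u1 < v - u \<and> v2 - u2 < v - u"

lemma weber_cost_Nil [simp]: "weber_cost t [] = 0"
proof -
  have "weber_cost t [] \<le> 0" using weber_cost_le[of t "[]" t] by (simp add: star_cost_def)
  then show ?thesis using weber_cost_nonneg[of t "[]"] by simp
qed

text \<open>The second assumption forbids a fourth block of a group in the linear window, so at most
  two gaps lie between its first and its last position.\<close>

locale noncrossing =
  fixes G :: "nat \<Rightarrow> 'c" and r R :: nat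
  assumes crossing: "\<And>i j k l. r \<le> i \<Longrightarrow> i < j \<Longrightarrow> j < k \<Longrightarrow> k < l \<Longrightarrow> l < R \<Longrightarrow>
      G i = G k \<Longrightarrow> G j = G l \<Longrightarrow> G i = G j"
    and pattern: "\<And>a0 b0 a1 b1 a2 b2 a3. r \<le> a0 \<Longrightarrow> a0 < b0 \<Longrightarrow> b0 < a1 \<Longrightarrow> a1 < b1 \<Longrightarrow> b1 < a2 \<Longrightarrow> a2 < b2 \<Longrightarrow>
      b2 < a3 \<Longrightarrow> a3 < R \<Longrightarrow> G a1 = G a0 \<Longrightarrow> G a2 = G a0 \<Longrightarrow> G a3 = G a0 \<Longrightarrow>
      G b0 \<noteq> G a0 \<Longrightarrow> G b1 \<noteq> G a0 \<Longrightarrow> G b2 \<noteq> G a0 \<Longrightarrow> False"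
begin

text \<open>The intervals that cut no group of the window apart. The recursion stays within
  them.\<close>

definition closed_interval :: "nat \<Rightarrow> nat \<Rightarrow> bool" where
  "closed_interval u v \<longleftrightarrow> r \<le> u \<and> u \<le> v \<and> v \<le> R \<and>
     (\<forall>i j. u \<le> i \<longrightarrow> i < v \<longrightarrow> r \<le> j \<longrightarrow> j < R \<longrightarrow> G i = G j \<longrightarrow> u \<le> j \<and> j < v)"

definition cell :: "nat \<Rightarrow> 'c \<Rightarrow> nat list" where
  "cell M q = filter (\<lambda>p. r \<le> p \<and> p < R \<and> G p = q) [0..<M]"

text \<open>Induction on the length. If the group of \<open>u\<close> ends at \<open>e\<close>
  before \<open>v - 1\<close>, no group extends across \<open>e\<close>, since it would cross that
  of \<open>u\<close>; so the interval splits behind \<open>e\<close>. Otherwise the group of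
  \<open>u\<close> spans the interval and leaves at most two gaps, closed for the same reason. Every
  group is charged exactly once.\<close>

lemma interval_dp_bound:
  fixes F :: "nat \<Rightarrow> nat \<Rightarrow> real" and w :: "nat list \<Rightarrow> real"
  assumes F0: "\<And>u. r \<le> u \<Longrightarrow> u \<le> R \<Longrightarrow> F u u \<le> 0" and w0: "w [] = 0"
    and F: "\<And>u v u1 v1 u2 v2. r \<le> u \<Longrightarrow> v \<le> R \<Longrightarrow> gaps u v u1 v1 u2 v2 \<Longrightarrow>
      F u v \<le> F u1 v1 + F u2 v2 + w (filter (in_group u v u1 v1 u2 v2) [0..<M])"
    and "closed_interval u v"
  shows "F u v \<le> (\<Sum>q\<in>G ` {u..<v}. w (cell M q))"
  using assms(4)
proof (induction "v - u" arbitrary: u v rule: less_induct)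
  case less
  have cl: "r \<le> u" "u \<le> v" "v \<le> R" using less.prems by (auto simp: closed_interval_def)
  have cl': "u \<le> j \<and> j < v" if "u \<le> i" "i < v" "r \<le> j" "j < R" "G i = G j" for i j
    using less.prems that unfolding closed_interval_def by blast
  have sub: "closed_interval x y"
    if "u \<le> x" "x \<le> y" "y \<le> v" "\<And>i j. x \<le> i \<Longrightarrow> i < y \<Longrightarrow> u \<le> j \<Longrightarrow> j < v \<Longrightarrow> G i = G j \<Longrightarrow> x \<le> j \<and> j < y" for x y
    using that cl cl' unfolding closed_interval_def by (meson order_trans less_le_trans)
  show ?case
  proof (cases "u = v")
    case True
    then show ?thesis using F0[of u] cl by simp
  next
    case False
    then have uv: "u < v" using cl by simp
    define e where "e = Max {p. u \<le> p \<and> p < v \<and> G p = G u}"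
    have fin: "finite {p. u \<le> p \<and> p < v \<and> G p = G u}" by simp
    have ne: "u \<in> {p. u \<le> p \<and> p < v \<and> G p = G u}" using uv by simp
    have "e \<in> {p. u \<le> p \<and> p < v \<and> G p = G u}" unfolding e_def using Max_in[OF fin] ne by blast
    then have e: "u \<le> e" "e < v" "G e = G u" by auto
    have emax: "p \<le> e" if "u \<le> p" "p < v" "G p = G u" for p
      unfolding e_def by (rule Max_ge) (use that fin in auto)
    show ?thesis
    proof (cases "Suc e < v")
      case True
      have split: False if "u \<le> i" "i \<le> e" "e < j" "j < v" "G i = G j" for i j
      proof -
        have "G j \<noteq> G u" using emax[of j] that by auto
        then have "i \<noteq> u" "i \<noteq> e" using that e by auto
        then show False using crossing[of u i e j] that e cl \<open>G j \<noteq> G u\<close> by auto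
      qed
      have c1: "closed_interval u (Suc e)"
      proof (rule sub)
        fix i j assume "u \<le> i" "i < Suc e" "u \<le> j" "j < v" "G i = G j"
        then show "u \<le> j \<and> j < Suc e" using split[of i j] by (meson less_Suc_eq_le not_less)
      qed (use e in auto)
      have c2: "closed_interval (Suc e) v"
      proof (rule sub)
        fix i j assume "Suc e \<le> i" "i < v" "u \<le> j" "j < v" "G i = G j"
        then show "Suc e \<le> j \<and> j < v" using split[of j i] by (metis Suc_le_eq not_less)
      qed (use e in auto)
      \<comment> \<open>Two adjacent gaps that exhaust the interval, with an empty group between
        them, express the split.\<close>
      have "gaps u v u (Suc e) (Suc e) v" using e True by (auto simp: gaps_def)
      moreover have "filter (in_group u v u (Suc e) (Suc e) v) [0..<M] = []"
        by (auto simp: filter_empty_conv in_group_def)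
      ultimately have "F u v \<le> F u (Suc e) + F (Suc e) v" using F[of u v u "Suc e" "Suc e" v] cl w0 by simp
      also have "\<dots> \<le> (\<Sum>q\<in>G ` {u..<Suc e}. w (cell M q)) + (\<Sum>q\<in>G ` {Suc e..<v}. w (cell M q))"
        using less.hyps[OF _ c1] less.hyps[OF _ c2] True e by (intro add_mono) auto
      also have "\<dots> = (\<Sum>q\<in>G ` {u..<Suc e} \<union> G ` {Suc e..<v}. w (cell M q))"
        by (rule sum.union_disjoint[symmetric]) (auto simp: less_Suc_eq_le Suc_le_eq dest: split)
      also have "G ` {u..<Suc e} \<union> G ` {Suc e..<v} = G ` {u..<v}"
      proof -
        have "{u..<v} = {u..<Suc e} \<union> {Suc e..<v}" using e by auto
        then show ?thesis by (simp add: image_Un)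
      qed
      finally show ?thesis .
    next
      case False
      then have ve: "e = v - 1" using e by simp
      define P where "P p \<longleftrightarrow> G p = G u" for p
      obtain u1 v1 u2 v2 where g: "u < u1" "u1 \<le> v1" "v1 \<le> u2" "u2 \<le> v2" "v2 \<le> v"
        "v1 < v \<Longrightarrow> P v1" "v2 < v \<Longrightarrow> P v2"
        and iff: "\<And>p. u \<le> p \<Longrightarrow> p < v \<Longrightarrow> P p \<longleftrightarrow> \<not> (u1 \<le> p \<and> p < v1) \<and> \<not> (u2 \<le> p \<and> p < v2)"
      proof (rule two_gaps[of u v P])
        show "P (v - 1)" using e ve by (simp add: P_def)
        fix b0 a1 b1 a2 b2
        assume *: "u < b0" "b0 < a1" "a1 < b1" "b1 < a2" "a2 < b2" "b2 < v - 1"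
          and **: "P a1" "P a2" "\<not> P b0" "\<not> P b1" "\<not> P b2"
        have "v - 1 < R" "G (v - 1) = G u" using uv cl e ve by auto
        then show False using pattern[OF cl(1) *] ** unfolding P_def by blast
      qed (use uv in \<open>auto simp: P_def\<close>)
      have cross: False if "u < i" "i < k" "k < j" "j < v" "P k" "G i = G j" "\<not> P i" for i j k
        using crossing[of u i k j] that cl by (simp add: P_def)
      have c1: "closed_interval u1 v1"
      proof (rule sub)
        fix i j assume ij: "u1 \<le> i" "i < v1" "u \<le> j" "j < v" "G i = G j"
        have nP: "\<not> P i" using iff[of i] ij g by auto
        then have nPj: "\<not> P j" using ij by (simp add: P_def)
        have "u1 \<le> j" using iff[of j] nPj ij g by auto
        moreover have "j < v1"
        proof (rule ccontr)
          assume "\<not> j < v1"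
          then have "P v1" "v1 < j" using g ij nPj by (auto simp: nat_less_le)
          then show False using cross[of i v1 j] ij g nP by auto
        qed
        ultimately show "u1 \<le> j \<and> j < v1" by simp
      qed (use g in auto)
      have c2: "closed_interval u2 v2"
      proof (rule sub)
        fix i j assume ij: "u2 \<le> i" "i < v2" "u \<le> j" "j < v" "G i = G j"
        have nP: "\<not> P i" using iff[of i] ij g by auto
        then have nPj: "\<not> P j" using ij by (simp add: P_def)
        have "u2 \<le> j"
        proof (rule ccontr)
          assume "\<not> u2 \<le> j"
          then have "u1 \<le> j" "j < v1" using iff[of j] nPj ij g by auto
          moreover have "P v1" using g ij by auto
          moreover have "i \<noteq> v1" using nP \<open>P v1\<close> by auto
          ultimately show False using cross[of j v1 i] ij g nPj by auto
        qed
        moreover have "j < v2"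
        proof (rule ccontr)
          assume "\<not> j < v2"
          then have "P v2" "v2 < j" using g ij nPj by (auto simp: nat_less_le)
          then show False using cross[of i v2 j] ij g nP by auto
        qed
        ultimately show "u2 \<le> j \<and> j < v2" by simp
      qed (use g in auto)
      have gp: "gaps u v u1 v1 u2 v2" using g by (auto simp: gaps_def)
      have len: "v1 - u1 < v - u" "v2 - u2 < v - u" using gp by (auto simp: gaps_def)
      have grp: "filter (in_group u v u1 v1 u2 v2) [0..<M] = cell M (G u)"
        unfolding cell_def
      proof (rule filter_cong[OF refl])
        fix p
        show "in_group u v u1 v1 u2 v2 p \<longleftrightarrow> r \<le> p \<and> p < R \<and> G p = G u"
          using iff[of p] cl cl'[of u p] uv unfolding in_group_def P_def by auto
      qed
      have "F u v \<le> F u1 v1 + F u2 v2 + w (cell M (G u))" using F[OF _ _ gp] cl grp by simp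
      also have "\<dots> \<le> (\<Sum>q\<in>G ` {u1..<v1}. w (cell M q)) + (\<Sum>q\<in>G ` {u2..<v2}. w (cell M q)) + w (cell M (G u))"
        using less.hyps[OF len(1) c1] less.hyps[OF len(2) c2] by simp
      also have "\<dots> = (\<Sum>q\<in>G ` {u1..<v1} \<union> G ` {u2..<v2}. w (cell M q)) + w (cell M (G u))"
      proof -
        have "G ` {u1..<v1} \<inter> G ` {u2..<v2} = {}"
        proof (rule ccontr)
          assume "G ` {u1..<v1} \<inter> G ` {u2..<v2} \<noteq> {}"
          then obtain i j where ij: "u1 \<le> i" "i < v1" "u2 \<le> j" "j < v2" "G i = G j" by auto
          have "\<not> P i" "\<not> P j" using iff[of i] iff[of j] ij g by auto
          moreover have "P v1" using g ij by auto
          moreover have "v1 \<noteq> j" using calculation by auto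
          ultimately show False using cross[of i v1 j] ij g by auto
        qed
        then show ?thesis by (subst sum.union_disjoint) auto
      qed
      also have "\<dots> = (\<Sum>q\<in>insert (G u) (G ` {u1..<v1} \<union> G ` {u2..<v2}). w (cell M q))"
      proof -
        have "\<not> P p" if "p \<in> {u1..<v1} \<union> {u2..<v2}" for p using that iff[of p] g by auto
        then have "G u \<notin> G ` {u1..<v1} \<union> G ` {u2..<v2}" unfolding P_def by fastforce
        then show ?thesis by (subst sum.insert) auto
      qed
      also have "insert (G u) (G ` {u1..<v1} \<union> G ` {u2..<v2}) = G ` {u..<v}"
      proof -
        have "{u..<v} = {p. u \<le> p \<and> p < v \<and> P p} \<union> {u1..<v1} \<union> {u2..<v2}"
          using iff g by auto
        moreover have "G ` {p. u \<le> p \<and> p < v \<and> P p} = {G u}" using uv by (auto simp: P_def)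
        ultimately show ?thesis by (simp add: image_Un)
      qed
      finally show ?thesis .
    qed
  qed
qed


end

section \<open>The dynamic program bounds every choice of Steiner points\<close>

context voronoi_cells
begin

text \<open>Four linear blocks of a cell have only three interruptions between them. As the first
  and the last position of the window belong to different cells, one of them is outside the cell in
  question and supplies the fourth.\<close>

lemma noncrossing_cells:
  assumes "g (X u) \<noteq> g (X (v - 1)) \<or> (\<forall>i j. u \<le> i \<longrightarrow> i < v \<longrightarrow> u \<le> j \<longrightarrow> j < v \<longrightarrow> g (X i) = g (X j))"
  shows "noncrossing (\<lambda>p. g (X p)) u v"
proof
  fix i j k l
  assume "u \<le> i" "i < j" "j < k" "k < l" "l < v" "g (X i) = g (X k)" "g (X j) = g (X l)"
  then show "g (X i) = g (X j)" by (rule cells_noncrossing)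
next
  fix a0 b0 a1 b1 a2 b2 a3
  assume o: "u \<le> a0" "a0 < b0" "b0 < a1" "a1 < b1" "b1 < a2" "a2 < b2" "b2 < a3" "a3 < v"
    and a: "g (X a1) = g (X a0)" "g (X a2) = g (X a0)" "g (X a3) = g (X a0)"
    and b: "g (X b0) \<noteq> g (X a0)" "g (X b1) \<noteq> g (X a0)" "g (X b2) \<noteq> g (X a0)"
  have "u \<le> b0" "b0 < v" "a0 < v" using o by linarith+
  then have ends: "g (X u) \<noteq> g (X (v - 1))" using assms b(1) o(1) by blast
  show False
  proof (cases "g (X u) = g (X a0)")
    case True
    then have n: "g (X (v - 1)) \<noteq> g (X a0)" using ends by auto
    then have "a3 \<noteq> v - 1" using a by auto
    then have "a3 < v - 1" "v - 1 < v" using o by auto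
    then show False using no_four_alternations[OF o(1-7) _ _ refl a b n] by blast
  next
    case False
    then have "u \<noteq> a0" by auto
    then have "u < a0" using o by simp
    then show False using no_four_alternations'[OF order_refl _ o(2-8) refl a False b] by blast
  qed
qed

end

lemma sum_periodic:
  fixes f :: "nat \<Rightarrow> 'a::ab_group_add"
  assumes "\<And>p. f (p + n) = f p"
  shows "sum f {r..<r + n} = sum f {..<n}"
proof (induction r)
  case 0
  then show ?case by (simp add: atLeast0LessThan)
next
  case (Suc r)
  have "sum f {Suc r..<Suc r + n} + f r = sum f {r..<r + n} + f (r + n)"
    by (cases n) (auto simp: sum.atLeast_Suc_lessThan sum.atLeastLessThan_Suc add.commute algebra_simps)
  then show ?case using Suc assms by simp
qed

lemma nearest_site_exists:
  assumes "finite Q" "Q \<noteq> {}"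
  shows "\<exists>p. nearest_site Q x p"
proof -
  define N where "N = {q \<in> Q. \<forall>q'\<in>Q. dist x q \<le> dist x q'}"
  obtain q where "is_arg_min (dist x) (\<lambda>q. q \<in> Q) q" using ex_is_arg_min_if_finite[OF assms] by blast
  then have "q \<in> N" unfolding N_def is_arg_min_linorder by blast
  then have "N \<noteq> {}" by blast
  have "finite N" using assms by (simp add: N_def)
  then have "\<exists>p\<in>N. \<forall>q\<in>N. q = p \<or> lex_less p q" using \<open>N \<noteq> {}\<close>
  proof (induction N rule: finite_ne_induct)
    case (insert q F)
    then obtain p where p: "p \<in> F" "\<And>q. q \<in> F \<Longrightarrow> q = p \<or> lex_less p q" by blast
    show ?case
    proof (cases "lex_less p q")
      case True
      then show ?thesis using p by blast
    next
      case False
      then have "lex_less q p \<or> q = p" using lex_less_total by blast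
      then have "\<forall>x\<in>insert q F. x = q \<or> lex_less q x" using p(2) lex_less_trans[of q p] by blast
      then show ?thesis by blast
    qed
  qed auto
  then obtain p where p: "p \<in> N" "\<And>q. q \<in> N \<Longrightarrow> q = p \<or> lex_less p q" by blast
  have "nearest_site Q x p" unfolding nearest_site_def
  proof (intro conjI ballI)
    show "p \<in> Q" using p by (simp add: N_def)
    fix q assume q: "q \<in> Q"
    then show "dist x p \<le> dist x q" using p by (simp add: N_def)
    show "dist x p = dist x q \<longrightarrow> q = p \<or> lex_less p q"
      using p(1) p(2)[of q] q by (auto simp: N_def)
  qed
  then show ?thesis ..
qed

text \<open>Any assignment \<open>h\<close> to sites is at least as long as the nearest one, whose
  cells are noncrossing in a suitable window. The groups are then bounded by stars around their own
  sites, so each site of \<open>Q\<close> is charged at most once for its connection to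
  \<open>t\<close>.\<close>

lemma interval_dp_le_sites:
  fixes F :: "nat \<Rightarrow> nat \<Rightarrow> real" and X :: "nat \<Rightarrow> point"
  assumes cb: "convex_boundary S H" and QH: "finite Q" "Q \<subseteq> H" and "0 \<le> c"
    and XS: "\<And>i. X i \<in> S" "\<And>p. X (p + n) = X p" and alt: "alternating X 0 n"
    and h: "\<And>i. i < n \<Longrightarrow> h i \<in> Q"
    and F0: "\<And>u. u \<le> 2 * n \<Longrightarrow> F u u \<le> 0"
    and F: "\<And>u v u1 v1 u2 v2. v \<le> u + n \<Longrightarrow> v \<le> 2 * n \<Longrightarrow> gaps u v u1 v1 u2 v2 \<Longrightarrow>
      F u v \<le> F u1 v1 + F u2 v2 + c * weber_cost t (map X (filter (in_group u v u1 v1 u2 v2) [0..<Suc (2 * n)]))"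
  shows "\<exists>r\<le>n. F r (r + n) \<le> c * ((\<Sum>i<n. dist (X i) (h i)) + (\<Sum>q\<in>Q. dist q t))"
proof (cases "n = 0")
  case True
  then show ?thesis using F0[of 0] \<open>0 \<le> c\<close> by (auto intro!: order_trans[OF F0[of 0]] mult_nonneg_nonneg sum_nonneg)
next
  case False
  then have "Q \<noteq> {}" using h by blast
  then obtain g where near: "\<And>x. nearest_site Q x (g x)" using nearest_site_exists[OF QH(1)] by metis
  define G where "G p = g (X p)" for p
  have GQ: "G p \<in> Q" for p using near by (simp add: G_def nearest_site_def)
  \<comment> \<open>The window starts right behind a change of cell, so that it also ends with the
    other cell by periodicity. Without any change there is a single cell.\<close>
  have "\<exists>r\<le>n. G r \<noteq> G (r + n - 1) \<or> (\<forall>i j. r \<le> i \<longrightarrow> i < r + n \<longrightarrow> r \<le> j \<longrightarrow> j < r + n \<longrightarrow> G i = G j)"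
  proof (cases "\<exists>i<n. G i \<noteq> G (Suc i)")
    case True
    then obtain i where i: "i < n" "G i \<noteq> G (Suc i)" by blast
    have "G (Suc i + n - 1) = G i" using XS(2)[of i] by (simp add: G_def)
    then show ?thesis using i by (intro exI[of _ "Suc i"]) auto
  next
    case False
    have const: "G i = G 0" if "i \<le> n" for i
      using that by (induction i) (use False in \<open>auto simp: Suc_le_eq\<close>)
    show ?thesis
    proof (intro exI[of _ 0] conjI disjI2 allI impI)
      fix i j assume "i < 0 + n" "j < 0 + n"
      then show "G i = G j" using const[of i] const[of j] by simp
    qed simp
  qed
  then obtain r where r: "r \<le> n"
    "G r \<noteq> G (r + n - 1) \<or> (\<forall>i j. r \<le> i \<longrightarrow> i < r + n \<longrightarrow> r \<le> j \<longrightarrow> j < r + n \<longrightarrow> G i = G j)" by blast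
  interpret voronoi_cells S H Q g X r "r + n"
    using cb QH near XS alternating_rotate[OF alt XS(2)] by (simp add: voronoi_cells_def voronoi_cells_axioms_def)
  interpret nc: noncrossing G r "r + n"
  proof -
    have "G = (\<lambda>p. g (X p))" by (rule ext) (rule G_def)
    then show "noncrossing G r (r + n)" using noncrossing_cells[OF r(2)[unfolded G_def]] by (simp only:)
  qed
  let ?M = "Suc (2 * n)"
  let ?w = "\<lambda>L. c * weber_cost t (map X L)"
  have "F r (r + n) \<le> (\<Sum>q\<in>G ` {r..<r + n}. ?w (nc.cell ?M q))"
  proof (rule nc.interval_dp_bound)
    fix u v u1 v1 u2 v2 assume "r \<le> u" "v \<le> r + n" "gaps u v u1 v1 u2 v2"
    then show "F u v \<le> F u1 v1 + F u2 v2 + ?w (filter (in_group u v u1 v1 u2 v2) [0..<?M])"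
      using r(1) by (intro F) auto
  next
    show "nc.closed_interval r (r + n)" by (simp add: nc.closed_interval_def)
  qed (use r(1) F0 in auto)
  also have "\<dots> \<le> (\<Sum>q\<in>G ` {r..<r + n}. c * (dist q t + (\<Sum>p\<in>{p\<in>{r..<r + n}. G p = q}. dist (X p) q)))"
  proof (rule sum_mono)
    fix q
    have "(\<Sum>a\<leftarrow>map X (nc.cell ?M q). dist a q) = (\<Sum>p\<leftarrow>nc.cell ?M q. dist (X p) q)"
      by (simp add: comp_def)
    also have "\<dots> = (\<Sum>p\<in>set (nc.cell ?M q). dist (X p) q)"
      by (rule sum_list_distinct_conv_sum_set) (simp add: nc.cell_def)
    also have "set (nc.cell ?M q) = {p\<in>{r..<r + n}. G p = q}" using r(1) by (auto simp: nc.cell_def)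
    finally have "star_cost t (map X (nc.cell ?M q)) q = dist q t + (\<Sum>p\<in>{p\<in>{r..<r + n}. G p = q}. dist (X p) q)"
      by (simp add: star_cost_def)
    then show "?w (nc.cell ?M q) \<le> c * (dist q t + (\<Sum>p\<in>{p\<in>{r..<r + n}. G p = q}. dist (X p) q))"
      using weber_cost_le[of t "map X (nc.cell ?M q)" q] \<open>0 \<le> c\<close> by (simp add: mult_left_mono)
  qed
  also have "\<dots> = c * ((\<Sum>q\<in>G ` {r..<r + n}. dist q t) + (\<Sum>q\<in>G ` {r..<r + n}. \<Sum>p\<in>{p\<in>{r..<r + n}. G p = q}. dist (X p) (G p)))"
    by (simp add: sum_distrib_left[symmetric] sum.distrib)
  also have "(\<Sum>q\<in>G ` {r..<r + n}. \<Sum>p\<in>{p\<in>{r..<r + n}. G p = q}. dist (X p) (G p)) = (\<Sum>p\<in>{r..<r + n}. dist (X p) (G p))"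
    by (rule sum.image_gen[symmetric]) simp
  also have "\<dots> = (\<Sum>p<n. dist (X p) (G p))"
    by (rule sum_periodic) (simp add: G_def XS)
  also have "c * ((\<Sum>q\<in>G ` {r..<r + n}. dist q t) + (\<Sum>p<n. dist (X p) (G p))) \<le>
      c * ((\<Sum>q\<in>Q. dist q t) + (\<Sum>i<n. dist (X i) (h i)))"
  proof (intro mult_left_mono add_mono \<open>0 \<le> c\<close>)
    show "(\<Sum>q\<in>G ` {r..<r + n}. dist q t) \<le> (\<Sum>q\<in>Q. dist q t)"
      by (rule sum_mono2) (use QH GQ in auto)
    show "(\<Sum>p<n. dist (X p) (G p)) \<le> (\<Sum>i<n. dist (X i) (h i))"
      by (rule sum_mono) (use near h in \<open>auto simp: G_def nearest_site_def\<close>)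
  qed
  finally show ?thesis using r(1) by (auto simp: add.commute)
qed

section \<open>Layouts with one intermediate layer\<close>

text \<open>Height 2 leaves only two possibilities for the parent of a source: the sink, or a
  Steiner vertex attached to the sink. A source attached directly to the sink counts as using a
  Steiner point at \<open>t\<close>, which is free. Steiner vertices at the same point are merged,
  which can only lower the sum.\<close>

lemma layout_star_decomposition:
  assumes L: "is_layout I L" and I: "sinks I = [t]" "layers I = 1" "alpha I = 0"
  obtains P par where "finite P" "\<And>i. i < length (sources I) \<Longrightarrow> par i \<in> P"
    "(\<Sum>i<length (sources I). dist (sources I ! i) (par i)) + (\<Sum>q\<in>P. dist q t) \<le> layout_cost I L"
proof -
  define n where "n = length (sources I)"
  have lay: "finite (verts L)" "arcs L \<subseteq> verts L \<times> verts L"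
    "\<And>u v d. (u, v) \<in> arcs L ^^ d \<Longrightarrow> d \<le> 2" "leaves L = Source ` {..<n}" "roots L \<subseteq> {Sink 0}"
    "verts L - leaves L - roots L \<subseteq> range Steiner" "\<And>i. i < n \<Longrightarrow> pos L (Source i) = sources I ! i" "pos L (Sink 0) = t"
    using L I unfolding is_layout_def rooted_forest_def height_at_most_def n_def by (auto simp: numeral_2_eq_2)
  have fin: "finite (arcs L)" using lay(1,2) by (meson finite_SigmaI finite_subset)
  have src: "\<exists>v. (Source i, v) \<in> arcs L" if "i < n" for i
  proof -
    have "Source i \<in> leaves L" using that lay(4) by blast
    then have v: "Source i \<in> verts L" by (simp add: leaves_def)
    have "Source i \<notin> roots L" using lay(5) by auto
    then show ?thesis using v by (auto simp: roots_def arcs_def)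
  qed
  then obtain up where up: "\<And>i. i < n \<Longrightarrow> (Source i, up i) \<in> arcs L" by metis
  have not_leaf: "v \<notin> leaves L" if "(u, v) \<in> arcs L" for u v using that by (auto simp: leaves_def)
  have up2: "up i = Sink 0 \<or> up i \<in> range Steiner \<and> (up i, Sink 0) \<in> arcs L" if i: "i < n" for i
  proof (cases "up i \<in> roots L")
    case True
    then show ?thesis using lay(5) by auto
  next
    case False
    have v: "up i \<in> verts L" using up[OF i] lay(2) by auto
    then have st: "up i \<in> range Steiner" using lay(6) False not_leaf[OF up[OF i]] by auto
    obtain w where w: "(up i, w) \<in> arcs L" using v False by (auto simp: roots_def arcs_def)
    have "w \<in> roots L"
    proof (rule ccontr)
      assume "w \<notin> roots L"
      moreover have "w \<in> verts L" using w lay(2) by auto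
      ultimately obtain x where "(w, x) \<in> arcs L" by (auto simp: roots_def arcs_def)
      then have "(Source i, x) \<in> arcs L ^^ 3" using up[OF i] w by (auto simp: numeral_3_eq_3)
      then show False using lay(3) by fastforce
    qed
    then show ?thesis using st w lay(5) by auto
  qed
  define V where "V = up ` {..<n}"
  define cost where "cost = (\<lambda>(u, v). dist (pos L u) (pos L v) * real (load L u) powr alpha I)"
  have finl: "finite (leaves L)" using lay(4) by simp
  \<comment> \<open>\<open>0 powr 0\<close> is 0, so an arc has its full length as cost only if
    there is a source below it.\<close>
  have load: "load L u \<noteq> 0" if "i < n" "(Source i, u) \<in> (arcs L)\<^sup>*" for i u
  proof -
    have "Source i \<in> {w \<in> leaves L. (w, u) \<in> (arcs L)\<^sup>*}" using that lay(4) by auto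
    moreover have "finite {w \<in> leaves L. (w, u) \<in> (arcs L)\<^sup>*}" using finl by simp
    ultimately show ?thesis unfolding load_def using card_0_eq by blast
  qed
  define E1 where "E1 = (\<lambda>i. (Source i, up i)) ` {..<n}"
  define E2 where "E2 = (\<lambda>v. (v, Sink 0)) ` (V - {Sink 0})"
  have V: "v \<in> range Steiner \<and> (v, Sink 0) \<in> arcs L" if "v \<in> V - {Sink 0}" for v
    using that up2 by (auto simp: V_def)
  have E: "E1 \<subseteq> arcs L" "E2 \<subseteq> arcs L" using up V by (auto simp: E1_def E2_def)
  have disj: "E1 \<inter> E2 = {}" using V by (auto simp: E1_def E2_def)
  have "sum cost E1 = (\<Sum>i<n. dist (sources I ! i) (pos L (up i)))"
  proof -
    have "sum cost E1 = (\<Sum>i<n. cost (Source i, up i))"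
      unfolding E1_def by (rule sum.reindex_cong[of "\<lambda>i. (Source i, up i)"]) (auto simp: inj_on_def)
    also have "\<dots> = (\<Sum>i<n. dist (sources I ! i) (pos L (up i)))"
    proof (rule sum.cong[OF refl])
      fix i assume "i \<in> {..<n}"
      then show "cost (Source i, up i) = dist (sources I ! i) (pos L (up i))"
        using load[of i "Source i"] lay(7) I by (simp add: cost_def)
    qed
    finally show ?thesis .
  qed
  moreover have "sum cost E2 = (\<Sum>v\<in>V - {Sink 0}. dist (pos L v) t)"
  proof -
    have "sum cost E2 = (\<Sum>v\<in>V - {Sink 0}. cost (v, Sink 0))"
      unfolding E2_def by (rule sum.reindex_cong[of "\<lambda>v. (v, Sink 0)"]) (auto simp: inj_on_def)
    also have "\<dots> = (\<Sum>v\<in>V - {Sink 0}. dist (pos L v) t)"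
    proof (rule sum.cong[OF refl])
      fix v assume "v \<in> V - {Sink 0}"
      then obtain i where "i < n" "(Source i, v) \<in> arcs L" using up by (auto simp: V_def)
      then show "cost (v, Sink 0) = dist (pos L v) t"
        using load[of i v] r_into_rtrancl[of "(Source i, v)" "arcs L"] lay(8) I by (auto simp: cost_def)
    qed
    finally show ?thesis .
  qed
  moreover have "sum cost E1 + sum cost E2 \<le> sum cost (arcs L)"
  proof -
    have "sum cost E1 + sum cost E2 = sum cost (E1 \<union> E2)"
      by (rule sum.union_disjoint[symmetric]) (use disj E fin in \<open>auto intro: finite_subset\<close>)
    also have "\<dots> \<le> sum cost (arcs L)"
      by (rule sum_mono2) (use fin E in \<open>auto simp: cost_def\<close>)
    finally show ?thesis .
  qed
  moreover have "(\<Sum>q\<in>pos L ` V. dist q t) \<le> (\<Sum>v\<in>V - {Sink 0}. dist (pos L v) t)"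
  proof -
    have finV: "finite V" by (simp add: V_def)
    have "(\<Sum>q\<in>pos L ` V. dist q t) \<le> (\<Sum>v\<in>V. dist (pos L v) t)"
      using sum_image_le[OF finV, of "\<lambda>q. dist q t" "pos L"] by (simp add: comp_def)
    also have "\<dots> = (\<Sum>v\<in>V - {Sink 0}. dist (pos L v) t)"
      by (rule sum.mono_neutral_right) (use finV lay(8) in auto)
    finally show ?thesis .
  qed
  ultimately have "(\<Sum>i<n. dist (sources I ! i) (pos L (up i))) + (\<Sum>q\<in>pos L ` V. dist q t) \<le> layout_cost I L"
    unfolding layout_cost_def cost_def[symmetric] by simp
  then show ?thesis
    using that[of "pos L ` V" "\<lambda>i. pos L (up i)"] by (auto simp: V_def n_def)
qed

text \<open>The closest-point map onto \<open>H\<close> does not increase distances and fixes the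
  sources and the sink.\<close>

lemma layout_projected_sites:
  assumes L: "is_layout I L" and I: "sinks I = [t]" "layers I = 1" "alpha I = 0"
    and H: "H = convex hull (set (sources I) \<union> {t})"
  obtains Q par where "finite Q" "Q \<subseteq> H" "\<And>i. i < length (sources I) \<Longrightarrow> par i \<in> Q"
    "(\<Sum>i<length (sources I). dist (sources I ! i) (par i)) + (\<Sum>q\<in>Q. dist q t) \<le> layout_cost I L"
proof -
  obtain P par where P: "finite P" "\<And>i. i < length (sources I) \<Longrightarrow> par i \<in> P"
    "(\<Sum>i<length (sources I). dist (sources I ! i) (par i)) + (\<Sum>q\<in>P. dist q t) \<le> layout_cost I L"
    using layout_star_decomposition[OF L I] by blast
  have Hc: "convex H" "closed H" "H \<noteq> {}" and inH: "t \<in> H" "\<And>x. x \<in> set (sources I) \<Longrightarrow> x \<in> H"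
    unfolding H by (auto intro!: compact_imp_closed finite_imp_compact_convex_hull hull_inc)
  define pr where "pr = closest_point H"
  have le: "dist x (pr y) \<le> dist x y" if "x \<in> H" for x y
    using closest_point_lipschitz[OF Hc, of x y] closest_point_self[OF that] by (simp add: pr_def)
  have "(\<Sum>q\<in>pr ` P. dist q t) \<le> (\<Sum>q\<in>P. dist (pr q) t)"
    using sum_image_le[OF P(1), of "\<lambda>q. dist q t" pr] by (simp add: comp_def)
  also have "\<dots> \<le> (\<Sum>q\<in>P. dist q t)"
    using le[OF inH(1)] by (intro sum_mono) (simp add: dist_commute)
  finally have "(\<Sum>q\<in>pr ` P. dist q t) \<le> (\<Sum>q\<in>P. dist q t)" .
  moreover have "(\<Sum>i<length (sources I). dist (sources I ! i) (pr (par i))) \<le>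
      (\<Sum>i<length (sources I). dist (sources I ! i) (par i))"
    using le inH(2) by (intro sum_mono) simp
  ultimately have "(\<Sum>i<length (sources I). dist (sources I ! i) (pr (par i))) + (\<Sum>q\<in>pr ` P. dist q t) \<le> layout_cost I L"
    using P(3) by linarith
  then show ?thesis
    using that[of "pr ` P" "\<lambda>i. pr (par i)"] P(1,2) closest_point_in_set[OF Hc(2,3)] unfolding pr_def by blast
qed

text \<open>A Steiner vertex without children would be a leaf, hence \<open>onto\<close>. For
  \<open>m = 0\<close> there are no sources either, and the layout is empty: a sink becomes a vertex
  only as the parent of another one.\<close>

lemma output_layout_correct:
  assumes I: "sinks I = [t]" "layers I = 1" "alpha I = 0" and n: "n = length (sources I)"
    and m: "m = nmem s 1 0"
    and src: "\<And>i. i < n \<Longrightarrow> nmem s 2 i = n + ix i \<and> ix i < m"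
    and onto: "\<And>j. j < m \<Longrightarrow> \<exists>i<n. ix i = j"
    and st: "\<And>j. j < m \<Longrightarrow> nmem s 2 (n + j) = n + m"
  shows "is_layout I (output_layout I s)"
    "layout_cost I (output_layout I s) \<le>
      (\<Sum>i<n. dist (sources I ! i) (rmem s 3 (ix i), rmem s 4 (ix i))) + (\<Sum>j<m. dist (rmem s 3 j, rmem s 4 j) t)"
proof -
  let ?L = "output_layout I s"
  have par: "parent ?L v = (case v of Source i \<Rightarrow> if i < n then Some (Steiner (ix i)) else None
      | Steiner j \<Rightarrow> if j < m then Some (Sink 0) else None | Sink j \<Rightarrow> None)" for v
    using src st by (auto simp: output_layout_def output_parent_def Let_def n[symmetric] m[symmetric, unfolded One_nat_def]
        vertex_of_code_def split: vertex.split)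
  have verts: "verts ?L = {v. parent ?L v \<noteq> None} \<union> {v. \<exists>u. parent ?L u = Some v}"
    by (simp add: output_layout_def Let_def)
  have vertsE: "verts ?L = Source ` {..<n} \<union> Steiner ` {..<m} \<union> (if m = 0 then {} else {Sink 0})"
  proof -
    have "{v. parent ?L v \<noteq> None} = Source ` {..<n} \<union> Steiner ` {..<m}"
    proof (rule set_eqI)
      fix v show "v \<in> {v. parent ?L v \<noteq> None} \<longleftrightarrow> v \<in> Source ` {..<n} \<union> Steiner ` {..<m}"
        by (cases v) (auto simp: par)
    qed
    moreover have "{v. \<exists>u. parent ?L u = Some v} = Steiner ` {..<m} \<union> (if m = 0 then {} else {Sink 0})"
    proof (rule set_eqI, rule iffI)
      fix v assume "v \<in> {v. \<exists>u. parent ?L u = Some v}"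
      then obtain u where u: "parent ?L u = Some v" by blast
      show "v \<in> Steiner ` {..<m} \<union> (if m = 0 then {} else {Sink 0})"
        using u src less_nat_zero_code by (cases u) (fastforce simp: par split: if_splits)+
    next
      fix v assume v: "v \<in> Steiner ` {..<m} \<union> (if m = 0 then {} else {Sink 0})"
      show "v \<in> {v. \<exists>u. parent ?L u = Some v}"
      proof (cases "v = Sink 0")
        case True
        then have "parent ?L (Steiner 0) = Some v" using v by (auto simp: par split: if_splits)
        then show ?thesis by blast
      next
        case False
        then obtain j where j: "j < m" "v = Steiner j" using v by (auto split: if_splits)
        then obtain i where "i < n" "ix i = j" using onto by blast
        then have "parent ?L (Source i) = Some v" using j by (simp add: par)
        then show ?thesis by blast
      qed
    qed
    ultimately show ?thesis unfolding verts by auto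
  qed
  have arcs: "arcs ?L = (\<lambda>i. (Source i, Steiner (ix i))) ` {..<n} \<union> (\<lambda>j. (Steiner j, Sink 0)) ` {..<m}"
  proof (rule set_eqI)
    fix e :: "vertex \<times> vertex"
    obtain a b where e: "e = (a, b)" by fastforce
    show "e \<in> arcs ?L \<longleftrightarrow> e \<in> (\<lambda>i. (Source i, Steiner (ix i))) ` {..<n} \<union> (\<lambda>j. (Steiner j, Sink 0)) ` {..<m}"
      by (cases a) (auto simp: e arcs_def vertsE par)
  qed
  define rk where "rk v = (case v of Source i \<Rightarrow> 0 | Steiner j \<Rightarrow> 1 | Sink j \<Rightarrow> (2::nat))" for v
  \<comment> \<open>Every arc rises by one level, which yields both acyclicity and the height
    bound.\<close>
  have rk: "rk v = Suc (rk u)" if "(u, v) \<in> arcs ?L" for u v using that by (auto simp: arcs rk_def)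
  have "acyclic (arcs ?L)"
    by (rule acyclicI_order[where f = "\<lambda>v. 2 - rk v"]) (use rk in \<open>auto simp: arcs rk_def\<close>)
  moreover have "d \<le> layers I + 1" if "(u, v) \<in> arcs ?L ^^ d" for u v d
  proof -
    have "rk v = rk u + d" using that by (induction d arbitrary: v) (auto dest: rk)
    moreover have "rk v \<le> 2" by (simp add: rk_def split: vertex.split)
    ultimately show ?thesis using I by simp
  qed
  moreover have "leaves ?L = Source ` {..<n}"
  proof -
    have "\<exists>u. (u, Steiner j) \<in> arcs ?L" if "j < m" for j
      using onto[OF that] unfolding arcs by blast
    then show ?thesis unfolding leaves_def vertsE arcs by (auto split: if_splits)
  qed
  moreover have "roots ?L = (if m = 0 then {} else {Sink 0})"
    by (auto simp: roots_def vertsE par split: if_splits)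
  moreover have "finite (verts ?L)" by (simp add: vertsE)
  moreover have "arcs ?L \<subseteq> verts ?L \<times> verts ?L" using src by (auto simp: arcs vertsE split: if_splits)
  moreover have pos: "pos ?L v = (case v of Source i \<Rightarrow> sources I ! i | Sink j \<Rightarrow> sinks I ! j
      | Steiner j \<Rightarrow> (rmem s 3 j, rmem s 4 j))" for v
    by (simp add: output_layout_def Let_def)
  ultimately show "is_layout I ?L"
    unfolding is_layout_def rooted_forest_def height_at_most_def n[symmetric]
    using I by (auto simp: vertsE split: if_splits)
  \<comment> \<open>With exponent 0 the factor is 0 or 1, so lengths bound costs without computing
    any load.\<close>
  have le1: "a * real k powr alpha I \<le> a" if "0 \<le> a" for a k
    using that I by (cases "k = 0") auto
  have "layout_cost I ?L \<le> (\<Sum>(u, v)\<in>arcs ?L. dist (pos ?L u) (pos ?L v))"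
    unfolding layout_cost_def by (rule sum_mono) (auto intro!: le1)
  also have "\<dots> = (\<Sum>(u, v)\<in>(\<lambda>i. (Source i, Steiner (ix i))) ` {..<n}. dist (pos ?L u) (pos ?L v)) +
      (\<Sum>(u, v)\<in>(\<lambda>j. (Steiner j, Sink 0)) ` {..<m}. dist (pos ?L u) (pos ?L v))"
    unfolding arcs by (rule sum.union_disjoint) auto
  also have "\<dots> = (\<Sum>i<n. dist (sources I ! i) (rmem s 3 (ix i), rmem s 4 (ix i))) + (\<Sum>j<m. dist (rmem s 3 j, rmem s 4 j) t)"
    by (simp add: sum.reindex inj_on_def pos I)
  finally show "layout_cost I ?L \<le> (\<Sum>i<n. dist (sources I ! i) (rmem s 3 (ix i), rmem s 4 (ix i))) +
    (\<Sum>j<m. dist (rmem s 3 j, rmem s 4 j) t)" .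
qed

section \<open>Loop-free code\<close>

fun straight :: "com \<Rightarrow> bool" where
  "straight (Seq c d) \<longleftrightarrow> straight c \<and> straight d"
| "straight (If b c d) \<longleftrightarrow> straight c \<and> straight d"
| "straight (While b c) \<longleftrightarrow> False"
| "straight c \<longleftrightarrow> True"

text \<open>Symbolic execution: the effect of a loop-free block becomes a term that rewriting can
  evaluate. The clause for \<open>While\<close> is a dummy, as \<open>straight\<close> excludes
  loops.\<close>

fun result :: "com \<Rightarrow> state \<Rightarrow> state" where
  "result SKIP s = s"
| "result (NAssign a i e) s = nupd a (nval i s) (nval e s) s"
| "result (RAssign a i e) s = rupd a (nval i s) (rval e s) s"
| "result (Seq c d) s = result d (result c s)"
| "result (If b c d) s = (if bval b s then result c s else result d s)"
| "result (While b c) s = s"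

fun steps :: "com \<Rightarrow> real" where
  "steps (Seq c d) = steps c + steps d"
| "steps (If b c d) = max (steps c) (steps d) + 1"
| "steps c = 1"

lemma exec_straight: "straight c \<Longrightarrow> \<exists>k. exec c s k (result c s) \<and> real k \<le> steps c"
proof (induction c arbitrary: s)
  case (Seq c d)
  obtain j k where "exec c s j (result c s)" "real j \<le> steps c"
    "exec d (result c s) k (result d (result c s))" "real k \<le> steps d" using Seq by (meson straight.simps(1))
  then show ?case by (auto intro!: exI[of _ "j + k"] exec.Seq)
next
  case (If b c d)
  show ?case
  proof (cases "bval b s")
    case True
    obtain k where "exec c s k (result c s)" "real k \<le> steps c" using If by (meson straight.simps(2))
    then show ?thesis using True exec.IfTrue[of b s c k "result c s" d] by (auto intro!: exI[of _ "k + 1"])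
  next
    case False
    obtain k where "exec d s k (result d s)" "real k \<le> steps d" using If by (meson straight.simps(2))
    then show ?thesis using False exec.IfFalse[of b s d k "result d s" c] by (auto intro!: exI[of _ "k + 1"])
  qed
qed (auto intro!: exI[of _ "1::nat"] exec.Skip[simplified] exec.NAssign[simplified] exec.RAssign[simplified])

lemma runs_straight: "straight c \<Longrightarrow> steps c \<le> B \<Longrightarrow> Q (result c s) \<Longrightarrow> runs c B Q s"
  using exec_straight[of c s] unfolding runs_def by (meson order_trans)

lemma runs_SeqI:
  assumes "runs c Bc R s" "\<And>s'. frame c s s' \<Longrightarrow> R s' \<Longrightarrow> runs d Bd Q s'" "Bc + Bd \<le> B"
  shows "runs (Seq c d) B Q s"
proof -
  have "runs c Bc (\<lambda>s'. runs d Bd Q s') s"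
    by (rule runs_mono[OF assms(1) order_refl assms(2)])
  then show ?thesis using runs_mono[OF runs_Seq assms(3)] by blast
qed

abbreviation NV :: "nat \<Rightarrow> nexp" where "NV a \<equiv> NCell a (NConst 0)"
abbreviation NSet :: "nat \<Rightarrow> nexp \<Rightarrow> com" where "NSet a e \<equiv> NAssign a (NConst 0) e"
abbreviation NLe :: "nexp \<Rightarrow> nexp \<Rightarrow> bexp" where "NLe e f \<equiv> BNot (NLess f e)"
abbreviation BOr :: "bexp \<Rightarrow> bexp \<Rightarrow> bexp" where "BOr b c \<equiv> BNot (BAnd (BNot b) (BNot c))"

section \<open>Solutions on an interval of positions\<close>

text \<open>
  Position \<open>p\<close> is connected to the Steiner point \<open>\<sigma> p\<close>, and \<open>l p\<close> is a representative of its group, so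
  that the fixed points of \<open>l\<close> enumerate the groups.
\<close>

definition sol_ok :: "(nat \<Rightarrow> point) \<Rightarrow> point \<Rightarrow> nat \<Rightarrow> nat \<Rightarrow> (nat \<Rightarrow> nat) \<Rightarrow> (nat \<Rightarrow> point) \<Rightarrow> real \<Rightarrow> bool" where
  "sol_ok X t u v l \<sigma> z \<longleftrightarrow>
     (\<forall>p. u \<le> p \<longrightarrow> p < v \<longrightarrow> u \<le> l p \<and> l p < v \<and> l (l p) = l p \<and> \<sigma> (l p) = \<sigma> p) \<and>
     (\<Sum>p\<in>{u..<v}. dist (X p) (\<sigma> p)) + (\<Sum>p\<in>{p\<in>{u..<v}. l p = p}. dist (\<sigma> p) t) \<le> z"

text \<open>The group and the two gaps partition the interval, so the costs add. An empty group has
  no representative, while \<open>w\<close> still contains the distance from \<open>q\<close> to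
  \<open>t\<close>; hence only an inequality for the connections to the sink.\<close>

lemma sol_ok_combine:
  assumes g: "gaps u v u1 v1 u2 v2" and s1: "sol_ok X t u1 v1 l1 \<sigma>1 z1" and s2: "sol_ok X t u2 v2 l2 \<sigma>2 z2"
    and vM: "v \<le> M" and L: "L = filter (in_group u v u1 v1 u2 v2) [0..<M]"
    and w: "star_cost t (map X L) q \<le> w"
    and l: "\<And>p. u \<le> p \<Longrightarrow> p < v \<Longrightarrow> l p = (if u1 \<le> p \<and> p < v1 then l1 p else if u2 \<le> p \<and> p < v2 then l2 p else m)"
    and \<sigma>: "\<And>p. u \<le> p \<Longrightarrow> p < v \<Longrightarrow> \<sigma> p = (if u1 \<le> p \<and> p < v1 then \<sigma>1 p else if u2 \<le> p \<and> p < v2 then \<sigma>2 p else q)"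
    and m: "L \<noteq> [] \<Longrightarrow> m \<in> set L"
  shows "sol_ok X t u v l \<sigma> (w + (z1 + z2))"
proof -
  define D where "D = {p. in_group u v u1 v1 u2 v2 p}"
  have setL: "set L = D" using vM by (auto simp: L D_def in_group_def)
  have le: "u \<le> u1" "u1 \<le> v1" "v1 \<le> u2" "u2 \<le> v2" "v2 \<le> v" using g by (auto simp: gaps_def)
  have part: "{u..<v} = {u1..<v1} \<union> ({u2..<v2} \<union> D)" using le by (auto simp: D_def in_group_def)
  have disj: "{u1..<v1} \<inter> ({u2..<v2} \<union> D) = {}" "{u2..<v2} \<inter> D = {}" using le by (auto simp: D_def in_group_def)
  have finD: "finite D" using setL by (metis List.finite_set)
  have on1: "l p = l1 p" "\<sigma> p = \<sigma>1 p" if "p \<in> {u1..<v1}" for p using that l \<sigma> le by auto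
  have on2: "l p = l2 p" "\<sigma> p = \<sigma>2 p" if "p \<in> {u2..<v2}" for p using that l \<sigma> le by auto
  have onD: "l p = m" "\<sigma> p = q" if "p \<in> D" for p using that l \<sigma> by (auto simp: D_def in_group_def)
  have mD: "m \<in> D" if "p \<in> D" for p
  proof -
    have "L \<noteq> []" using that setL by auto
    then show ?thesis using m setL by auto
  qed
  have "u \<le> l p \<and> l p < v \<and> l (l p) = l p \<and> \<sigma> (l p) = \<sigma> p" if "u \<le> p" "p < v" for p
  proof -
    have "p \<in> {u..<v}" using that by simp
    then consider "p \<in> {u1..<v1}" | "p \<in> {u2..<v2}" | "p \<in> D" unfolding part by blast
    then show ?thesis
    proof cases
      case 1
      then have "l1 p \<in> {u1..<v1}" "l1 (l1 p) = l1 p" "\<sigma>1 (l1 p) = \<sigma>1 p" using s1 by (auto simp: sol_ok_def)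
      then show ?thesis using 1 on1 le by auto
    next
      case 2
      then have "l2 p \<in> {u2..<v2}" "l2 (l2 p) = l2 p" "\<sigma>2 (l2 p) = \<sigma>2 p" using s2 by (auto simp: sol_ok_def)
      then show ?thesis using 2 on2 le by auto
    next
      case 3
      then show ?thesis using onD mD by (auto simp: D_def in_group_def)
    qed
  qed
  moreover have "(\<Sum>p\<in>{u..<v}. dist (X p) (\<sigma> p)) =
     (\<Sum>p\<in>{u1..<v1}. dist (X p) (\<sigma>1 p)) + ((\<Sum>p\<in>{u2..<v2}. dist (X p) (\<sigma>2 p)) + (\<Sum>p\<in>D. dist (X p) q))"
    unfolding part using disj finD on1 on2 onD by (simp add: sum.union_disjoint)
  moreover have "(\<Sum>p\<in>{p\<in>{u..<v}. l p = p}. dist (\<sigma> p) t) \<le>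
     (\<Sum>p\<in>{p\<in>{u1..<v1}. l1 p = p}. dist (\<sigma>1 p) t) + ((\<Sum>p\<in>{p\<in>{u2..<v2}. l2 p = p}. dist (\<sigma>2 p) t) + dist q t)"
  proof -
    let ?A = "{p\<in>{u1..<v1}. l1 p = p}" and ?B = "{p\<in>{u2..<v2}. l2 p = p}" and ?C = "{p\<in>D. m = p}"
    have "{p\<in>{u..<v}. l p = p} = ?A \<union> (?B \<union> ?C)" unfolding part using on1 on2 onD by auto
    then have "(\<Sum>p\<in>{p\<in>{u..<v}. l p = p}. dist (\<sigma> p) t) = (\<Sum>p\<in>?A \<union> (?B \<union> ?C). dist (\<sigma> p) t)" by simp
    also have "\<dots> = (\<Sum>p\<in>?A. dist (\<sigma> p) t) + (\<Sum>p\<in>?B \<union> ?C. dist (\<sigma> p) t)"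
      by (rule sum.union_disjoint) (use disj finD in auto)
    also have "(\<Sum>p\<in>?B \<union> ?C. dist (\<sigma> p) t) = (\<Sum>p\<in>?B. dist (\<sigma> p) t) + (\<Sum>p\<in>?C. dist (\<sigma> p) t)"
      by (rule sum.union_disjoint) (use disj finD in auto)
    also have "(\<Sum>p\<in>?C. dist (\<sigma> p) t) \<le> dist q t"
    proof (cases "m \<in> D")
      case True
      then have "?C = {m}" by auto
      then show ?thesis using onD True by simp
    qed (auto intro: sum.neutral[THEN ord_eq_le_trans])
    also have "(\<Sum>p\<in>?A. dist (\<sigma> p) t) = (\<Sum>p\<in>?A. dist (\<sigma>1 p) t)" using on1 by (intro sum.cong) auto
    also have "(\<Sum>p\<in>?B. dist (\<sigma> p) t) = (\<Sum>p\<in>?B. dist (\<sigma>2 p) t)" using on2 by (intro sum.cong) auto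
    finally show ?thesis by simp
  qed
  moreover have "(\<Sum>p\<in>D. dist (X p) q) + dist q t \<le> w"
  proof -
    have "(\<Sum>p\<leftarrow>L. dist (X p) q) = (\<Sum>p\<in>set L. dist (X p) q)"
      by (rule sum_list_distinct_conv_sum_set) (simp add: L)
    then show ?thesis using w setL by (simp add: star_cost_def comp_def)
  qed
  moreover have "(\<Sum>p\<in>{u1..<v1}. dist (X p) (\<sigma>1 p)) + (\<Sum>p\<in>{p\<in>{u1..<v1}. l1 p = p}. dist (\<sigma>1 p) t) \<le> z1"
    "(\<Sum>p\<in>{u2..<v2}. dist (X p) (\<sigma>2 p)) + (\<Sum>p\<in>{p\<in>{u2..<v2}. l2 p = p}. dist (\<sigma>2 p) t) \<le> z2"
    using s1 s2 by (auto simp: sol_ok_def)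
  ultimately show ?thesis unfolding sol_ok_def by (intro conjI allI impI) (blast, blast, blast, blast, linarith)
qed

section \<open>The dynamic program\<close>

text \<open>
  There are \<open>2 n\<close> positions, as the cyclic order is written down twice to turn all its rotations into
  intervals.
\<close>

record table =
  has :: "nat \<Rightarrow> nat"
  lab :: "nat \<Rightarrow> nat"
  val :: "nat \<Rightarrow> real"
  sx :: "nat \<Rightarrow> real"
  sy :: "nat \<Rightarrow> real"

text \<open>Row-major addressing with base \<open>2 * n + 1\<close>, because the ends of intervals
  range from 0 to \<open>2 * n\<close>.\<close>

definition ix2 :: "nat \<Rightarrow> nat \<Rightarrow> nat \<Rightarrow> nat" where
  "ix2 n u v = u * (2 * n + 1) + v"

definition ix3 :: "nat \<Rightarrow> nat \<Rightarrow> nat \<Rightarrow> nat \<Rightarrow> nat" where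
  "ix3 n u v p = ix2 n u v * (2 * n + 1) + p"

lemma mult_add_inj:
  fixes u v M :: nat
  assumes "v < M" "v' < M"
  shows "u * M + v = u' * M + v' \<longleftrightarrow> u = u' \<and> v = v'"
proof
  assume e: "u * M + v = u' * M + v'"
  have "(u * M + v) div M = u" "(u' * M + v') div M = u'" using assms by auto
  then have "u = u'" using e by metis
  then show "u = u' \<and> v = v'" using e by simp
qed simp

lemma ix2_inj: "v < 2 * n + 1 \<Longrightarrow> v' < 2 * n + 1 \<Longrightarrow> ix2 n u v = ix2 n u' v' \<longleftrightarrow> u = u' \<and> v = v'"
  unfolding ix2_def by (rule mult_add_inj)

lemma ix3_inj: "v < 2 * n + 1 \<Longrightarrow> v' < 2 * n + 1 \<Longrightarrow> p < 2 * n + 1 \<Longrightarrow> p' < 2 * n + 1 \<Longrightarrow>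
  ix3 n u v p = ix3 n u' v' p' \<longleftrightarrow> u = u' \<and> v = v' \<and> p = p'"
  unfolding ix3_def using mult_add_inj ix2_inj by metis

definition sound :: "nat \<Rightarrow> (nat \<Rightarrow> point) \<Rightarrow> point \<Rightarrow> table \<Rightarrow> nat \<Rightarrow> nat \<Rightarrow> bool" where
  "sound n X t x u v \<longleftrightarrow> sol_ok X t u v (\<lambda>p. lab x (ix3 n u v p))
     (\<lambda>p. (sx x (ix3 n u v p), sy x (ix3 n u v p))) (val x (ix2 n u v))"

text \<open>\<open>K\<close> separates the arrays that \<open>W\<close> may overwrite from those of
  the solver, whose numbers start at \<open>K + 5\<close> to stay clear of the arrays 0 to 4 used
  for input and output even if \<open>K\<close> is 0. \<open>W\<close> may read anything, but its
  contract holds for every content of the memory outside its input.\<close>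

locale weber_machine =
  fixes W :: com and T :: "nat \<Rightarrow> real \<Rightarrow> real" and K :: nat
  assumes W: "weber_program W T" and K: "\<And>a. a \<in> nmods W \<union> rmods W \<Longrightarrow> a < K"
begin

lemma fresh [simp]: "K + a \<notin> nmods W" "K + a \<notin> rmods W"
  using K[of "K + a"] by auto

text \<open>
  \<open>W\<close> does not write to the arrays from \<open>K\<close> on. The prefix of a name tells natural scalars (\<open>v\<close>, stored
  in cell 0), natural arrays (\<open>a\<close>) and real arrays (\<open>r\<close>), as well as expressions (\<open>e\<close>) and tests (\<open>b\<close>).
\<close>

abbreviation "vN \<equiv> K + 5"
abbreviation "vI \<equiv> K + 6"
abbreviation "vJ \<equiv> K + 7"
abbreviation "vL \<equiv> K + 8"
abbreviation "aFL \<equiv> K + 9"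
abbreviation "vRK \<equiv> K + 10"
abbreviation "aPM \<equiv> K + 11"
abbreviation "vD \<equiv> K + 12"
abbreviation "vU \<equiv> K + 13"
abbreviation "vU1 \<equiv> K + 14"
abbreviation "vV1 \<equiv> K + 15"
abbreviation "vU2 \<equiv> K + 16"
abbreviation "vV2 \<equiv> K + 17"
abbreviation "vP \<equiv> K + 18"
abbreviation "vCN \<equiv> K + 19"
abbreviation "vLD \<equiv> K + 20"
abbreviation "aHS \<equiv> K + 21"
abbreviation "aLB \<equiv> K + 22"
abbreviation "vBU \<equiv> K + 23"
abbreviation "aIX \<equiv> K + 24"
abbreviation "rE \<equiv> K + 5"
abbreviation "rX \<equiv> K + 6"
abbreviation "rY \<equiv> K + 7"
abbreviation "rF \<equiv> K + 8"
abbreviation "rS \<equiv> K + 9"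
abbreviation "rT \<equiv> K + 10"
abbreviation "rC \<equiv> K + 11"

abbreviation "eM \<equiv> NAdd (NMul (NConst 2) (NV vN)) (NConst 1)"
abbreviation "eIx2 e f \<equiv> NAdd (NMul e eM) f"
abbreviation "eIx3 e f g \<equiv> NAdd (NMul (eIx2 e f) eM) g"
abbreviation "eV \<equiv> NAdd (NAdd (NV vU) (NV vD)) (NConst 1)"
abbreviation "bGap1 \<equiv> BAnd (NLe (NV vU1) (NV vP)) (NLess (NV vP) (NV vV1))"
abbreviation "bGap2 \<equiv> BAnd (NLe (NV vU2) (NV vP)) (NLess (NV vP) (NV vV2))"

text \<open>The group is written directly into the input arrays of \<open>W\<close>. The last
  position collected stays in \<open>vLD\<close> and becomes the representative.\<close>

definition collect_body :: com where
  "collect_body =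
     If (BAnd (BAnd (NLe (NV vU) (NV vP)) (NLess (NV vP) eV)) (BAnd (BNot bGap1) (BNot bGap2)))
       (Seq (RAssign 1 (NV vCN) (RCell rX (NCell aPM (NV vP))))
       (Seq (RAssign 2 (NV vCN) (RCell rY (NCell aPM (NV vP))))
       (Seq (NSet vCN (NAdd (NV vCN) (NConst 1)))
            (NSet vLD (NV vP))))) SKIP"

definition collect :: com where
  "collect = Seq (NSet vCN (NConst 0)) (For vP eM collect_body)"

definition call_weber :: com where
  "call_weber =
     Seq (Seq (NSet 0 (NV vCN))
     (Seq (RAssign 0 (NConst 0) (RCell rE (NConst 0)))
     (Seq (RAssign 0 (NConst 1) (RCell rE (NConst 1)))
          (RAssign 0 (NConst 2) (RCell rE (NConst 2)))))) W"

definition candidate_value :: com where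
  "candidate_value = RAssign rC (NConst 0) (RAdd (RCell 3 (NConst 0))
     (RAdd (RCell rF (eIx2 (NV vU1) (NV vV1))) (RCell rF (eIx2 (NV vU2) (NV vV2)))))"

definition write_position :: "nexp \<Rightarrow> rexp \<Rightarrow> rexp \<Rightarrow> com" where
  "write_position l x y = Seq (NAssign aLB (eIx3 (NV vU) eV (NV vP)) l)
     (Seq (RAssign rS (eIx3 (NV vU) eV (NV vP)) x) (RAssign rT (eIx3 (NV vU) eV (NV vP)) y))"

definition copy_position :: "nexp \<Rightarrow> nexp \<Rightarrow> com" where
  "copy_position e f = write_position (NCell aLB (eIx3 e f (NV vP)))
     (RCell rS (eIx3 e f (NV vP))) (RCell rT (eIx3 e f (NV vP)))"

definition store_body :: com where
  "store_body = If bGap1 (copy_position (NV vU1) (NV vV1))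
     (If bGap2 (copy_position (NV vU2) (NV vV2))
       (write_position (NV vLD) (RCell 3 (NConst 1)) (RCell 3 (NConst 2))))"

definition store :: com where
  "store = Seq (Seq (NAssign aHS (eIx2 (NV vU) eV) (NConst 1))
     (RAssign rF (eIx2 (NV vU) eV) (RCell rC (NConst 0)))) (For vP eM store_body)"

abbreviation "bKeep \<equiv> BAnd (NLess (NConst 0) (NCell aHS (eIx2 (NV vU) eV)))
     (BNot (RLess (RCell rC (NConst 0)) (RCell rF (eIx2 (NV vU) eV))))"

definition candidate :: com where
  "candidate = Seq collect (Seq call_weber (Seq candidate_value
     (If bKeep
       SKIP store)))"

definition bValid :: bexp where
  "bValid = BAnd (BAnd (NLe (NV vU) (NV vU1)) (BAnd (NLe (NV vU1) (NV vV1)) (BAnd (NLe (NV vV1) (NV vU2))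
     (BAnd (NLe (NV vU2) (NV vV2)) (NLe (NV vV2) eV)))))
     (BAnd (BAnd (NLess (NSub (NV vV1) (NV vU1)) (NSub eV (NV vU))) (NLess (NSub (NV vV2) (NV vU2)) (NSub eV (NV vU))))
       (NLe eV (NMul (NConst 2) (NV vN))))"

text \<open>\<open>vD\<close> is the length of the interval minus one, so its right end
  \<open>eV\<close> is computed instead of searched. This leaves \<open>n\<close> phases with five
  nested loops each.\<close>

definition dp :: com where
  "dp = For vD (NV vN) (For vU eM (For vU1 eM (For vV1 eM (For vU2 eM (For vV2 eM
     (If bValid candidate SKIP))))))"

lemma nmods_candidate [simp]:
  "nmods collect_body = {vCN, vLD}" "rmods collect_body = {1, 2}"
  "nmods store_body = {aLB}" "rmods store_body = {rS, rT}"
  by (auto simp: collect_body_def store_body_def copy_position_def write_position_def)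

lemma nmods_parts [simp]:
  "nmods collect = {vCN, vLD, vP}" "rmods collect = {1, 2}"
  "nmods call_weber = insert 0 (nmods W)" "rmods call_weber = insert 0 (rmods W)"
  "nmods candidate_value = {}" "rmods candidate_value = {rC}"
  "nmods store = {aHS, aLB, vP}" "rmods store = {rF, rS, rT}"
  by (auto simp: collect_def call_weber_def candidate_value_def store_def)

definition tab :: "state \<Rightarrow> table" where
  "tab s = \<lparr>has = nmem s aHS, lab = nmem s aLB, val = rmem s rF, sx = rmem s rS, sy = rmem s rT\<rparr>"

definition context_ok :: "nat \<Rightarrow> real \<Rightarrow> point \<Rightarrow> (nat \<Rightarrow> point) \<Rightarrow> state \<Rightarrow> bool" where
  "context_ok n \<epsilon> t X s \<longleftrightarrow> nmem s vN 0 = n \<and> rmem s rE 0 = \<epsilon> \<and> rmem s rE 1 = fst t \<and> rmem s rE 2 = snd t \<and>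
     (\<forall>p<2 * n. rmem s rX (nmem s aPM p) = fst (X p) \<and> rmem s rY (nmem s aPM p) = snd (X p))"

definition vars :: "nat \<Rightarrow> nat \<Rightarrow> nat \<Rightarrow> nat \<Rightarrow> nat \<Rightarrow> nat \<Rightarrow> state \<Rightarrow> bool" where
  "vars u v u1 v1 u2 v2 s \<longleftrightarrow> nmem s vU 0 = u \<and> nmem s vU 0 + nmem s vD 0 + 1 = v \<and>
     nmem s vU1 0 = u1 \<and> nmem s vV1 0 = v1 \<and> nmem s vU2 0 = u2 \<and> nmem s vV2 0 = v2"

lemma runs_collect:
  assumes c: "context_ok n \<epsilon> t X s" and vs: "vars u v u1 v1 u2 v2 s" and v: "v \<le> 2 * n"
    and L: "L = filter (in_group u v u1 v1 u2 v2) [0..<Suc (2 * n)]"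
  shows "runs collect (14 * real n + 11) (\<lambda>s'. nmem s' vCN 0 = length L \<and>
     (\<forall>i<length L. rmem s' 1 i = fst (X (L ! i)) \<and> rmem s' 2 i = snd (X (L ! i))) \<and>
     (L \<noteq> [] \<longrightarrow> nmem s' vLD 0 \<in> set L)) s"
proof -
  let ?P = "in_group u v u1 v1 u2 v2"
  define L' where "L' i = filter ?P [0..<i]" for i
  define J where "J i s' \<longleftrightarrow> nmem s' vCN 0 = length (L' i) \<and>
     (\<forall>j<length (L' i). rmem s' 1 j = fst (X (L' i ! j)) \<and> rmem s' 2 j = snd (X (L' i ! j))) \<and>
     (L' i \<noteq> [] \<longrightarrow> nmem s' vLD 0 \<in> set (L' i))" for i and s' :: state
  define s0 where "s0 = nupd vCN 0 0 s"
  have "runs (For vP eM collect_body) (real (2 * n + 1) * (5 + 2) + 2) (J (2 * n + 1)) s0"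
  proof (rule runs_For)
    fix s' assume "frame (For vP eM collect_body) s0 s'"
    then show "nval eM s' = 2 * n + 1" using c by (auto simp: frame_def s0_def context_ok_def)
  next
    show "J 0 (nupd vP 0 0 s0)" by (simp add: J_def L'_def s0_def)
  next
    fix i s'
    assume i: "i < 2 * n + 1" "frame (For vP eM collect_body) s0 s'" "nmem s' vP 0 = i" "J i s'"
    have fr: "nmem s' vU 0 = u" "u + nmem s' vD 0 + 1 = v" "nmem s' vU1 0 = u1" "nmem s' vV1 0 = v1"
       "nmem s' vU2 0 = u2" "nmem s' vV2 0 = v2"
       "nmem s' aPM = nmem s aPM" "rmem s' rX = rmem s rX" "rmem s' rY = rmem s rY"
      using i(2) vs by (auto simp: frame_def s0_def vars_def)
    have Pi: "?P i \<longleftrightarrow> bval (BAnd (BAnd (NLe (NV vU) (NV vP)) (NLess (NV vP) eV)) (BAnd (BNot bGap1) (BNot bGap2))) s'"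
      using fr i(3) by (auto simp: in_group_def)
    have Xi: "rmem s rX (nmem s aPM i) = fst (X i)" "rmem s rY (nmem s aPM i) = snd (X i)" if "?P i"
      using that c v by (auto simp: context_ok_def in_group_def)
    have LS: "L' (Suc i) = (if ?P i then L' i @ [i] else L' i)" by (simp add: L'_def)
    show "runs collect_body 5 (\<lambda>s''. J (Suc i) (nupd vP 0 (Suc i) s'')) s'"
    proof (rule runs_straight)
      show "J (Suc i) (nupd vP 0 (Suc i) (result collect_body s'))"
        using i(3,4) Xi fr unfolding collect_body_def J_def LS
        by (simp only: result.simps Pi[symmetric] split: if_split)
          (auto simp: nth_append less_Suc_eq)
    qed (simp_all add: collect_body_def)
  qed simp
  then have loop: "runs (For vP eM collect_body) (14 * real n + 9) (J (2 * n + 1)) s0"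
    by (rule runs_mono) (auto simp: algebra_simps)
  have "runs collect (14 * real n + 11) (J (2 * n + 1)) s"
    unfolding collect_def
  proof (rule runs_SeqI[where Bc = 1 and R = "\<lambda>s'. s' = s0"])
    show "runs (NSet vCN (NConst 0)) 1 (\<lambda>s'. s' = s0) s"
      by (rule runs_straight) (auto simp: s0_def)
  qed (use loop in auto)
  then show ?thesis
    by (rule runs_mono) (auto simp: J_def L'_def L)
qed

text \<open>The contract of \<open>W\<close> covers all lists of at most \<open>n\<close> sources
  within time \<open>T n \<epsilon>\<close>, so the same bound serves groups of every size.\<close>

lemma runs_call_weber:
  assumes "\<epsilon> > 0" and c: "rmem s rE 0 = \<epsilon>" "rmem s rE 1 = fst t" "rmem s rE 2 = snd t"
    and A: "nmem s vCN 0 = length A" "\<And>i. i < length A \<Longrightarrow> rmem s 1 i = fst (A ! i) \<and> rmem s 2 i = snd (A ! i)"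
    and n: "length A \<le> n"
  shows "runs call_weber (T n \<epsilon> + 4) (\<lambda>s'. star_cost t A (rmem s' 3 1, rmem s' 3 2) \<le> rmem s' 3 0 \<and>
     rmem s' 3 0 \<le> (1 + \<epsilon>) * weber_cost t A) s"
  unfolding call_weber_def
proof (rule runs_SeqI[where Bc = 4 and R = "holds_input \<epsilon> t A"])
  show "runs (Seq (NSet 0 (NV vCN)) (Seq (RAssign 0 (NConst 0) (RCell rE (NConst 0)))
     (Seq (RAssign 0 (NConst 1) (RCell rE (NConst 1))) (RAssign 0 (NConst 2) (RCell rE (NConst 2)))))) 4
     (holds_input \<epsilon> t A) s"
    by (rule runs_straight) (use c A in \<open>auto simp: holds_input_def\<close>)
  fix s' assume "holds_input \<epsilon> t A s'"
  then show "runs W (T n \<epsilon>) (\<lambda>s'. star_cost t A (rmem s' 3 1, rmem s' 3 2) \<le> rmem s' 3 0 \<and>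
     rmem s' 3 0 \<le> (1 + \<epsilon>) * weber_cost t A) s'"
    using W n \<open>\<epsilon> > 0\<close> unfolding weber_program_def runs_def Let_def by blast
qed simp

end

section \<open>Computing and storing one candidate\<close>

definition same_entry :: "nat \<Rightarrow> table \<Rightarrow> table \<Rightarrow> nat \<Rightarrow> nat \<Rightarrow> bool" where
  "same_entry n x y u v \<longleftrightarrow> has y (ix2 n u v) = has x (ix2 n u v) \<and> val y (ix2 n u v) = val x (ix2 n u v) \<and>
     (\<forall>p<2 * n + 1. lab y (ix3 n u v p) = lab x (ix3 n u v p) \<and>
        sx y (ix3 n u v p) = sx x (ix3 n u v p) \<and> sy y (ix3 n u v p) = sy x (ix3 n u v p))"

lemma sol_ok_cong:
  assumes "\<And>p. u \<le> p \<Longrightarrow> p < v \<Longrightarrow> l p = l' p \<and> \<sigma> p = \<sigma>' p" "z = z'"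
  shows "sol_ok X t u v l \<sigma> z \<longleftrightarrow> sol_ok X t u v l' \<sigma>' z'"
proof -
  have imp: "sol_ok X t u v l' \<sigma>' z" if eq: "\<And>p. u \<le> p \<Longrightarrow> p < v \<Longrightarrow> l p = l' p \<and> \<sigma> p = \<sigma>' p"
    and ok: "sol_ok X t u v l \<sigma> z" for l l' \<sigma> \<sigma>'
  proof -
    have "(\<Sum>p\<in>{u..<v}. dist (X p) (\<sigma>' p)) = (\<Sum>p\<in>{u..<v}. dist (X p) (\<sigma> p))"
      "(\<Sum>p\<in>{p\<in>{u..<v}. l' p = p}. dist (\<sigma>' p) t) = (\<Sum>p\<in>{p\<in>{u..<v}. l p = p}. dist (\<sigma> p) t)"
      using eq by (auto intro!: sum.cong)
    moreover have "u \<le> l' p \<and> l' p < v \<and> l' (l' p) = l' p \<and> \<sigma>' (l' p) = \<sigma>' p" if "u \<le> p" "p < v" for p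
      using ok eq[OF that] eq[of "l p"] that unfolding sol_ok_def by metis
    ultimately show ?thesis using ok unfolding sol_ok_def by simp
  qed
  show ?thesis using imp[of l l' \<sigma> \<sigma>'] imp[of l' l \<sigma>' \<sigma>] assms by metis
qed

lemma same_entry_sound:
  assumes "same_entry n x y u v" "v \<le> 2 * n + 1"
  shows "sound n X t y u v \<longleftrightarrow> sound n X t x u v"
  unfolding sound_def by (rule sol_ok_cong) (use assms in \<open>auto simp: same_entry_def\<close>)

context weber_machine
begin

text \<open>The gaps are strictly shorter than the interval, so their entries differ from the one
  being written and are still intact when they are copied. The loop runs over all positions; those
  outside the interval receive values that \<open>sol_ok\<close> does not look at.\<close>

lemma runs_store:
  assumes N: "nmem s vN 0 = n" and vs: "vars u v u1 v1 u2 v2 s" and v: "v \<le> 2 * n" and g: "gaps u v u1 v1 u2 v2"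
  shows "runs store (14 * real n + 11) (\<lambda>s'.
     has (tab s') = (has (tab s))(ix2 n u v := 1) \<and> val (tab s') = (val (tab s))(ix2 n u v := rmem s rC 0) \<and>
     (\<forall>p<2 * n + 1.
       lab (tab s') (ix3 n u v p) = (if u1 \<le> p \<and> p < v1 then lab (tab s) (ix3 n u1 v1 p)
         else if u2 \<le> p \<and> p < v2 then lab (tab s) (ix3 n u2 v2 p) else nmem s vLD 0) \<and>
       sx (tab s') (ix3 n u v p) = (if u1 \<le> p \<and> p < v1 then sx (tab s) (ix3 n u1 v1 p)
         else if u2 \<le> p \<and> p < v2 then sx (tab s) (ix3 n u2 v2 p) else rmem s 3 1) \<and>
       sy (tab s') (ix3 n u v p) = (if u1 \<le> p \<and> p < v1 then sy (tab s) (ix3 n u1 v1 p)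
         else if u2 \<le> p \<and> p < v2 then sy (tab s) (ix3 n u2 v2 p) else rmem s 3 2)) \<and>
     (\<forall>k. (\<forall>p<2 * n + 1. k \<noteq> ix3 n u v p) \<longrightarrow>
       lab (tab s') k = lab (tab s) k \<and> sx (tab s') k = sx (tab s) k \<and> sy (tab s') k = sy (tab s) k)) s"
    (is "runs store _ ?Q s")
proof -
  define s0 where "s0 = rupd rF (ix2 n u v) (rmem s rC 0) (nupd aHS (ix2 n u v) 1 s)"
  define J where "J i s' \<longleftrightarrow> nmem s' aHS = nmem s0 aHS \<and> rmem s' rF = rmem s0 rF \<and>
     (\<forall>p<i.
       nmem s' aLB (ix3 n u v p) = (if u1 \<le> p \<and> p < v1 then nmem s aLB (ix3 n u1 v1 p)
         else if u2 \<le> p \<and> p < v2 then nmem s aLB (ix3 n u2 v2 p) else nmem s vLD 0) \<and>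
       rmem s' rS (ix3 n u v p) = (if u1 \<le> p \<and> p < v1 then rmem s rS (ix3 n u1 v1 p)
         else if u2 \<le> p \<and> p < v2 then rmem s rS (ix3 n u2 v2 p) else rmem s 3 1) \<and>
       rmem s' rT (ix3 n u v p) = (if u1 \<le> p \<and> p < v1 then rmem s rT (ix3 n u1 v1 p)
         else if u2 \<le> p \<and> p < v2 then rmem s rT (ix3 n u2 v2 p) else rmem s 3 2)) \<and>
     (\<forall>k. (\<forall>p<i. k \<noteq> ix3 n u v p) \<longrightarrow>
       nmem s' aLB k = nmem s aLB k \<and> rmem s' rS k = rmem s rS k \<and> rmem s' rT k = rmem s rT k)"
    for i and s' :: state
  have le: "u \<le> u1" "u1 \<le> v1" "v1 \<le> u2" "u2 \<le> v2" "v2 \<le> v" using g by (auto simp: gaps_def)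
  have pairs: "\<not> (u1 = u \<and> v1 = v)" "\<not> (u2 = u \<and> v2 = v)" using g by (auto simp: gaps_def)
  have "runs (For vP eM store_body) (real (2 * n + 1) * (5 + 2) + 2) (J (2 * n + 1)) s0"
  proof (rule runs_For)
    fix s' assume "frame (For vP eM store_body) s0 s'"
    then show "nval eM s' = 2 * n + 1" using N by (auto simp: frame_def s0_def)
  next
    show "J 0 (nupd vP 0 0 s0)" by (simp add: J_def s0_def)
  next
    fix i s'
    assume i: "i < 2 * n + 1" "frame (For vP eM store_body) s0 s'" "nmem s' vP 0 = i" "J i s'"
    have fr: "nmem s' vU 0 = u" "u + nmem s' vD 0 + 1 = v" "nmem s' vU1 0 = u1" "nmem s' vV1 0 = v1"
       "nmem s' vU2 0 = u2" "nmem s' vV2 0 = v2" "nmem s' vN 0 = n" "nmem s' vLD 0 = nmem s vLD 0" "rmem s' 3 = rmem s 3"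
      using i(2) vs N by (auto simp: frame_def s0_def vars_def)
    have old: "nmem s' aLB (ix3 n x y i) = nmem s aLB (ix3 n x y i)" "rmem s' rS (ix3 n x y i) = rmem s rS (ix3 n x y i)"
      "rmem s' rT (ix3 n x y i) = rmem s rT (ix3 n x y i)"
      if "y \<le> 2 * n" "\<not> (x = u \<and> y = v)" for x y
    proof -
      have "ix3 n x y i \<noteq> ix3 n u v p" if "p < i" for p
        using ix3_inj[of y n v i p x u] \<open>y \<le> 2 * n\<close> \<open>\<not> (x = u \<and> y = v)\<close> v i(1) that by auto
      then show "nmem s' aLB (ix3 n x y i) = nmem s aLB (ix3 n x y i)" "rmem s' rS (ix3 n x y i) = rmem s rS (ix3 n x y i)"
        "rmem s' rT (ix3 n x y i) = rmem s rT (ix3 n x y i)" using i(4) by (auto simp: J_def)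
    qed
    have old1: "nmem s' aLB (ix3 n u1 v1 i) = nmem s aLB (ix3 n u1 v1 i)" "rmem s' rS (ix3 n u1 v1 i) = rmem s rS (ix3 n u1 v1 i)"
      "rmem s' rT (ix3 n u1 v1 i) = rmem s rT (ix3 n u1 v1 i)"
      and old2: "nmem s' aLB (ix3 n u2 v2 i) = nmem s aLB (ix3 n u2 v2 i)" "rmem s' rS (ix3 n u2 v2 i) = rmem s rS (ix3 n u2 v2 i)"
      "rmem s' rT (ix3 n u2 v2 i) = rmem s rT (ix3 n u2 v2 i)"
      using old pairs le v by auto
    define y z1 z2 where "y = (if u1 \<le> i \<and> i < v1 then nmem s aLB (ix3 n u1 v1 i)
         else if u2 \<le> i \<and> i < v2 then nmem s aLB (ix3 n u2 v2 i) else nmem s vLD 0)"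
      and "z1 = (if u1 \<le> i \<and> i < v1 then rmem s rS (ix3 n u1 v1 i)
         else if u2 \<le> i \<and> i < v2 then rmem s rS (ix3 n u2 v2 i) else rmem s 3 1)"
      and "z2 = (if u1 \<le> i \<and> i < v1 then rmem s rT (ix3 n u1 v1 i)
         else if u2 \<le> i \<and> i < v2 then rmem s rT (ix3 n u2 v2 i) else rmem s 3 2)"
    have res: "result store_body s' = rupd rT (ix3 n u v i) z2 (rupd rS (ix3 n u v i) z1 (nupd aLB (ix3 n u v i) y s'))"
      unfolding store_body_def copy_position_def write_position_def result.simps y_def z1_def z2_def
      using fr i(3) old1 old2 by (auto simp: ix3_def ix2_def)
    have fresh: "ix3 n u v p \<noteq> ix3 n u v i" if "p < i" for p
      using ix3_inj[of v n v p i u u] v i(1) that by auto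
    show "runs store_body 5 (\<lambda>s''. J (Suc i) (nupd vP 0 (Suc i) s'')) s'"
    proof (rule runs_straight)
      show "J (Suc i) (nupd vP 0 (Suc i) (result store_body s'))"
        unfolding res J_def using i(4) fresh unfolding J_def
        by (auto simp: less_Suc_eq y_def z1_def z2_def)
    qed (simp_all add: store_body_def copy_position_def write_position_def)
  qed simp
  then have loop: "runs (For vP eM store_body) (14 * real n + 9) (J (2 * n + 1)) s0"
    by (rule runs_mono) (auto simp: algebra_simps)
  have "runs store (14 * real n + 11) (J (2 * n + 1)) s"
    unfolding store_def
  proof (rule runs_SeqI[where Bc = 2 and R = "\<lambda>s'. s' = s0"])
    show "runs (Seq (NAssign aHS (eIx2 (NV vU) eV) (NConst 1)) (RAssign rF (eIx2 (NV vU) eV) (RCell rC (NConst 0)))) 2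
       (\<lambda>s'. s' = s0) s"
      by (rule runs_straight) (use vs N in \<open>auto simp: s0_def vars_def ix2_def\<close>)
  qed (use loop in auto)
  then show ?thesis
    by (rule runs_mono) (auto simp: J_def tab_def s0_def)
qed

lemma runs_candidate:
  assumes \<epsilon>: "\<epsilon> > 0" and c: "context_ok n \<epsilon> t X s" and vs: "vars u v u1 v1 u2 v2 s"
    and v: "v \<le> 2 * n" "v \<le> u + n" and g: "gaps u v u1 v1 u2 v2"
    and s1: "sound n X t (tab s) u1 v1" and s2: "sound n X t (tab s) u2 v2"
    and s0: "has (tab s) (ix2 n u v) \<noteq> 0 \<Longrightarrow> sound n X t (tab s) u v"
    and L: "L = filter (in_group u v u1 v1 u2 v2) [0..<Suc (2 * n)]"
  shows "runs candidate (28 * real n + T n \<epsilon> + 40) (\<lambda>s'.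
     (\<forall>u' v'. v' \<le> 2 * n \<longrightarrow> (u', v') \<noteq> (u, v) \<longrightarrow> same_entry n (tab s) (tab s') u' v') \<and>
     has (tab s') (ix2 n u v) \<noteq> 0 \<and> sound n X t (tab s') u v \<and>
     val (tab s') (ix2 n u v) \<le> val (tab s) (ix2 n u1 v1) + val (tab s) (ix2 n u2 v2) + (1 + \<epsilon>) * weber_cost t (map X L) \<and>
     (has (tab s) (ix2 n u v) \<noteq> 0 \<longrightarrow> val (tab s') (ix2 n u v) \<le> val (tab s) (ix2 n u v))) s"
    (is "runs candidate _ ?Q s")
  unfolding candidate_def
proof (rule runs_SeqI[OF runs_collect[OF c vs v(1) L]])
  fix sa
  assume fa: "frame collect s sa" and a: "nmem sa vCN 0 = length L \<and>
     (\<forall>i<length L. rmem sa 1 i = fst (X (L ! i)) \<and> rmem sa 2 i = snd (X (L ! i))) \<and>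
     (L \<noteq> [] \<longrightarrow> nmem sa vLD 0 \<in> set L)"
  \<comment> \<open>Although there are \<open>2 * n\<close> positions, the intervals considered have
    at most \<open>n\<close>, so every group obeys the size bound of the call.\<close>
  have "length L \<le> n"
  proof -
    have "set L \<subseteq> {u..<v}" by (auto simp: L in_group_def)
    moreover have "distinct L" by (simp add: L)
    ultimately have "length L \<le> card {u..<v}" using distinct_card card_mono[of "{u..<v}" "set L"] by fastforce
    then show ?thesis using v by simp
  qed
  let ?w = "weber_cost t (map X L)"
  have e: "rmem sa rE 0 = \<epsilon>" "rmem sa rE 1 = fst t" "rmem sa rE 2 = snd t"
    using fa c by (auto simp: frame_def context_ok_def)
  have call: "runs call_weber (T n \<epsilon> + 4) (\<lambda>s'. star_cost t (map X L) (rmem s' 3 1, rmem s' 3 2) \<le> rmem s' 3 0 \<and>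
     rmem s' 3 0 \<le> (1 + \<epsilon>) * ?w) sa"
    by (rule runs_call_weber[OF \<epsilon> e]) (use a \<open>length L \<le> n\<close> in auto)
  show "runs (Seq call_weber (Seq candidate_value
     (If bKeep SKIP store)))
     (14 * real n + T n \<epsilon> + 29) ?Q sa"
  proof (rule runs_SeqI[OF call])
    fix sb
    assume fb: "frame call_weber sa sb" and b: "star_cost t (map X L) (rmem sb 3 1, rmem sb 3 2) \<le> rmem sb 3 0 \<and>
     rmem sb 3 0 \<le> (1 + \<epsilon>) * ?w"
    have tb: "tab sb = tab s" using fa fb by (auto simp: tab_def frame_def)
    have Nb: "nmem sb vN 0 = n" using fa fb c by (auto simp: frame_def context_ok_def)
    have vb: "vars u v u1 v1 u2 v2 sb" using fa fb vs by (auto simp: frame_def vars_def)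
    have ld: "nmem sb vLD 0 = nmem sa vLD 0" using fb by (auto simp: frame_def)
    define z where "z = rmem sb 3 0 + (val (tab s) (ix2 n u1 v1) + val (tab s) (ix2 n u2 v2))"
    define sc where "sc = rupd rC 0 z sb"
    have val: "runs candidate_value 1 (\<lambda>s'. s' = sc) sb"
      unfolding candidate_value_def
      by (rule runs_straight) (use vb Nb tb[symmetric] in \<open>auto simp: sc_def z_def vars_def tab_def ix2_def\<close>)
    have zle: "z \<le> val (tab s) (ix2 n u1 v1) + val (tab s) (ix2 n u2 v2) + (1 + \<epsilon>) * ?w"
      using b by (simp add: z_def)
    have tc: "tab sc = tab s" using tb by (auto simp: sc_def tab_def)
    have vc: "vars u v u1 v1 u2 v2 sc" "nmem sc vN 0 = n" using vb Nb by (auto simp: sc_def vars_def)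
    have st: "runs store (14 * real n + 11) ?Q sc" if zv: "has (tab s) (ix2 n u v) \<noteq> 0 \<longrightarrow> z \<le> val (tab s) (ix2 n u v)"
    proof (rule runs_mono[OF runs_store[OF vc(2,1) v(1) g] order_refl], elim conjE, intro conjI allI impI)
      fix s'
      assume h: "has (tab s') = (has (tab sc))(ix2 n u v := 1)"
        and vl: "val (tab s') = (val (tab sc))(ix2 n u v := rmem sc rC 0)"
        and w: "\<forall>p<2 * n + 1.
          lab (tab s') (ix3 n u v p) = (if u1 \<le> p \<and> p < v1 then lab (tab sc) (ix3 n u1 v1 p)
           else if u2 \<le> p \<and> p < v2 then lab (tab sc) (ix3 n u2 v2 p) else nmem sc vLD 0) \<and>
          sx (tab s') (ix3 n u v p) = (if u1 \<le> p \<and> p < v1 then sx (tab sc) (ix3 n u1 v1 p)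
           else if u2 \<le> p \<and> p < v2 then sx (tab sc) (ix3 n u2 v2 p) else rmem sc 3 1) \<and>
          sy (tab s') (ix3 n u v p) = (if u1 \<le> p \<and> p < v1 then sy (tab sc) (ix3 n u1 v1 p)
           else if u2 \<le> p \<and> p < v2 then sy (tab sc) (ix3 n u2 v2 p) else rmem sc 3 2)"
        and o: "\<forall>k. (\<forall>p<2 * n + 1. k \<noteq> ix3 n u v p) \<longrightarrow>
          lab (tab s') k = lab (tab sc) k \<and> sx (tab s') k = sx (tab sc) k \<and> sy (tab s') k = sy (tab sc) k"
      have zc: "rmem sc rC 0 = z" "rmem sc 3 = rmem sb 3" "nmem sc vLD 0 = nmem sa vLD 0" using ld by (auto simp: sc_def)
      show "has (tab s') (ix2 n u v) \<noteq> 0" using h by simp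
      have vz: "val (tab s') (ix2 n u v) = z" using vl zc by simp
      then show "val (tab s') (ix2 n u v) \<le> val (tab s) (ix2 n u1 v1) + val (tab s) (ix2 n u2 v2) + (1 + \<epsilon>) * ?w"
        using zle by simp
      show "sound n X t (tab s') u v"
        unfolding sound_def vz z_def
        by (rule sol_ok_combine[OF g s1[unfolded sound_def] s2[unfolded sound_def] _ L conjunct1[OF b],
              where m = "nmem sa vLD 0"])
          (use v w a zc tc in auto)
      show "val (tab s') (ix2 n u v) \<le> val (tab s) (ix2 n u v)" if "has (tab s) (ix2 n u v) \<noteq> 0"
        using zv vz that by simp
      fix u' v'
      assume v': "v' \<le> 2 * n" "(u', v') \<noteq> (u, v)"
      have "ix2 n u' v' \<noteq> ix2 n u v" using ix2_inj[of v' n v u' u] v v' by auto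
      moreover have "ix3 n u' v' p \<noteq> ix3 n u v q" if "p < 2 * n + 1" "q < 2 * n + 1" for p q
        using ix3_inj[of v' n v p q u' u] v v' that by auto
      ultimately show "same_entry n (tab s) (tab s') u' v'"
        unfolding same_entry_def using h vl o tc by auto
    qed
    show "runs (Seq candidate_value
     (If bKeep SKIP store))
     (14 * real n + 25) ?Q sb"
    proof (rule runs_SeqI[OF val])
      fix s' assume "s' = sc"
      have ev: "bval bKeep sc \<longleftrightarrow>
         has (tab s) (ix2 n u v) \<noteq> 0 \<and> val (tab s) (ix2 n u v) \<le> z"
        using vc tc[symmetric] by (auto simp: vars_def tab_def ix2_def sc_def)
      have "runs (If bKeep SKIP store) ((14 * real n + 11) + 1) ?Q sc"
      proof (rule runs_If)
        assume "bval bKeep sc"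
        then have hv: "has (tab s) (ix2 n u v) \<noteq> 0" "val (tab s) (ix2 n u v) \<le> z" using ev by blast+
        have "?Q sc" using hv s0 zle tc by (auto simp: same_entry_def)
        then show "runs SKIP (14 * real n + 11) ?Q sc" by (intro runs_straight) auto
      next
        assume "\<not> bval bKeep sc"
        then have "has (tab s) (ix2 n u v) \<noteq> 0 \<longrightarrow> z \<le> val (tab s) (ix2 n u v)" unfolding ev by linarith
        then show "runs store (14 * real n + 11) ?Q sc" by (rule st)
      qed
      then show "runs (If bKeep SKIP store) (14 * real n + 24) ?Q s'"
        unfolding \<open>s' = sc\<close> by (rule runs_mono) simp_all
    qed simp
  qed simp
qed simp

end

section \<open>Invariants of the table across the phases\<close>

definition table_ok :: "nat \<Rightarrow> (nat \<Rightarrow> point) \<Rightarrow> point \<Rightarrow> nat \<Rightarrow> table \<Rightarrow> bool" where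
  "table_ok n X t d x \<longleftrightarrow> (\<forall>u v. u \<le> v \<longrightarrow> v \<le> 2 * n \<longrightarrow>
     (has x (ix2 n u v) \<noteq> 0 \<longrightarrow> sound n X t x u v) \<and> (v - u \<le> d \<longrightarrow> has x (ix2 n u v) \<noteq> 0))"

text \<open>How a table may evolve during phase \<open>d\<close>: values of intervals of length
  \<open>d + 1\<close> only decrease, and those of all other lengths are frozen.\<close>

definition improves :: "nat \<Rightarrow> nat \<Rightarrow> table \<Rightarrow> table \<Rightarrow> bool" where
  "improves n d x y \<longleftrightarrow> (\<forall>u v. u \<le> v \<longrightarrow> v \<le> 2 * n \<longrightarrow>
     (if v = u + d + 1 then has x (ix2 n u v) \<noteq> 0 \<longrightarrow> has y (ix2 n u v) \<noteq> 0 \<and> val y (ix2 n u v) \<le> val x (ix2 n u v)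
      else has y (ix2 n u v) = has x (ix2 n u v) \<and> val y (ix2 n u v) = val x (ix2 n u v)))"

definition bounded_by :: "nat \<Rightarrow> real \<Rightarrow> point \<Rightarrow> (nat \<Rightarrow> point) \<Rightarrow> nat \<Rightarrow> nat \<Rightarrow> nat \<Rightarrow> nat \<Rightarrow> nat \<Rightarrow> nat \<Rightarrow> table \<Rightarrow> bool" where
  "bounded_by n \<epsilon> t X d u u1 v1 u2 v2 x \<longleftrightarrow> u + d + 1 \<le> 2 * n \<longrightarrow> gaps u (u + d + 1) u1 v1 u2 v2 \<longrightarrow>
     has x (ix2 n u (u + d + 1)) \<noteq> 0 \<and>
     val x (ix2 n u (u + d + 1)) \<le> val x (ix2 n u1 v1) + val x (ix2 n u2 v2) +
       (1 + \<epsilon>) * weber_cost t (map X (filter (in_group u (u + d + 1) u1 v1 u2 v2) [0..<Suc (2 * n)]))"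

lemma improves_refl: "improves n d x x"
  by (simp add: improves_def)

lemma improves_trans: "improves n d x y \<Longrightarrow> improves n d y z \<Longrightarrow> improves n d x z"
  unfolding improves_def by (smt (verit))

text \<open>Both gaps have length at most \<open>d'\<close>, so the values on the right-hand side
  are frozen in phase \<open>d\<close>, while the value on the left can only drop.\<close>

lemma bounded_by_stable:
  assumes b: "bounded_by n \<epsilon> t X d' u u1 v1 u2 v2 x" and i: "improves n d x y" and "d' \<le> d"
  shows "bounded_by n \<epsilon> t X d' u u1 v1 u2 v2 y"
  unfolding bounded_by_def
proof (intro impI)
  assume v: "u + d' + 1 \<le> 2 * n" and g: "gaps u (u + d' + 1) u1 v1 u2 v2"
  have le: "u \<le> u1" "u1 \<le> v1" "v1 \<le> u2" "u2 \<le> v2" "v2 \<le> u + d' + 1" "v1 \<noteq> u1 + d + 1" "v2 \<noteq> u2 + d + 1"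
    using g \<open>d' \<le> d\<close> by (auto simp: gaps_def)
  have same: "val y (ix2 n u1 v1) = val x (ix2 n u1 v1)" "val y (ix2 n u2 v2) = val x (ix2 n u2 v2)"
    using i le v unfolding improves_def by (meson order_trans)+
  have "has x (ix2 n u (u + d' + 1)) \<noteq> 0 \<longrightarrow>
      has y (ix2 n u (u + d' + 1)) \<noteq> 0 \<and> val y (ix2 n u (u + d' + 1)) \<le> val x (ix2 n u (u + d' + 1))"
    using i[unfolded improves_def, rule_format, of u "u + d' + 1"] v by (auto split: if_splits)
  then show "has y (ix2 n u (u + d' + 1)) \<noteq> 0 \<and>
     val y (ix2 n u (u + d' + 1)) \<le> val y (ix2 n u1 v1) + val y (ix2 n u2 v2) +
       (1 + \<epsilon>) * weber_cost t (map X (filter (in_group u (u + d' + 1) u1 v1 u2 v2) [0..<Suc (2 * n)]))"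
    using b v g unfolding bounded_by_def same by linarith
qed

context weber_machine
begin

abbreviation "loop5 \<equiv> If bValid candidate SKIP"
abbreviation "loop4 \<equiv> For vV2 eM loop5"
abbreviation "loop3 \<equiv> For vU2 eM loop4"
abbreviation "loop2 \<equiv> For vV1 eM loop3"
abbreviation "loop1 \<equiv> For vU1 eM loop2"
abbreviation "loop0 \<equiv> For vU eM loop1"

lemma nmods_candidate' [simp]:
  "nmods candidate = {vCN, vLD, vP, aHS, aLB, 0} \<union> nmods W"
  "rmods candidate = {0, 1, 2, rC, rF, rS, rT} \<union> rmods W"
  by (auto simp: candidate_def)

lemma tab_nupd [simp]: "a \<noteq> aHS \<Longrightarrow> a \<noteq> aLB \<Longrightarrow> tab (nupd a i x s) = tab s"
  by (simp add: tab_def)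

definition loop_time :: "nat \<Rightarrow> real \<Rightarrow> real" where
  "loop_time n B = real (2 * n + 1) * (B + 2) + 2"

lemma runs_loop5:
  assumes \<epsilon>: "\<epsilon> > 0" and c: "context_ok n \<epsilon> t X s" and d: "d < n" "nmem s vD 0 = d"
    and ok: "table_ok n X t d (tab s)"
    and vs: "nmem s vU 0 = u" "nmem s vU1 0 = u1" "nmem s vV1 0 = v1" "nmem s vU2 0 = u2" "nmem s vV2 0 = v2"
  shows "runs loop5 (28 * real n + T n \<epsilon> + 41) (\<lambda>s'. table_ok n X t d (tab s') \<and> improves n d (tab s) (tab s') \<and>
     bounded_by n \<epsilon> t X d u u1 v1 u2 v2 (tab s')) s"
    (is "runs _ _ ?Q s")
proof -
  let ?v = "u + d + 1"
  have ev: "bval bValid s \<longleftrightarrow> gaps u ?v u1 v1 u2 v2 \<and> ?v \<le> 2 * n"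
    using vs d c by (auto simp: bValid_def gaps_def context_ok_def)
  have T: "1 \<le> T n \<epsilon>" using weber_program_linear_time[OF W \<epsilon>] by blast
  have "runs loop5 ((28 * real n + T n \<epsilon> + 40) + 1) ?Q s"
  proof (rule runs_If)
    assume "bval bValid s"
    then have g: "gaps u ?v u1 v1 u2 v2" and v: "?v \<le> 2 * n" using ev by auto
    have le: "u \<le> u1" "u1 \<le> v1" "v1 \<le> u2" "u2 \<le> v2" "v2 \<le> ?v" "v1 - u1 \<le> d" "v2 - u2 \<le> d"
      using g by (auto simp: gaps_def)
    have vs': "vars u ?v u1 v1 u2 v2 s" using vs d by (simp add: vars_def)
    have s1: "sound n X t (tab s) u1 v1" and s2: "sound n X t (tab s) u2 v2"
      using ok le v by (auto simp: table_ok_def)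
    have s0: "sound n X t (tab s) u ?v" if "has (tab s) (ix2 n u ?v) \<noteq> 0"
      using ok v that by (auto simp: table_ok_def)
    have dn: "?v \<le> u + n" using d by simp
    show "runs candidate (28 * real n + T n \<epsilon> + 40) ?Q s"
    proof (rule runs_mono[OF runs_candidate[OF \<epsilon> c vs' v dn g s1 s2 s0 refl] order_refl], assumption, elim conjE)
      fix s'
      assume same: "\<forall>u' v'. v' \<le> 2 * n \<longrightarrow> (u', v') \<noteq> (u, ?v) \<longrightarrow> same_entry n (tab s) (tab s') u' v'"
        and h: "has (tab s') (ix2 n u ?v) \<noteq> 0" and sd: "sound n X t (tab s') u ?v"
        and b: "val (tab s') (ix2 n u ?v) \<le> val (tab s) (ix2 n u1 v1) + val (tab s) (ix2 n u2 v2) +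
          (1 + \<epsilon>) * weber_cost t (map X (filter (in_group u ?v u1 v1 u2 v2) [0..<Suc (2 * n)]))"
        and le': "has (tab s) (ix2 n u ?v) \<noteq> 0 \<longrightarrow> val (tab s') (ix2 n u ?v) \<le> val (tab s) (ix2 n u ?v)"
      have "table_ok n X t d (tab s')"
        unfolding table_ok_def
      proof (intro allI impI)
        fix u' v' assume v': "u' \<le> v'" "v' \<le> 2 * n"
        show "(has (tab s') (ix2 n u' v') \<noteq> 0 \<longrightarrow> sound n X t (tab s') u' v') \<and>
           (v' - u' \<le> d \<longrightarrow> has (tab s') (ix2 n u' v') \<noteq> 0)"
        proof (cases "(u', v') = (u, ?v)")
          case True
          then show ?thesis using h sd by auto
        next
          case False
          have se: "same_entry n (tab s) (tab s') u' v'" by (rule same[rule_format, OF v'(2) False])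
          have "sound n X t (tab s') u' v' \<longleftrightarrow> sound n X t (tab s) u' v'"
            by (rule same_entry_sound[OF se]) (use v' in simp)
          moreover have "has (tab s') (ix2 n u' v') = has (tab s) (ix2 n u' v')" using se by (simp add: same_entry_def)
          moreover have "(has (tab s) (ix2 n u' v') \<noteq> 0 \<longrightarrow> sound n X t (tab s) u' v') \<and>
             (v' - u' \<le> d \<longrightarrow> has (tab s) (ix2 n u' v') \<noteq> 0)"
            using ok v' unfolding table_ok_def by blast
          ultimately show ?thesis by simp
        qed
      qed
      moreover have "improves n d (tab s) (tab s')"
        unfolding improves_def
      proof (intro allI impI)
        fix u' v' assume v': "u' \<le> v'" "v' \<le> 2 * n"
        show "if v' = u' + d + 1 then has (tab s) (ix2 n u' v') \<noteq> 0 \<longrightarrow>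
            has (tab s') (ix2 n u' v') \<noteq> 0 \<and> val (tab s') (ix2 n u' v') \<le> val (tab s) (ix2 n u' v')
          else has (tab s') (ix2 n u' v') = has (tab s) (ix2 n u' v') \<and> val (tab s') (ix2 n u' v') = val (tab s) (ix2 n u' v')"
        proof (cases "(u', v') = (u, ?v)")
          case True
          then show ?thesis using h le' by auto
        next
          case False
          have "same_entry n (tab s) (tab s') u' v'" by (rule same[rule_format, OF v'(2) False])
          then show ?thesis by (auto simp: same_entry_def)
        qed
      qed
      moreover have "bounded_by n \<epsilon> t X d u u1 v1 u2 v2 (tab s')"
      proof -
        have "same_entry n (tab s) (tab s') u1 v1" "same_entry n (tab s) (tab s') u2 v2"
          by (rule same[rule_format]; use le v in auto)+
        then have "val (tab s') (ix2 n u1 v1) = val (tab s) (ix2 n u1 v1)" "val (tab s') (ix2 n u2 v2) = val (tab s) (ix2 n u2 v2)"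
          by (simp_all add: same_entry_def)
        then show ?thesis using h b by (simp add: bounded_by_def)
      qed
      ultimately show "?Q s'" by blast
    qed
  next
    assume "\<not> bval bValid s"
    then have "?Q s" using ev ok improves_refl by (auto simp: bounded_by_def)
    then show "runs SKIP (28 * real n + T n \<epsilon> + 40) ?Q s"
      using T by (intro runs_straight) auto
  qed
  then show ?thesis by (rule runs_mono) auto
qed

lemma context_frame:
  assumes "context_ok n \<epsilon> t X s" "frame c s s'" "vN \<notin> nmods c" "aPM \<notin> nmods c"
    "rE \<notin> rmods c" "rX \<notin> rmods c" "rY \<notin> rmods c"
  shows "context_ok n \<epsilon> t X s'"
  using assms by (simp add: context_ok_def frame_def)

text \<open>One rule for all five nested loops: \<open>P i\<close> is what the inner loops achieve
  for the value \<open>i\<close> of the counter, and it survives later improvements of the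
  table.\<close>

lemma runs_search_loop:
  assumes c: "context_ok n \<epsilon> t X s" and a: "a \<notin> nmods body" "a \<noteq> vN" "a \<noteq> aPM" "a \<noteq> aHS" "a \<noteq> aLB"
    and mods: "vN \<notin> nmods body" "aPM \<notin> nmods body" "rE \<notin> rmods body" "rX \<notin> rmods body" "rY \<notin> rmods body"
    and ok: "table_ok n X t d (tab s)"
    and P: "\<And>i x y. P i x \<Longrightarrow> improves n d x y \<Longrightarrow> P i y"
    and step: "\<And>i s'. frame (For a eM body) s s' \<Longrightarrow> context_ok n \<epsilon> t X s' \<Longrightarrow> nmem s' a 0 = i \<Longrightarrow> table_ok n X t d (tab s') \<Longrightarrow>
      runs body B (\<lambda>s''. table_ok n X t d (tab s'') \<and> improves n d (tab s') (tab s'') \<and> P i (tab s'')) s'"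
  shows "runs (For a eM body) (loop_time n B) (\<lambda>s'. table_ok n X t d (tab s') \<and> improves n d (tab s) (tab s') \<and>
     (\<forall>i<2 * n + 1. P i (tab s'))) s"
  unfolding loop_time_def
proof (rule runs_For_all[where R = "improves n d"])
  fix s' assume "frame (For a eM body) s s'"
  then have "context_ok n \<epsilon> t X s'" using context_frame[OF c] a mods by auto
  then show "nval eM s' = 2 * n + 1" by (simp add: context_ok_def)
next
  fix i s'
  assume i: "frame (For a eM body) s s'" "nmem s' a 0 = i" "table_ok n X t d (tab s')"
  then have "context_ok n \<epsilon> t X s'" using context_frame[OF c] a mods by auto
  then show "runs body B (\<lambda>s''. table_ok n X t d (tab s'') \<and> improves n d (tab s') (tab s'') \<and> P i (tab s'')) s'"
    using step i by blast
qed (use a ok P improves_refl in \<open>auto intro: improves_trans\<close>)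

lemma runs_loop0:
  assumes \<epsilon>: "\<epsilon> > 0" and c: "context_ok n \<epsilon> t X s" and d: "d < n" "nmem s vD 0 = d"
    and ok: "table_ok n X t d (tab s)"
  shows "runs loop0 ((loop_time n ^^ 5) (28 * real n + T n \<epsilon> + 41))
    (\<lambda>s'. table_ok n X t d (tab s') \<and> improves n d (tab s) (tab s') \<and>
     (\<forall>u<2 * n + 1. \<forall>u1<2 * n + 1. \<forall>v1<2 * n + 1. \<forall>u2<2 * n + 1. \<forall>v2<2 * n + 1.
       bounded_by n \<epsilon> t X d u u1 v1 u2 v2 (tab s'))) s"
proof -
  note st = bounded_by_stable[OF _ _ order_refl]
  let ?B = "28 * real n + T n \<epsilon> + 41"
  have e: "(loop_time n ^^ 5) ?B = loop_time n (loop_time n (loop_time n (loop_time n (loop_time n ?B))))"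
    by (simp add: numeral_eq_Suc)
  show ?thesis unfolding e
  proof (rule runs_search_loop[OF c _ _ _ _ _ _ _ _ _ _ ok])
    fix u s0 assume s0: "frame loop0 s s0" "context_ok n \<epsilon> t X s0" "nmem s0 vU 0 = u" "table_ok n X t d (tab s0)"
    show "runs loop1 (loop_time n (loop_time n (loop_time n (loop_time n ?B)))) (\<lambda>s''. table_ok n X t d (tab s'') \<and>
        improves n d (tab s0) (tab s'') \<and> (\<forall>u1<2 * n + 1. \<forall>v1<2 * n + 1. \<forall>u2<2 * n + 1. \<forall>v2<2 * n + 1.
         bounded_by n \<epsilon> t X d u u1 v1 u2 v2 (tab s''))) s0"
    proof (rule runs_search_loop[OF s0(2) _ _ _ _ _ _ _ _ _ _ s0(4)])
      fix u1 s1 assume s1: "frame loop1 s0 s1" "context_ok n \<epsilon> t X s1" "nmem s1 vU1 0 = u1" "table_ok n X t d (tab s1)"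
      show "runs loop2 (loop_time n (loop_time n (loop_time n ?B))) (\<lambda>s''. table_ok n X t d (tab s'') \<and>
          improves n d (tab s1) (tab s'') \<and> (\<forall>v1<2 * n + 1. \<forall>u2<2 * n + 1. \<forall>v2<2 * n + 1.
           bounded_by n \<epsilon> t X d u u1 v1 u2 v2 (tab s''))) s1"
      proof (rule runs_search_loop[OF s1(2) _ _ _ _ _ _ _ _ _ _ s1(4)])
        fix v1 s2 assume s2: "frame loop2 s1 s2" "context_ok n \<epsilon> t X s2" "nmem s2 vV1 0 = v1" "table_ok n X t d (tab s2)"
        show "runs loop3 (loop_time n (loop_time n ?B)) (\<lambda>s''. table_ok n X t d (tab s'') \<and>
            improves n d (tab s2) (tab s'') \<and> (\<forall>u2<2 * n + 1. \<forall>v2<2 * n + 1.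
             bounded_by n \<epsilon> t X d u u1 v1 u2 v2 (tab s''))) s2"
        proof (rule runs_search_loop[OF s2(2) _ _ _ _ _ _ _ _ _ _ s2(4)])
          fix u2 s3 assume s3: "frame loop3 s2 s3" "context_ok n \<epsilon> t X s3" "nmem s3 vU2 0 = u2" "table_ok n X t d (tab s3)"
          show "runs loop4 (loop_time n ?B) (\<lambda>s''. table_ok n X t d (tab s'') \<and>
              improves n d (tab s3) (tab s'') \<and> (\<forall>v2<2 * n + 1.
               bounded_by n \<epsilon> t X d u u1 v1 u2 v2 (tab s''))) s3"
          proof (rule runs_search_loop[OF s3(2) _ _ _ _ _ _ _ _ _ _ s3(4)])
            fix v2 s4 assume s4: "frame loop4 s3 s4" "context_ok n \<epsilon> t X s4" "nmem s4 vV2 0 = v2" "table_ok n X t d (tab s4)"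
            show "runs loop5 ?B (\<lambda>s''. table_ok n X t d (tab s'') \<and>
              improves n d (tab s4) (tab s'') \<and> bounded_by n \<epsilon> t X d u u1 v1 u2 v2 (tab s'')) s4"
              by (rule runs_loop5[OF \<epsilon> s4(2) d(1) _ s4(4)])
                (use d s0 s1 s2 s3 s4 in \<open>auto simp: frame_def\<close>)
          qed (simp_all, blast intro: st)
        qed (simp_all, blast intro: st)
      qed (simp_all, blast intro: st)
    qed (simp_all, blast intro: st)
  qed (simp_all, blast intro: st)
qed

lemma runs_dp:
  assumes \<epsilon>: "\<epsilon> > 0" and c: "context_ok n \<epsilon> t X s" and ok: "table_ok n X t 0 (tab s)"
    and diag: "\<And>u. u \<le> 2 * n \<Longrightarrow> val (tab s) (ix2 n u u) = 0"
  shows "runs dp (real n * ((loop_time n ^^ 5) (28 * real n + T n \<epsilon> + 41) + 2) + 2) (\<lambda>s'.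
     table_ok n X t n (tab s') \<and> (\<forall>u\<le>2 * n. val (tab s') (ix2 n u u) = 0) \<and>
     (\<forall>d<n. \<forall>u u1 v1 u2 v2. bounded_by n \<epsilon> t X d u u1 v1 u2 v2 (tab s'))) s"
  unfolding dp_def
proof (rule runs_For[where J = "\<lambda>k s'. table_ok n X t k (tab s') \<and> (\<forall>u\<le>2 * n. val (tab s') (ix2 n u u) = 0) \<and>
     (\<forall>d<k. \<forall>u u1 v1 u2 v2. bounded_by n \<epsilon> t X d u u1 v1 u2 v2 (tab s'))"])
  fix s' assume "frame (For vD (NV vN) loop0) s s'"
  then have "context_ok n \<epsilon> t X s'" using context_frame[OF c] by auto
  then show "nval (NV vN) s' = n" by (simp add: context_ok_def)
next
  fix d s'
  assume d: "d < n" and fr: "frame (For vD (NV vN) loop0) s s'" and vd: "nmem s' vD 0 = d"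
    and inv: "table_ok n X t d (tab s') \<and> (\<forall>u\<le>2 * n. val (tab s') (ix2 n u u) = 0) \<and>
     (\<forall>d'<d. \<forall>u u1 v1 u2 v2. bounded_by n \<epsilon> t X d' u u1 v1 u2 v2 (tab s'))"
  have c': "context_ok n \<epsilon> t X s'" using context_frame[OF c fr] by auto
  show "runs loop0 ((loop_time n ^^ 5) (28 * real n + T n \<epsilon> + 41)) (\<lambda>s''.
     table_ok n X t (Suc d) (tab (nupd vD 0 (Suc d) s'')) \<and> (\<forall>u\<le>2 * n. val (tab (nupd vD 0 (Suc d) s'')) (ix2 n u u) = 0) \<and>
     (\<forall>d'<Suc d. \<forall>u u1 v1 u2 v2. bounded_by n \<epsilon> t X d' u u1 v1 u2 v2 (tab (nupd vD 0 (Suc d) s'')))) s'"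
  proof (rule runs_mono[OF runs_loop0[OF \<epsilon> c' d vd] order_refl])
    show "table_ok n X t d (tab s')" using inv by blast
    fix s''
    assume "table_ok n X t d (tab s'') \<and> improves n d (tab s') (tab s'') \<and>
     (\<forall>u<2 * n + 1. \<forall>u1<2 * n + 1. \<forall>v1<2 * n + 1. \<forall>u2<2 * n + 1. \<forall>v2<2 * n + 1.
       bounded_by n \<epsilon> t X d u u1 v1 u2 v2 (tab s''))"
    then have ok: "table_ok n X t d (tab s'')" and im: "improves n d (tab s') (tab s'')"
      and b: "\<And>u u1 v1 u2 v2. u < 2 * n + 1 \<Longrightarrow> u1 < 2 * n + 1 \<Longrightarrow> v1 < 2 * n + 1 \<Longrightarrow> u2 < 2 * n + 1 \<Longrightarrow> v2 < 2 * n + 1 \<Longrightarrow>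
       bounded_by n \<epsilon> t X d u u1 v1 u2 v2 (tab s'')" by blast+
    \<comment> \<open>Valid gaps of an interval up to \<open>2 * n\<close> have all their bounds in
      the ranges of the loops; for all other indices the claim is vacuous.\<close>
    have b': "bounded_by n \<epsilon> t X d u u1 v1 u2 v2 (tab s'')" for u u1 v1 u2 v2
      using b[of u u1 v1 u2 v2] by (auto simp: bounded_by_def gaps_def)
    have "has (tab s'') (ix2 n u v) \<noteq> 0" if "u \<le> v" "v \<le> 2 * n" "v - u \<le> Suc d" for u v
    proof (cases "v - u \<le> d")
      case True
      then show ?thesis using ok that by (auto simp: table_ok_def)
    next
      case False
      then have "v = u + d + 1" using that by simp
      \<comment> \<open>The candidate with two empty gaps, a single group for the entire interval,
        is always valid, so every entry gets filled.\<close>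
      then show ?thesis using b'[of u u u u u] that by (simp add: bounded_by_def gaps_def)
    qed
    then have "table_ok n X t (Suc d) (tab s'')" using ok by (auto simp: table_ok_def)
    moreover have "val (tab s'') (ix2 n u u) = 0" if "u \<le> 2 * n" for u
      using im[unfolded improves_def, rule_format, of u u] inv that by auto
    moreover have "bounded_by n \<epsilon> t X d' u u1 v1 u2 v2 (tab s'')" if "d' < Suc d" for d' u u1 v1 u2 v2
      using that b' inv bounded_by_stable[OF _ im, of \<epsilon> t X d'] by (auto simp: less_Suc_eq)
    ultimately show "table_ok n X t (Suc d) (tab (nupd vD 0 (Suc d) s'')) \<and>
      (\<forall>u\<le>2 * n. val (tab (nupd vD 0 (Suc d) s'')) (ix2 n u u) = 0) \<and>
      (\<forall>d'<Suc d. \<forall>u u1 v1 u2 v2. bounded_by n \<epsilon> t X d' u u1 v1 u2 v2 (tab (nupd vD 0 (Suc d) s'')))"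
      by simp
  qed
qed (use ok diag in auto)

end

section \<open>Sorting the sources along the hull\<close>

lemma rank_bij:
  fixes n :: nat
  assumes irr: "\<And>i. \<not> R i i" and trans: "\<And>i j k. R i j \<Longrightarrow> R j k \<Longrightarrow> R i k"
    and tot: "\<And>i j. i \<noteq> j \<Longrightarrow> R i j \<or> R j i"
  defines "rk \<equiv> \<lambda>i. card {j. j < n \<and> R j i}"
  shows "\<And>i j. i < n \<Longrightarrow> R i j \<Longrightarrow> rk i < rk j" "bij_betw rk {..<n} {..<n}"
proof -
  show mono: "rk i < rk j" if "i < n" "R i j" for i j
  proof -
    have "{k. k < n \<and> R k i} \<subset> {k. k < n \<and> R k j}" using that irr trans by blast
    then show ?thesis unfolding rk_def by (intro psubset_card_mono) auto
  qed
  have "inj_on rk {..<n}"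
    unfolding inj_on_def using mono tot by (metis lessThan_iff less_irrefl)
  moreover have "rk ` {..<n} \<subseteq> {..<n}"
  proof
    fix x assume "x \<in> rk ` {..<n}"
    then obtain i where i: "i < n" "x = rk i" by auto
    have "{j. j < n \<and> R j i} \<subset> {..<n}" using irr i by auto
    then have "rk i < card {..<n}" unfolding rk_def by (intro psubset_card_mono) auto
    then show "x \<in> {..<n}" using i by simp
  qed
  ultimately show "bij_betw rk {..<n} {..<n}" by (simp add: bij_betw_def endo_inj_surj)
qed

context weber_machine
begin

text \<open>The calls of \<open>W\<close> take their input from arrays 0, 1 and 2, so the instance
  has to be moved away first.\<close>

definition copy_input :: com where
  "copy_input = Seq (Seq (NSet vN (NV 0)) (Seq (RAssign rE (NConst 0) (RCell 0 (NConst 0)))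
     (Seq (RAssign rE (NConst 1) (RCell 0 (NConst 1))) (RAssign rE (NConst 2) (RCell 0 (NConst 2))))))
     (For vI (NV vN) (Seq (RAssign rX (NV vI) (RCell 1 (NV vI))) (RAssign rY (NV vI) (RCell 2 (NV vI)))))"

definition base_ok :: "real \<Rightarrow> point \<Rightarrow> point list \<Rightarrow> state \<Rightarrow> bool" where
  "base_ok \<epsilon> t A s \<longleftrightarrow> nmem s vN 0 = length A \<and> rmem s rE 0 = \<epsilon> \<and> rmem s rE 1 = fst t \<and> rmem s rE 2 = snd t \<and>
     (\<forall>i<length A. rmem s rX i = fst (A ! i) \<and> rmem s rY i = snd (A ! i))"

lemma runs_copy_input:
  assumes "holds_input \<epsilon> t A s"
  shows "runs copy_input (4 * real (length A) + 6) (base_ok \<epsilon> t A) s"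
proof -
  define s0 where "s0 = rupd rE 2 (rmem s 0 2) (rupd rE 1 (rmem s 0 1) (rupd rE 0 (rmem s 0 0) (nupd vN 0 (nmem s 0 0) s)))"
  define J where "J i s' \<longleftrightarrow> (\<forall>j<i. rmem s' rX j = fst (A ! j) \<and> rmem s' rY j = snd (A ! j))" for i and s' :: state
  have s0: "nmem s0 vN 0 = length A" "rmem s0 rE 0 = \<epsilon>" "rmem s0 rE 1 = fst t" "rmem s0 rE 2 = snd t"
    "rmem s0 1 = rmem s 1" "rmem s0 2 = rmem s 2"
    using assms by (auto simp: s0_def holds_input_def)
  let ?b = "Seq (RAssign rX (NV vI) (RCell 1 (NV vI))) (RAssign rY (NV vI) (RCell 2 (NV vI)))"
  have "runs (For vI (NV vN) ?b) (real (length A) * (2 + 2) + 2) (J (length A)) s0"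
  proof (rule runs_For)
    fix i s'
    assume i: "i < length A" "frame (For vI (NV vN) ?b) s0 s'" "nmem s' vI 0 = i" "J i s'"
    have "rmem s' 1 i = fst (A ! i)" "rmem s' 2 i = snd (A ! i)"
      using i(1,2) s0 assms by (auto simp: frame_def holds_input_def)
    then show "runs ?b 2 (\<lambda>s''. J (Suc i) (nupd vI 0 (Suc i) s'')) s'"
      by (intro runs_straight) (use i(3,4) in \<open>auto simp: J_def less_Suc_eq\<close>)
  qed (use s0 in \<open>auto simp: frame_def J_def\<close>)
  then have loop: "runs (For vI (NV vN) ?b) (4 * real (length A) + 2) (base_ok \<epsilon> t A) s0"
    by (rule runs_mono) (use s0 in \<open>auto simp: frame_def J_def base_ok_def\<close>)
  show ?thesis unfolding copy_input_def
  proof (rule runs_SeqI[where Bc = 4 and R = "\<lambda>s'. s' = s0"])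
    show "runs (Seq (NSet vN (NV 0)) (Seq (RAssign rE (NConst 0) (RCell 0 (NConst 0)))
     (Seq (RAssign rE (NConst 1) (RCell 0 (NConst 1))) (RAssign rE (NConst 2) (RCell 0 (NConst 2)))))) 4 (\<lambda>s'. s' = s0) s"
      by (rule runs_straight) (auto simp: s0_def)
  qed (use loop in auto)
qed

abbreviation "eX e \<equiv> RCell rX e"
abbreviation "eY e \<equiv> RCell rY e"

definition bLex :: "nexp \<Rightarrow> nexp \<Rightarrow> bexp" where
  "bLex e f = BOr (RLess (eX e) (eX f)) (BAnd (BNot (RLess (eX f) (eX e))) (RLess (eY e) (eY f)))"

definition bBelow :: "nexp \<Rightarrow> nexp \<Rightarrow> nexp \<Rightarrow> bexp" where
  "bBelow a b c = BAnd (BAnd (bLex a b) (bLex b c)) (RLess (RMul (RSub (eX c) (eX a)) (RSub (eY b) (eY a)))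
     (RMul (RSub (eY c) (eY a)) (RSub (eX b) (eX a))))"

definition bHull :: "nexp \<Rightarrow> nexp \<Rightarrow> bexp" where
  "bHull e f = BOr (BAnd (NLess (NConst 0) (NCell aFL e)) (BAnd (NLess (NConst 0) (NCell aFL f)) (bLex f e)))
     (BAnd (BNot (NLess (NConst 0) (NCell aFL e))) (BOr (NLess (NConst 0) (NCell aFL f)) (bLex e f)))"

definition bBefore :: "nexp \<Rightarrow> nexp \<Rightarrow> bexp" where
  "bBefore e f = BOr (bHull e f) (BAnd (BNot (bHull f e)) (NLess e f))"

lemma bval_bLex:
  assumes "base_ok \<epsilon> t A s" "nval e s < length A" "nval f s < length A"
  shows "bval (bLex e f) s \<longleftrightarrow> lex_less (A ! nval e s) (A ! nval f s)"
  using assms by (auto simp: bLex_def base_ok_def lex_less_def)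

lemma bval_bBelow:
  assumes "base_ok \<epsilon> t A s" "nval e s < length A" "nval f s < length A" "nval g s < length A"
  shows "bval (bBelow e f g) s \<longleftrightarrow> lex_less (A ! nval e s) (A ! nval f s) \<and> lex_less (A ! nval f s) (A ! nval g s) \<and>
     det2 (A ! nval g s - A ! nval e s) (A ! nval f s - A ! nval e s) < 0"
  using assms by (auto simp: bBelow_def bval_bLex det2_def base_ok_def)

text \<open>All pairs of chord ends are tried for each source; cubic time is far below the
  total.\<close>

definition flags :: com where
  "flags = For vI (NV vN) (Seq (NAssign aFL (NV vI) (NConst 0))
     (For vJ (NV vN) (For vL (NV vN) (If (bBelow (NV vJ) (NV vI) (NV vL)) (NAssign aFL (NV vI) (NConst 1)) SKIP))))"

lemma base_frame:
  assumes "base_ok \<epsilon> t A s" "frame c s s'" "vN \<notin> nmods c" "rE \<notin> rmods c" "rX \<notin> rmods c" "rY \<notin> rmods c"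
  shows "base_ok \<epsilon> t A s'"
  using assms by (simp add: base_ok_def frame_def)

definition flags_ok :: "point list \<Rightarrow> state \<Rightarrow> bool" where
  "flags_ok A s \<longleftrightarrow> (\<forall>i<length A. 0 < nmem s aFL i \<longleftrightarrow> below_chord (set A) (A ! i))"

lemma runs_flags:
  assumes b: "base_ok \<epsilon> t A s" and n: "n = length A"
  shows "runs flags (real n * (real n * (real n * 4 + 4) + 5) + 2) (flags_ok A) s"
proof -
  let ?T = "\<lambda>i j l. lex_less (A ! j) (A ! i) \<and> lex_less (A ! i) (A ! l) \<and> det2 (A ! l - A ! j) (A ! i - A ! j) < 0"
  let ?P = "\<lambda>i. \<exists>j<n. \<exists>l<n. ?T i j l"
  let ?c = "If (bBelow (NV vJ) (NV vI) (NV vL)) (NAssign aFL (NV vI) (NConst 1)) SKIP"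
  have low: "below_chord (set A) (A ! i) \<longleftrightarrow> ?P i" for i
    unfolding below_chord_def n by (metis in_set_conv_nth)
  define J where "J i s' \<longleftrightarrow> (\<forall>k<i. 0 < nmem s' aFL k \<longleftrightarrow> ?P k)" for i and s' :: state
  have "runs flags (real n * ((real n * (real n * 4 + 4) + 3) + 2) + 2) (J n) s"
    unfolding flags_def
  proof (rule runs_For)
    fix s' assume "frame (For vI (NV vN) (Seq (NAssign aFL (NV vI) (NConst 0)) (For vJ (NV vN) (For vL (NV vN) ?c)))) s s'"
    then show "nval (NV vN) s' = n" using base_frame[OF b] n by (simp add: base_ok_def)
  next
    fix i s1
    assume i: "i < n" and f1: "frame (For vI (NV vN) (Seq (NAssign aFL (NV vI) (NConst 0)) (For vJ (NV vN) (For vL (NV vN) ?c)))) s s1"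
      and v1: "nmem s1 vI 0 = i" and J1: "J i s1"
    have b1: "base_ok \<epsilon> t A s1" using base_frame[OF b f1] by simp
    define s2 where "s2 = nupd aFL i 0 s1"
    have b2: "base_ok \<epsilon> t A s2" using b1 by (simp add: s2_def base_ok_def)
    have v2: "nmem s2 vI 0 = i" using v1 by (simp add: s2_def)
    define J' where "J' j s' \<longleftrightarrow> (\<forall>k<i. 0 < nmem s' aFL k \<longleftrightarrow> ?P k) \<and>
      (0 < nmem s' aFL i \<longleftrightarrow> (\<exists>j'<j. \<exists>l<n. ?T i j' l))" for j and s' :: state
    have "runs (For vJ (NV vN) (For vL (NV vN) ?c)) (real n * ((real n * (2 + 2) + 2) + 2) + 2) (J' n) s2"
    proof (rule runs_For)
      fix s' assume "frame (For vJ (NV vN) (For vL (NV vN) ?c)) s2 s'"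
      then show "nval (NV vN) s' = n" using base_frame[OF b2] n by (simp add: base_ok_def)
    next
      show "J' 0 (nupd vJ 0 0 s2)" using J1 by (auto simp: J'_def J_def s2_def)
    next
      fix j s3
      assume j: "j < n" and f3: "frame (For vJ (NV vN) (For vL (NV vN) ?c)) s2 s3" and v3: "nmem s3 vJ 0 = j" and J3: "J' j s3"
      have b3: "base_ok \<epsilon> t A s3" using base_frame[OF b2 f3] by simp
      have v3': "nmem s3 vI 0 = i" using f3 v2 by (simp add: frame_def)
      define J'' where "J'' m s' \<longleftrightarrow> (\<forall>k<i. 0 < nmem s' aFL k \<longleftrightarrow> ?P k) \<and>
        (0 < nmem s' aFL i \<longleftrightarrow> (\<exists>j'<j. \<exists>l<n. ?T i j' l) \<or> (\<exists>l<m. ?T i j l))" for m and s' :: state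
      have "runs (For vL (NV vN) ?c) (real n * (2 + 2) + 2) (J'' n) s3"
      proof (rule runs_For)
        fix s' assume "frame (For vL (NV vN) ?c) s3 s'"
        then show "nval (NV vN) s' = n" using base_frame[OF b3] n by (simp add: base_ok_def)
      next
        show "J'' 0 (nupd vL 0 0 s3)" using J3 by (simp add: J''_def J'_def)
      next
        fix l s4
        assume l: "l < n" and f4: "frame (For vL (NV vN) ?c) s3 s4" and v4: "nmem s4 vL 0 = l" and J4: "J'' l s4"
        have b4: "base_ok \<epsilon> t A s4" using base_frame[OF b3 f4] by simp
        have v4': "nmem s4 vI 0 = i" "nmem s4 vJ 0 = j" using f4 v3 v3' by (simp_all add: frame_def)
        have ev: "bval (bBelow (NV vJ) (NV vI) (NV vL)) s4 \<longleftrightarrow> ?T i j l"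
          using bval_bBelow[OF b4, of "NV vJ" "NV vI" "NV vL"] v4 v4' i j l n by simp
        show "runs ?c 2 (\<lambda>s''. J'' (Suc l) (nupd vL 0 (Suc l) s'')) s4"
          by (rule runs_straight) (use J4 v4' ev in \<open>auto simp: J''_def less_Suc_eq\<close>)
      qed simp
      then show "runs (For vL (NV vN) ?c) (real n * (2 + 2) + 2) (\<lambda>s''. J' (Suc j) (nupd vJ 0 (Suc j) s'')) s3"
        by (rule runs_mono) (auto simp: J''_def J'_def less_Suc_eq)
    qed simp
    then have loop: "runs (For vJ (NV vN) (For vL (NV vN) ?c)) (real n * (real n * 4 + 4) + 2) (\<lambda>s''. J (Suc i) (nupd vI 0 (Suc i) s'')) s2"
      by (rule runs_mono) (auto simp: J_def J'_def less_Suc_eq algebra_simps)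
    show "runs (Seq (NAssign aFL (NV vI) (NConst 0)) (For vJ (NV vN) (For vL (NV vN) ?c))) (real n * (real n * 4 + 4) + 3)
       (\<lambda>s''. J (Suc i) (nupd vI 0 (Suc i) s'')) s1"
    proof (rule runs_SeqI[where Bc = 1 and R = "\<lambda>s'. s' = s2"])
      show "runs (NAssign aFL (NV vI) (NConst 0)) 1 (\<lambda>s'. s' = s2) s1"
        by (rule runs_straight) (use v1 in \<open>auto simp: s2_def\<close>)
    qed (use loop in auto)
  qed (auto simp: J_def)
  then show ?thesis
    by (rule runs_mono) (auto simp: J_def flags_ok_def low n algebra_simps)
qed

lemma bval_bHull:
  assumes "base_ok \<epsilon> t A s" "flags_ok A s" "nval e s < length A" "nval f s < length A"
  shows "bval (bHull e f) s \<longleftrightarrow> hull_less (set A) (A ! nval e s) (A ! nval f s)"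
  using assms by (auto simp: bHull_def bval_bLex hull_less_def flags_ok_def)

text \<open>Sources may share a point; breaking ties by index makes this a strict total order on
  indices, so ranks are distinct.\<close>

definition before :: "point list \<Rightarrow> nat \<Rightarrow> nat \<Rightarrow> bool" where
  "before A i j \<longleftrightarrow> hull_less (set A) (A ! i) (A ! j) \<or> \<not> hull_less (set A) (A ! j) (A ! i) \<and> i < j"

lemma bval_bBefore:
  assumes "base_ok \<epsilon> t A s" "flags_ok A s" "nval e s < length A" "nval f s < length A"
  shows "bval (bBefore e f) s \<longleftrightarrow> before A (nval e s) (nval f s)"
  using assms by (auto simp: bBefore_def bval_bHull before_def)

lemma before_order:
  "\<not> before A i i" "before A i j \<Longrightarrow> before A j k \<Longrightarrow> before A i k" "i \<noteq> j \<Longrightarrow> before A i j \<or> before A j i"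
proof -
  show "\<not> before A i i" by (simp add: before_def)
  have eq: "A ! i = A ! j" if "\<not> hull_less (set A) (A ! i) (A ! j)" "\<not> hull_less (set A) (A ! j) (A ! i)" for i j
    using hull_less_total that by blast
  show "before A i k" if ij: "before A i j" and jk: "before A j k"
  proof (cases "hull_less (set A) (A ! i) (A ! j)")
    case True
    show ?thesis
    proof (cases "hull_less (set A) (A ! j) (A ! k)")
      case True
      then show ?thesis using \<open>hull_less (set A) (A ! i) (A ! j)\<close> hull_less_trans by (auto simp: before_def)
    next
      case False
      then have "A ! j = A ! k" using jk eq by (auto simp: before_def)
      then show ?thesis using True by (simp add: before_def)
    qed
  next
    case False
    then have "A ! i = A ! j" "i < j" using ij eq by (auto simp: before_def)
    then show ?thesis using jk by (auto simp: before_def)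
  qed
  show "before A i j \<or> before A j i" if "i \<noteq> j" using that by (auto simp: before_def)
qed

text \<open>Sorting by counting predecessors. Each source is entered at its rank and again
  \<open>n\<close> positions later, which writes the cycle down twice.\<close>

definition rank :: com where
  "rank = For vI (NV vN) (Seq (NSet vRK (NConst 0))
     (Seq (For vJ (NV vN) (If (bBefore (NV vJ) (NV vI)) (NSet vRK (NAdd (NV vRK) (NConst 1))) SKIP))
     (Seq (NAssign aPM (NV vRK) (NV vI)) (NAssign aPM (NAdd (NV vRK) (NV vN)) (NV vI)))))"

definition order_ok :: "point list \<Rightarrow> state \<Rightarrow> bool" where
  "order_ok A s \<longleftrightarrow> (\<forall>p<length A. nmem s aPM p < length A \<and> nmem s aPM (p + length A) = nmem s aPM p) \<and>
     inj_on (nmem s aPM) {..<length A} \<and>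
     (\<forall>p q. p < q \<longrightarrow> q < length A \<longrightarrow> before A (nmem s aPM p) (nmem s aPM q))"

lemma runs_rank:
  assumes b: "base_ok \<epsilon> t A s" and fl: "flags_ok A s" and n: "n = length A"
  shows "runs rank (real n * (real n * 4 + 7) + 2) (order_ok A) s"
proof -
  define rk where "rk i = card {j. j < n \<and> before A j i}" for i
  have rk_eq: "rk = (\<lambda>i. card {j. j < n \<and> before A j i})" by (simp add: rk_def fun_eq_iff)
  have rk: "\<And>i j. i < n \<Longrightarrow> before A i j \<Longrightarrow> rk i < rk j" "bij_betw rk {..<n} {..<n}"
    unfolding rk_eq using rank_bij[where R = "before A" and n = n, OF before_order] by simp_all
  have rkn: "rk i < n" if "i < n" for i using rk(2) that by (auto simp: bij_betw_def)
  have inj: "rk i = rk j \<longleftrightarrow> i = j" if "i < n" "j < n" for i j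
    using rk(2) that by (auto simp: bij_betw_def inj_on_def)
  define J where "J i s' \<longleftrightarrow> (\<forall>k<i. nmem s' aPM (rk k) = k \<and> nmem s' aPM (rk k + n) = k)" for i and s' :: state
  let ?c = "If (bBefore (NV vJ) (NV vI)) (NSet vRK (NAdd (NV vRK) (NConst 1))) SKIP"
  let ?body = "Seq (NSet vRK (NConst 0)) (Seq (For vJ (NV vN) ?c)
     (Seq (NAssign aPM (NV vRK) (NV vI)) (NAssign aPM (NAdd (NV vRK) (NV vN)) (NV vI))))"
  have "runs rank (real n * ((real n * 4 + 5) + 2) + 2) (J n) s"
    unfolding rank_def
  proof (rule runs_For)
    fix s' assume "frame (For vI (NV vN) ?body) s s'"
    then show "nval (NV vN) s' = n" using base_frame[OF b] n by (simp add: base_ok_def)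
  next
    fix i s1
    assume i: "i < n" and f1: "frame (For vI (NV vN) ?body) s s1" and v1: "nmem s1 vI 0 = i" and J1: "J i s1"
    have b1: "base_ok \<epsilon> t A s1" using base_frame[OF b f1] by simp
    have fl1: "flags_ok A s1" using fl f1 by (simp add: flags_ok_def frame_def)
    define s2 where "s2 = nupd vRK 0 0 s1"
    have b2: "base_ok \<epsilon> t A s2" "flags_ok A s2" using b1 fl1 by (simp_all add: s2_def base_ok_def flags_ok_def)
    have v2: "nmem s2 vI 0 = i" using v1 by (simp add: s2_def)
    have "runs (For vJ (NV vN) ?c) (real n * (2 + 2) + 2) (\<lambda>s'. nmem s' vRK 0 = card {j'. j' < n \<and> before A j' i}) s2"
    proof (rule runs_For[where J = "\<lambda>j s'. nmem s' vRK 0 = card {j'. j' < j \<and> before A j' i}"])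
      fix s' assume "frame (For vJ (NV vN) ?c) s2 s'"
      then show "nval (NV vN) s' = n" using base_frame[OF b2(1)] n by (simp add: base_ok_def)
    next
      fix j s3
      assume j: "j < n" and f3: "frame (For vJ (NV vN) ?c) s2 s3" and v3: "nmem s3 vJ 0 = j"
        and J3: "nmem s3 vRK 0 = card {j'. j' < j \<and> before A j' i}"
      have b3: "base_ok \<epsilon> t A s3" using base_frame[OF b2(1) f3] by simp
      have fl3: "flags_ok A s3" using b2(2) f3 by (simp add: flags_ok_def frame_def)
      have v3': "nmem s3 vI 0 = i" using f3 v2 by (simp add: frame_def)
      have ev: "bval (bBefore (NV vJ) (NV vI)) s3 \<longleftrightarrow> before A j i"
        using bval_bBefore[OF b3 fl3, of "NV vJ" "NV vI"] v3 v3' i j n by simp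
      have "{j'. j' < Suc j \<and> before A j' i} = (if before A j i then insert j {j'. j' < j \<and> before A j' i} else {j'. j' < j \<and> before A j' i})"
        by (auto simp: less_Suc_eq)
      then have "card {j'. j' < Suc j \<and> before A j' i} = (if before A j i then Suc (card {j'. j' < j \<and> before A j' i}) else card {j'. j' < j \<and> before A j' i})"
        by simp
      then show "runs ?c 2 (\<lambda>s''. nmem (nupd vJ 0 (Suc j) s'') vRK 0 = card {j'. j' < Suc j \<and> before A j' i}) s3"
        by (intro runs_straight) (use J3 ev in auto)
    qed (auto simp: s2_def)
    then have loop: "runs (For vJ (NV vN) ?c) (real n * 4 + 2) (\<lambda>s'. nmem s' vRK 0 = rk i) s2"
      by (rule runs_mono) (auto simp: rk_def)
    show "runs ?body (real n * 4 + 5) (\<lambda>s''. J (Suc i) (nupd vI 0 (Suc i) s'')) s1"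
    proof (rule runs_SeqI[where Bc = 1 and R = "\<lambda>s'. s' = s2"])
      show "runs (NSet vRK (NConst 0)) 1 (\<lambda>s'. s' = s2) s1"
        by (rule runs_straight) (auto simp: s2_def)
      fix s' assume "s' = s2"
      show "runs (Seq (For vJ (NV vN) ?c) (Seq (NAssign aPM (NV vRK) (NV vI)) (NAssign aPM (NAdd (NV vRK) (NV vN)) (NV vI))))
         (real n * 4 + 4) (\<lambda>s''. J (Suc i) (nupd vI 0 (Suc i) s'')) s'"
        unfolding \<open>s' = s2\<close>
      proof (rule runs_SeqI[OF loop])
        fix s3 assume f3: "frame (For vJ (NV vN) ?c) s2 s3" and r3: "nmem s3 vRK 0 = rk i"
        have v3: "nmem s3 vI 0 = i" "nmem s3 vN 0 = n" "J i s3"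
          using f3 v2 b2(1) n J1 by (auto simp: frame_def base_ok_def J_def s2_def)
        show "runs (Seq (NAssign aPM (NV vRK) (NV vI)) (NAssign aPM (NAdd (NV vRK) (NV vN)) (NV vI))) 2
           (\<lambda>s''. J (Suc i) (nupd vI 0 (Suc i) s'')) s3"
        proof (rule runs_straight)
          show "J (Suc i) (nupd vI 0 (Suc i) (result (Seq (NAssign aPM (NV vRK) (NV vI)) (NAssign aPM (NAdd (NV vRK) (NV vN)) (NV vI))) s3))"
            unfolding J_def
          proof (intro allI impI)
            fix k assume k: "k < Suc i"
            have "rk k < n" "rk i < n" "rk k = rk i \<longleftrightarrow> k = i" using rkn inj i k by auto
            then show "nmem (nupd vI 0 (Suc i) (result (Seq (NAssign aPM (NV vRK) (NV vI)) (NAssign aPM (NAdd (NV vRK) (NV vN)) (NV vI))) s3)) aPM (rk k) = k \<and>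
               nmem (nupd vI 0 (Suc i) (result (Seq (NAssign aPM (NV vRK) (NV vI)) (NAssign aPM (NAdd (NV vRK) (NV vN)) (NV vI))) s3)) aPM (rk k + n) = k"
              using v3 r3 k by (auto simp: J_def less_Suc_eq)
          qed
        qed auto
      qed simp
    qed simp
  qed (auto simp: J_def)
  then show ?thesis
  proof (rule runs_mono)
    fix s' assume J: "J n s'"
    have pm: "\<exists>i<n. rk i = p \<and> nmem s' aPM p = i \<and> nmem s' aPM (p + n) = i" if "p < n" for p
    proof -
      have "p \<in> rk ` {..<n}" using rk(2) that by (simp add: bij_betw_def)
      then show ?thesis using J by (auto simp: J_def)
    qed
    have "inj_on (nmem s' aPM) {..<n}" unfolding inj_on_def using pm by (metis lessThan_iff)
    moreover have "before A (nmem s' aPM p) (nmem s' aPM q)" if pq: "p < q" "q < n" for p q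
    proof -
      have "p < n" using pq by simp
      obtain i j where ij: "i < n" "rk i = p" "nmem s' aPM p = i" "j < n" "rk j = q" "nmem s' aPM q = j"
        using pm[OF \<open>p < n\<close>] pm[OF pq(2)] by blast
      then have "\<not> before A j i" "i \<noteq> j" using rk(1)[of j i] pq by auto
      then show ?thesis using before_order(3)[where A = A and i = i and j = j] ij by auto
    qed
    moreover have "nmem s' aPM p < n \<and> nmem s' aPM (p + n) = nmem s' aPM p" if "p < n" for p
      using pm[OF that] by auto
    ultimately show "order_ok A s'" by (simp add: order_ok_def n[symmetric])
  qed (simp add: algebra_simps)
qed

end

lemma ix2_less: "u \<le> 2 * n \<Longrightarrow> v \<le> 2 * n \<Longrightarrow> ix2 n u v < (2 * n + 1) * (2 * n + 1)"
proof -
  assume uv: "u \<le> 2 * n" "v \<le> 2 * n"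
  have "u * (2 * n + 1) \<le> 2 * n * (2 * n + 1)" using uv by (intro mult_le_mono1)
  then show ?thesis using uv by (simp add: ix2_def)
qed

context weber_machine
begin

section \<open>The complete program\<close>

text \<open>The memory is arbitrary at the start, so the flags of all entries have to be cleared
  explicitly. Empty intervals, with value 0, are the base of the recursion.\<close>

definition init :: com where
  "init = Seq (For vI (NMul eM eM) (NAssign aHS (NV vI) (NConst 0)))
     (For vI eM (Seq (NAssign aHS (eIx2 (NV vI) (NV vI)) (NConst 1)) (RAssign rF (eIx2 (NV vI) (NV vI)) (RNat (NConst 0)))))"

lemma runs_init:
  assumes N: "nmem s vN 0 = n"
  shows "runs init (real ((2 * n + 1) * (2 * n + 1)) * 3 + 8 * real n + 8)
    (\<lambda>s'. table_ok n X t 0 (tab s') \<and> (\<forall>u\<le>2 * n. val (tab s') (ix2 n u u) = 0)) s"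
  unfolding init_def
proof (rule runs_SeqI)
  let ?M = "(2 * n + 1) * (2 * n + 1)"
  let ?c = "NAssign aHS (NV vI) (NConst 0)"
  show "runs (For vI (NMul eM eM) ?c) (real ?M * (1 + 2) + 2) (\<lambda>s'. \<forall>k<?M. nmem s' aHS k = 0) s"
  proof (rule runs_For[where J = "\<lambda>i s'. \<forall>k<i. nmem s' aHS k = 0"])
    fix i and s' :: state assume "nmem s' vI 0 = i" "\<forall>k<i. nmem s' aHS k = 0"
    then show "runs ?c 1 (\<lambda>s''. \<forall>k<Suc i. nmem (nupd vI 0 (Suc i) s'') aHS k = 0) s'"
      by (intro runs_straight) (auto simp: less_Suc_eq)
  qed (use N in \<open>auto simp: frame_def\<close>)
  fix s1
  assume f1: "frame (For vI (NMul eM eM) ?c) s s1" and z: "\<forall>k<?M. nmem s1 aHS k = 0"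
  have N1: "nmem s1 vN 0 = n" using N f1 by (simp add: frame_def)
  let ?d = "Seq (NAssign aHS (eIx2 (NV vI) (NV vI)) (NConst 1)) (RAssign rF (eIx2 (NV vI) (NV vI)) (RNat (NConst 0)))"
  define J where "J i s' \<longleftrightarrow> (\<forall>u<i. nmem s' aHS (ix2 n u u) = 1 \<and> rmem s' rF (ix2 n u u) = 0) \<and>
     (\<forall>k<?M. nmem s' aHS k \<noteq> 0 \<longrightarrow> (\<exists>u<i. k = ix2 n u u))" for i and s' :: state
  have "runs (For vI eM ?d) (real (2 * n + 1) * (2 + 2) + 2) (J (2 * n + 1)) s1"
  proof (rule runs_For)
    fix i s' assume i: "i < 2 * n + 1" "frame (For vI eM ?d) s1 s'" "nmem s' vI 0 = i" "J i s'"
    have N': "nmem s' vN 0 = n" using N1 i(2) by (simp add: frame_def)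
    have r: "result ?d s' = rupd rF (ix2 n i i) 0 (nupd aHS (ix2 n i i) 1 s')"
      using i(3) N' by (simp add: ix2_def)
    show "runs ?d 2 (\<lambda>s''. J (Suc i) (nupd vI 0 (Suc i) s'')) s'"
    proof (rule runs_straight)
      show "J (Suc i) (nupd vI 0 (Suc i) (result ?d s'))"
        unfolding r using i(4) unfolding J_def by (auto simp: less_Suc_eq)
    qed auto
  qed (use N1 z in \<open>auto simp: frame_def J_def\<close>)
  then show "runs (For vI eM ?d) (8 * real n + 6)
      (\<lambda>s'. table_ok n X t 0 (tab s') \<and> (\<forall>u\<le>2 * n. val (tab s') (ix2 n u u) = 0)) s1"
  proof (rule runs_mono)
    fix s' assume J: "J (2 * n + 1) s'"
    have diag: "has (tab s') (ix2 n u u) \<noteq> 0" "val (tab s') (ix2 n u u) = 0" if "u \<le> 2 * n" for u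
      using J that by (auto simp: J_def tab_def)
    have off: "u = v" if uv: "has (tab s') (ix2 n u v) \<noteq> 0" "u \<le> 2 * n" "v \<le> 2 * n" for u v
    proof -
      obtain w where "w < 2 * n + 1" "ix2 n u v = ix2 n w w"
        using J uv(1) ix2_less[OF uv(2,3)] unfolding J_def tab_def by auto
      then show ?thesis using ix2_inj[of v n w u w] uv by auto
    qed
    have "table_ok n X t 0 (tab s')"
      unfolding table_ok_def
    proof (intro allI impI conjI)
      fix u v assume uv: "u \<le> v" "v \<le> 2 * n"
      show "sound n X t (tab s') u v" if "has (tab s') (ix2 n u v) \<noteq> 0"
        using off[OF that] uv diag(2)[of u] by (simp add: sound_def sol_ok_def)
      show "has (tab s') (ix2 n u v) \<noteq> 0" if "v - u \<le> 0" using that uv diag(1)[of u] by simp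
    qed
    then show "table_ok n X t 0 (tab s') \<and> (\<forall>u\<le>2 * n. val (tab s') (ix2 n u u) = 0)" using diag by blast
  qed (simp add: algebra_simps)
qed (simp add: algebra_simps)

section \<open>Choice of the rotation and output of the layout\<close>

definition choose_start :: com where
  "choose_start = Seq (NSet vBU (NConst 0)) (For vI (NAdd (NV vN) (NConst 1))
     (If (RLess (RCell rF (eIx2 (NV vI) (NAdd (NV vI) (NV vN)))) (RCell rF (eIx2 (NV vBU) (NAdd (NV vBU) (NV vN)))))
       (NSet vBU (NV vI)) SKIP))"

lemma runs_choose_start:
  assumes N: "nmem s vN 0 = n"
  shows "runs choose_start (4 * real n + 7) (\<lambda>s'. nmem s' vBU 0 \<le> n \<and>
     (\<forall>r\<le>n. val (tab s) (ix2 n (nmem s' vBU 0) (nmem s' vBU 0 + n)) \<le> val (tab s) (ix2 n r (r + n)))) s"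
proof -
  define s0 where "s0 = nupd vBU 0 0 s"
  define f where "f r = val (tab s) (ix2 n r (r + n))" for r
  define J where "J i s' \<longleftrightarrow> nmem s' vBU 0 \<le> n \<and> (\<forall>r<i. f (nmem s' vBU 0) \<le> f r)" for i and s' :: state
  let ?c = "If (RLess (RCell rF (eIx2 (NV vI) (NAdd (NV vI) (NV vN)))) (RCell rF (eIx2 (NV vBU) (NAdd (NV vBU) (NV vN)))))
       (NSet vBU (NV vI)) SKIP"
  have "runs (For vI (NAdd (NV vN) (NConst 1)) ?c) (real (n + 1) * (2 + 2) + 2) (J (n + 1)) s0"
  proof (rule runs_For)
    fix i s' assume i: "i < n + 1" "frame (For vI (NAdd (NV vN) (NConst 1)) ?c) s0 s'" "nmem s' vI 0 = i" "J i s'"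
    have N': "nmem s' vN 0 = n" "rmem s' rF = rmem s rF" using N i(2) by (simp_all add: frame_def s0_def)
    have ev: "bval (RLess (RCell rF (eIx2 (NV vI) (NAdd (NV vI) (NV vN)))) (RCell rF (eIx2 (NV vBU) (NAdd (NV vBU) (NV vN))))) s' \<longleftrightarrow>
       f i < f (nmem s' vBU 0)"
      using N' i(3) by (simp add: f_def tab_def ix2_def)
    show "runs ?c 2 (\<lambda>s''. J (Suc i) (nupd vI 0 (Suc i) s'')) s'"
    proof (rule runs_straight)
      show "J (Suc i) (nupd vI 0 (Suc i) (result ?c s'))"
        unfolding result.simps ev using i(1,3,4) by (auto simp: J_def less_Suc_eq intro: order_trans less_imp_le)
    qed auto
  qed (use N in \<open>auto simp: frame_def J_def s0_def\<close>)
  then have loop: "runs (For vI (NAdd (NV vN) (NConst 1)) ?c) (4 * real n + 6) (J (n + 1)) s0"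
    by (rule runs_mono) (auto simp: algebra_simps)
  have "runs choose_start (4 * real n + 7) (J (n + 1)) s"
    unfolding choose_start_def
  proof (rule runs_SeqI[where Bc = 1 and R = "\<lambda>s'. s' = s0"])
    show "runs (NSet vBU (NConst 0)) 1 (\<lambda>s'. s' = s0) s" by (rule runs_straight) (auto simp: s0_def)
  qed (use loop in auto)
  then show ?thesis by (rule runs_mono) (auto simp: J_def f_def less_Suc_eq_le)
qed

abbreviation "bRange \<equiv> BAnd (NLe (NV vBU) (NV vP)) (NLess (NV vP) (NAdd (NV vBU) (NV vN)))"
abbreviation "eOut \<equiv> eIx3 (NV vBU) (NAdd (NV vBU) (NV vN)) (NV vP)"

text \<open>Groups are numbered by the fixed points of the representative map; equality is tested by
  two inequalities, as the language only has the order.\<close>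

definition number_groups :: com where
  "number_groups = Seq (NSet 1 (NConst 0)) (For vP eM
     (If (BAnd bRange (BAnd (NLe (NCell aLB eOut) (NV vP)) (NLe (NV vP) (NCell aLB eOut))))
       (Seq (NAssign aIX (NV vP) (NV 1)) (Seq (RAssign 3 (NV 1) (RCell rS eOut))
         (Seq (RAssign 4 (NV 1) (RCell rT eOut)) (NSet 1 (NAdd (NV 1) (NConst 1)))))) SKIP))"

definition write_parents :: com where
  "write_parents = Seq (For vP eM (If bRange (NAssign 2 (NCell aPM (NV vP)) (NAdd (NV vN) (NCell aIX (NCell aLB eOut)))) SKIP))
     (For vP (NV 1) (NAssign 2 (NAdd (NV vN) (NV vP)) (NAdd (NV vN) (NV 1))))"

lemma runs_number_groups:
  assumes N: "nmem s vN 0 = n" "nmem s vBU 0 = b" and b: "b \<le> n"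
    and l: "\<And>p. l p = lab (tab s) (ix3 n b (b + n) p)"
    and L: "L = filter (\<lambda>p. b \<le> p \<and> p < b + n \<and> l p = p) [0..<Suc (2 * n)]"
  shows "runs number_groups (14 * real n + 10) (\<lambda>s'. nmem s' 1 0 = length L \<and>
     (\<forall>j<length L. nmem s' aIX (L ! j) = j \<and> rmem s' 3 j = sx (tab s) (ix3 n b (b + n) (L ! j)) \<and>
        rmem s' 4 j = sy (tab s) (ix3 n b (b + n) (L ! j)))) s"
proof -
  let ?P = "\<lambda>p. b \<le> p \<and> p < b + n \<and> l p = p"
  define L' where "L' i = filter ?P [0..<i]" for i
  define s0 where "s0 = nupd 1 0 0 s"
  define J where "J i s' \<longleftrightarrow> nmem s' 1 0 = length (L' i) \<and>
     (\<forall>j<length (L' i). nmem s' aIX (L' i ! j) = j \<and> rmem s' 3 j = rmem s rS (ix3 n b (b + n) (L' i ! j)) \<and>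
        rmem s' 4 j = rmem s rT (ix3 n b (b + n) (L' i ! j)))" for i and s' :: state
  let ?g = "BAnd bRange (BAnd (NLe (NCell aLB eOut) (NV vP)) (NLe (NV vP) (NCell aLB eOut)))"
  let ?c = "If ?g (Seq (NAssign aIX (NV vP) (NV 1)) (Seq (RAssign 3 (NV 1) (RCell rS eOut))
         (Seq (RAssign 4 (NV 1) (RCell rT eOut)) (NSet 1 (NAdd (NV 1) (NConst 1)))))) SKIP"
  have "runs (For vP eM ?c) (real (2 * n + 1) * (5 + 2) + 2) (J (2 * n + 1)) s0"
  proof (rule runs_For)
    fix i s' assume i: "i < 2 * n + 1" "frame (For vP eM ?c) s0 s'" "nmem s' vP 0 = i" "J i s'"
    have fr: "nmem s' vN 0 = n" "nmem s' vBU 0 = b" "nmem s' aLB = nmem s aLB" "rmem s' rS = rmem s rS" "rmem s' rT = rmem s rT"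
      using N i(2) by (auto simp: frame_def s0_def)
    have Pi: "bval ?g s' \<longleftrightarrow> ?P i"
      using fr i(3) l[of i] by (auto simp: tab_def ix3_def ix2_def)
    have LS: "L' (Suc i) = (if ?P i then L' i @ [i] else L' i)" by (simp add: L'_def)
    have res: "result ?c s' = (if ?P i then nupd 1 0 (Suc (nmem s' 1 0)) (rupd 4 (nmem s' 1 0) (rmem s rT (ix3 n b (b + n) i))
        (rupd 3 (nmem s' 1 0) (rmem s rS (ix3 n b (b + n) i)) (nupd aIX i (nmem s' 1 0) s'))) else s')"
      unfolding result.simps Pi using fr i(3) by (auto simp: ix3_def ix2_def)
    have old: "L' i ! j \<noteq> i" if "j < length (L' i)" for j
    proof -
      have "L' i ! j \<in> set (L' i)" using that by simp
      then show ?thesis by (auto simp: L'_def)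
    qed
    show "runs ?c 5 (\<lambda>s''. J (Suc i) (nupd vP 0 (Suc i) s'')) s'"
    proof (rule runs_straight)
      show "J (Suc i) (nupd vP 0 (Suc i) (result ?c s'))"
        unfolding res J_def LS using i(4) old unfolding J_def
        by (auto simp: nth_append less_Suc_eq)
    qed auto
  qed (use N in \<open>auto simp: frame_def J_def s0_def L'_def\<close>)
  then have loop: "runs (For vP eM ?c) (14 * real n + 9) (J (2 * n + 1)) s0"
    by (rule runs_mono) (auto simp: algebra_simps)
  have "runs number_groups (14 * real n + 10) (J (2 * n + 1)) s"
    unfolding number_groups_def
  proof (rule runs_SeqI[where Bc = 1 and R = "\<lambda>s'. s' = s0"])
    show "runs (NSet 1 (NConst 0)) 1 (\<lambda>s'. s' = s0) s" by (rule runs_straight) (auto simp: s0_def)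
  qed (use loop in auto)
  then show ?thesis by (rule runs_mono) (auto simp: J_def L'_def L tab_def)
qed

lemma runs_write_parents:
  assumes N: "nmem s vN 0 = n" "nmem s vBU 0 = b" "nmem s 1 0 = m" and b: "b \<le> n"
    and inj: "inj_on (nmem s aPM) {b..<b + n}" and PM: "\<And>p. b \<le> p \<Longrightarrow> p < b + n \<Longrightarrow> nmem s aPM p < n"
    and l: "\<And>p. l p = lab (tab s) (ix3 n b (b + n) p)"
  shows "runs write_parents (8 * real n + 3 * real m + 8) (\<lambda>s'. 
     (\<forall>p. b \<le> p \<longrightarrow> p < b + n \<longrightarrow> nmem s' 2 (nmem s aPM p) = n + nmem s aIX (l p)) \<and>
     (\<forall>j<m. nmem s' 2 (n + j) = n + m)) s"
  unfolding write_parents_def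
proof (rule runs_SeqI)
  let ?c = "If bRange (NAssign 2 (NCell aPM (NV vP)) (NAdd (NV vN) (NCell aIX (NCell aLB eOut)))) SKIP"
  let ?J = "\<lambda>i s'. \<forall>p. b \<le> p \<longrightarrow> p < b + n \<longrightarrow> p < i \<longrightarrow> nmem s' 2 (nmem s aPM p) = n + nmem s aIX (l p)"
  show "runs (For vP eM ?c) (real (2 * n + 1) * (2 + 2) + 2) (?J (2 * n + 1)) s"
  proof (rule runs_For)
    fix i s' assume i: "i < 2 * n + 1" "frame (For vP eM ?c) s s'" "nmem s' vP 0 = i" and J: "?J i s'"
    have fr: "nmem s' vN 0 = n" "nmem s' vBU 0 = b" "nmem s' aLB = nmem s aLB" "nmem s' aPM = nmem s aPM" "nmem s' aIX = nmem s aIX"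
      using N i(2) by (auto simp: frame_def)
    have ev: "bval bRange s' \<longleftrightarrow> b \<le> i \<and> i < b + n" using fr i(3) by auto
    have res: "result ?c s' = (if b \<le> i \<and> i < b + n then nupd 2 (nmem s aPM i) (n + nmem s aIX (l i)) s' else s')"
      unfolding result.simps ev using fr i(3) l[of i] by (auto simp: ix3_def ix2_def tab_def)
    have ne: "nmem s aPM p \<noteq> nmem s aPM i" if "b \<le> i" "i < b + n" "b \<le> p" "p < b + n" "p \<noteq> i" for p
      using inj_onD[OF inj, of p i] that by auto
    show "runs ?c 2 (\<lambda>s''. ?J (Suc i) (nupd vP 0 (Suc i) s'')) s'"
    proof (rule runs_straight)
      show "?J (Suc i) (nupd vP 0 (Suc i) (result ?c s'))"
        unfolding res using J ne by (auto simp: less_Suc_eq)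
    qed auto
  qed (use N in \<open>auto simp: frame_def\<close>)
  fix s1 assume f1: "frame (For vP eM ?c) s s1" and J1: "?J (2 * n + 1) s1"
  have fr1: "nmem s1 vN 0 = n" "nmem s1 1 0 = m" using N f1 by (auto simp: frame_def)
  let ?d = "NAssign 2 (NAdd (NV vN) (NV vP)) (NAdd (NV vN) (NV 1))"
  let ?J' = "\<lambda>i s'. ?J (2 * n + 1) s' \<and> (\<forall>j<i. nmem s' 2 (n + j) = n + m)"
  have "runs (For vP (NV 1) ?d) (real m * (1 + 2) + 2) (?J' m) s1"
  proof (rule runs_For[where J = ?J'])
    fix i s' assume i: "i < m" "frame (For vP (NV 1) ?d) s1 s'" "nmem s' vP 0 = i" and J: "?J' i s'"
    have fr: "nmem s' vN 0 = n" "nmem s' 1 0 = m" using fr1 i(2) by (auto simp: frame_def)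
    have res: "result ?d s' = nupd 2 (n + i) (n + m) s'" using fr i(3) by simp
    \<comment> \<open>Codes of sources are below \<open>n\<close> and those of Steiner vertices
      start at \<open>n\<close>, so the parents of the sources are not overwritten.\<close>
    have ne: "nmem s aPM p \<noteq> n + i" if "b \<le> p" "p < b + n" for p using PM[OF that] by simp
    show "runs ?d 1 (\<lambda>s''. ?J' (Suc i) (nupd vP 0 (Suc i) s'')) s'"
    proof (rule runs_straight)
      show "?J' (Suc i) (nupd vP 0 (Suc i) (result ?d s'))"
        unfolding res using J ne by (auto simp: less_Suc_eq)
    qed auto
  qed (use fr1 J1 in \<open>auto simp: frame_def\<close>)
  then show "runs (For vP (NV 1) ?d) (real m * 3 + 2) (\<lambda>s'. 
     (\<forall>p. b \<le> p \<longrightarrow> p < b + n \<longrightarrow> nmem s' 2 (nmem s aPM p) = n + nmem s aIX (l p)) \<and>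
     (\<forall>j<m. nmem s' 2 (n + j) = n + m)) s1"
    by (rule runs_mono) (use b in auto)
qed (simp add: algebra_simps)

text \<open>Subtracting \<open>n\<close> from the positions beyond \<open>n - 1\<close>
  (\<open>red\<close>) is injective on a window of \<open>n\<close> consecutive positions, so the
  window sees every source exactly once.\<close>

lemma order_ok_bij:
  assumes o: "order_ok A s" and n: "n = length A" and b: "b \<le> n"
  shows "bij_betw (nmem s aPM) {b..<b + n} {..<n}"
proof -
  have pm: "nmem s aPM p < n" "nmem s aPM (p + n) = nmem s aPM p" if "p < n" for p
    using o that by (auto simp: order_ok_def n)
  have inj: "p = q" if "nmem s aPM p = nmem s aPM q" "p < n" "q < n" for p q
    using o that by (auto simp: order_ok_def n inj_on_def)
  define red where "red p = (if p < n then p else p - n)" for p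
  have red: "red p < n" "nmem s aPM p = nmem s aPM (red p)" if "p \<in> {b..<b + n}" for p
    using that b pm(2)[of "p - n"] by (auto simp: red_def)
  have red_inj: "p = q" if "red p = red q" "p \<in> {b..<b + n}" "q \<in> {b..<b + n}" for p q
    using that b by (auto simp: red_def split: if_splits)
  have inj_R: "inj_on (nmem s aPM) {b..<b + n}"
  proof (rule inj_onI)
    fix p q assume pq: "p \<in> {b..<b + n}" "q \<in> {b..<b + n}" "nmem s aPM p = nmem s aPM q"
    then have "red p = red q" using inj[of "red p" "red q"] red[OF pq(1)] red[OF pq(2)] by simp
    then show "p = q" using red_inj pq by blast
  qed
  moreover have "nmem s aPM ` {b..<b + n} \<subseteq> {..<n}" using red pm(1) by force
  moreover have "card (nmem s aPM ` {b..<b + n}) = card {..<n}" using card_image[OF inj_R] by simp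
  ultimately show ?thesis
    unfolding bij_betw_def using card_subset_eq[of "{..<n}"] by blast
qed

lemma alternating_order:
  assumes cb: "convex_boundary (set A) H" and o: "order_ok A s" and n: "n = length A" "0 < n"
    and X: "\<And>p. X p = A ! nmem s aPM (p mod n)"
  shows "alternating X 0 n" "\<And>p. X p \<in> set A" "\<And>p. X (p + n) = X p"
proof -
  have pm: "nmem s aPM p < n" if "p < n" for p
    using o that by (auto simp: order_ok_def n)
  show mem: "X p \<in> set A" for p using pm[of "p mod n"] n by (simp add: X)
  show "X (p + n) = X p" for p by (simp add: X)
  show "alternating X 0 n"
  proof (rule convex_boundary.alternating_sorted[OF cb mem])
    fix i j assume ij: "i < j" "j < n"
    then have "before A (nmem s aPM i) (nmem s aPM j)" using o by (auto simp: order_ok_def n)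
    moreover have "i mod n = i" "j mod n = j" using ij by auto
    ultimately show "X i = X j \<or> hull_less (set A) (X i) (X j)"
      using hull_less_total[of "X i" "X j" "set A"] by (auto simp: before_def X)
  qed
qed

text \<open>Every layout yields sites in the hull to which the geometric bound applies; reindexing
  by the permutation of the sources turns the sum over positions back into the cost of the
  layout.\<close>

lemma dp_lower_bound:
  assumes \<epsilon>: "\<epsilon> > 0" and I: "sinks I = [t]" "layers I = 1" "alpha I = 0" "convex_instance I"
    and A: "A = sources I" and n: "n = length A" and o: "order_ok A s"
    and X: "\<And>p. X p = A ! nmem s aPM (p mod n)"
    and diag: "\<forall>u\<le>2 * n. val x (ix2 n u u) = 0"
    and bd: "\<forall>d<n. \<forall>u u1 v1 u2 v2. bounded_by n \<epsilon> t X d u u1 v1 u2 v2 x"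
    and L: "is_layout I L"
  shows "\<exists>r\<le>n. val x (ix2 n r (r + n)) \<le> (1 + \<epsilon>) * layout_cost I L"
proof (cases "n = 0")
  case True
  have "0 \<le> layout_cost I L" unfolding layout_cost_def by (rule sum_nonneg) auto
  then show ?thesis using True diag \<epsilon> by (intro exI[of _ 0]) simp
next
  case False
  define H where "H = convex hull (set A \<union> {t})"
  have "H = convex hull (set (sources I) \<union> {t})" by (simp add: H_def A)
  from layout_projected_sites[OF L I(1-3) this]
  obtain Q par where "finite Q" "Q \<subseteq> H" "\<And>i. i < length (sources I) \<Longrightarrow> par i \<in> Q"
    "(\<Sum>i<length (sources I). dist (sources I ! i) (par i)) + (\<Sum>q\<in>Q. dist q t) \<le> layout_cost I L"
    by blast
  then have Q: "finite Q" "Q \<subseteq> H" "\<And>i. i < n \<Longrightarrow> par i \<in> Q"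
    "(\<Sum>i<n. dist (A ! i) (par i)) + (\<Sum>q\<in>Q. dist q t) \<le> layout_cost I L"
    by (simp_all add: n A)
  have cb: "convex_boundary (set A) H"
  proof
    show "convex H" by (simp add: H_def)
    show "set A \<subseteq> H" by (auto simp: H_def intro: hull_inc)
    show "set A \<subseteq> frontier H" using I by (auto simp: H_def convex_instance_def A)
  qed
  have pos: "0 < n" using False by simp
  note alt = alternating_order[OF cb o n pos X]
  have bij: "bij_betw (nmem s aPM) {..<n} {..<n}"
    using order_ok_bij[OF o n, of 0] by (simp add: atLeast0LessThan)
  have "\<exists>r\<le>n. val x (ix2 n r (r + n)) \<le>
     (1 + \<epsilon>) * ((\<Sum>i<n. dist (X i) (par (nmem s aPM i))) + (\<Sum>q\<in>Q. dist q t))"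
  proof (rule interval_dp_le_sites[where F = "\<lambda>u v. val x (ix2 n u v)", OF cb Q(1,2) _ alt(2,3,1)])
    show "par (nmem s aPM i) \<in> Q" if "i < n" for i using Q(3) bij that by (auto simp: bij_betw_def)
    fix u v u1 v1 u2 v2
    assume uv: "v \<le> u + n" "v \<le> 2 * n" and g: "gaps u v u1 v1 u2 v2"
    define d where "d = v - u - 1"
    have d: "d < n" "v = u + d + 1" using uv g by (auto simp: d_def gaps_def)
    show "val x (ix2 n u v) \<le> val x (ix2 n u1 v1) + val x (ix2 n u2 v2) +
      (1 + \<epsilon>) * weber_cost t (map X (filter (in_group u v u1 v1 u2 v2) [0..<Suc (2 * n)]))"
      using bd[rule_format, OF d(1), of u u1 v1 u2 v2] uv(2) g unfolding bounded_by_def d(2)[symmetric] by blast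
  qed (use \<epsilon> diag in auto)
  also have "(\<Sum>i<n. dist (X i) (par (nmem s aPM i))) = (\<Sum>i<n. dist (A ! nmem s aPM i) (par (nmem s aPM i)))"
    by (rule sum.cong) (simp_all add: X)
  also have "\<dots> = (\<Sum>i<n. dist (A ! i) (par i))"
    using sum.reindex_bij_betw[OF bij, of "\<lambda>i. dist (A ! i) (par i)"] .
  finally obtain r where r: "r \<le> n" "val x (ix2 n r (r + n)) \<le> (1 + \<epsilon>) * ((\<Sum>i<n. dist (A ! i) (par i)) + (\<Sum>q\<in>Q. dist q t))"
    by blast
  have "(1 + \<epsilon>) * ((\<Sum>i<n. dist (A ! i) (par i)) + (\<Sum>q\<in>Q. dist q t)) \<le> (1 + \<epsilon>) * layout_cost I L"
    using Q(4) \<epsilon> by (intro mult_left_mono) auto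
  then show ?thesis using r by force
qed

lemma output_of_solution:
  assumes I: "sinks I = [t]" "layers I = 1" "alpha I = 0"
    and A: "A = sources I" and n: "n = length A" and o: "order_ok A s"
    and X: "\<And>p. X p = A ! nmem s aPM (p mod n)" and b: "b \<le> n"
    and l: "\<And>p. l p = lab x (ix3 n b (b + n) p)"
    and sd: "sound n X t x b (b + n)"
    and L: "L = filter (\<lambda>p. b \<le> p \<and> p < b + n \<and> l p = p) [0..<Suc (2 * n)]"
    and m: "nmem s' 1 0 = length L"
    and st: "\<forall>j<length L. h (L ! j) = j \<and> rmem s' 3 j = sx x (ix3 n b (b + n) (L ! j)) \<and>
        rmem s' 4 j = sy x (ix3 n b (b + n) (L ! j))"
    and p1: "\<forall>p. b \<le> p \<longrightarrow> p < b + n \<longrightarrow> nmem s' 2 (nmem s aPM p) = n + h (l p)"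
    and p2: "\<forall>j<length L. nmem s' 2 (n + j) = n + length L"
  shows "is_layout I (output_layout I s')" "layout_cost I (output_layout I s') \<le> val x (ix2 n b (b + n))"
proof -
  let ?R = "{b..<b + n}"
  define \<sigma> where "\<sigma> p = (sx x (ix3 n b (b + n) p), sy x (ix3 n b (b + n) p))" for p
  have bij: "bij_betw (nmem s aPM) ?R {..<n}" by (rule order_ok_bij[OF o n b])
  define inv where "inv i = the_inv_into ?R (nmem s aPM) i" for i
  have inv: "inv i \<in> ?R" "nmem s aPM (inv i) = i" if "i < n" for i
  proof -
    have i: "i \<in> nmem s aPM ` ?R" "inj_on (nmem s aPM) ?R" using bij that by (auto simp: bij_betw_def)
    show "inv i \<in> ?R" unfolding inv_def using the_inv_into_into[OF i(2,1)] by blast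
    show "nmem s aPM (inv i) = i" unfolding inv_def using f_the_inv_into_f[OF i(2,1)] .
  qed
  have inv': "inv (nmem s aPM p) = p" if "p \<in> ?R" for p
    using that bij by (simp add: inv_def bij_betw_def the_inv_into_f_f)
  have sol: "l p \<in> ?R \<and> l (l p) = l p \<and> \<sigma> (l p) = \<sigma> p" if "p \<in> ?R" for p
    using sd that unfolding sound_def sol_ok_def l[symmetric] \<sigma>_def by auto
  have cost: "(\<Sum>p\<in>?R. dist (X p) (\<sigma> p)) + (\<Sum>p\<in>{p\<in>?R. l p = p}. dist (\<sigma> p) t) \<le> val x (ix2 n b (b + n))"
    using sd unfolding sound_def sol_ok_def l[symmetric] \<sigma>_def by blast
  have setL: "set L = {p\<in>?R. l p = p}" using b by (auto simp: L)
  have distL: "distinct L" by (simp add: L)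
  have idx: "\<exists>j<length L. L ! j = l p" if "p \<in> ?R" for p
  proof -
    have "l p \<in> set L" using sol[OF that] setL by auto
    then show ?thesis by (auto simp: in_set_conv_nth)
  qed
  \<comment> \<open>From a source to its position in the window, to the representative of its group,
    to the number of the group.\<close>
  define ix where "ix i = h (l (inv i))" for i
  have src: "nmem s' 2 i = n + ix i \<and> ix i < length L" if i: "i < n" for i
  proof -
    obtain j where "j < length L" "L ! j = l (inv i)" using idx inv(1)[OF i] by blast
    then have "ix i < length L" using st by (auto simp: ix_def)
    then show ?thesis using p1[rule_format, of "inv i"] inv[OF i] by (auto simp: ix_def)
  qed
  have onto: "\<exists>i<n. ix i = j" if "j < length L" for j
  proof -
    have "L ! j \<in> set L" using that by simp
    then have p: "L ! j \<in> ?R" "l (L ! j) = L ! j" using setL by auto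
    have "nmem s aPM (L ! j) < n" using bij p(1) by (auto simp: bij_betw_def)
    moreover have "ix (nmem s aPM (L ! j)) = j" using inv'[OF p(1)] p(2) st that by (simp add: ix_def)
    ultimately show ?thesis by blast
  qed
  have n': "n = length (sources I)" using n A by simp
  note out = output_layout_correct[OF I n' m[symmetric] src onto p2[rule_format]]
  show "is_layout I (output_layout I s')" by (rule out(1))
  have coord: "(rmem s' 3 j, rmem s' 4 j) = \<sigma> (L ! j)" if "j < length L" for j
    using st that by (simp add: \<sigma>_def)
  have "layout_cost I (output_layout I s') \<le>
      (\<Sum>i<n. dist (A ! i) (rmem s' 3 (ix i), rmem s' 4 (ix i))) + (\<Sum>j<length L. dist (rmem s' 3 j, rmem s' 4 j) t)"
    using out(2) by (simp add: A)
  also have "(\<Sum>i<n. dist (A ! i) (rmem s' 3 (ix i), rmem s' 4 (ix i))) =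
      (\<Sum>p\<in>?R. dist (A ! nmem s aPM p) (rmem s' 3 (ix (nmem s aPM p)), rmem s' 4 (ix (nmem s aPM p))))"
    using sum.reindex_bij_betw[OF bij, of "\<lambda>i. dist (A ! i) (rmem s' 3 (ix i), rmem s' 4 (ix i))"] by simp
  also have "\<dots> = (\<Sum>p\<in>?R. dist (X p) (\<sigma> p))"
  proof (rule sum.cong[OF refl])
    fix p assume p: "p \<in> ?R"
    obtain j where j: "j < length L" "L ! j = l p" using idx[OF p] by blast
    have "ix (nmem s aPM p) = j" using inv'[OF p] j st by (auto simp: ix_def)
    then have "(rmem s' 3 (ix (nmem s aPM p)), rmem s' 4 (ix (nmem s aPM p))) = \<sigma> p"
      using coord[OF j(1)] j(2) sol[OF p] by simp
    moreover have "X p = A ! nmem s aPM p"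
    proof (cases "p < n")
      case False
      then have "p mod n = p - n" using p b by (simp add: le_mod_geq)
      moreover have "p - n < n" using p b False by auto
      then have "nmem s aPM (p - n + n) = nmem s aPM (p - n)"
        using o unfolding order_ok_def n[symmetric] by blast
      ultimately show ?thesis using False by (simp add: X)
    qed (simp add: X)
    ultimately show "dist (A ! nmem s aPM p) (rmem s' 3 (ix (nmem s aPM p)), rmem s' 4 (ix (nmem s aPM p))) = dist (X p) (\<sigma> p)"
      by simp
  qed
  also have "(\<Sum>j<length L. dist (rmem s' 3 j, rmem s' 4 j) t) = (\<Sum>j<length L. dist (\<sigma> (L ! j)) t)"
    by (rule sum.cong) (use coord in auto)
  also have "\<dots> = (\<Sum>p\<in>set L. dist (\<sigma> p) t)"
    using sum.reindex_bij_betw[OF bij_betw_nth[OF distL refl refl], of "\<lambda>p. dist (\<sigma> p) t"] .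
  finally show "layout_cost I (output_layout I s') \<le> val x (ix2 n b (b + n))"
    using cost setL by simp
qed

definition solver :: com where
  "solver = Seq copy_input (Seq flags (Seq rank (Seq init (Seq dp (Seq choose_start (Seq number_groups write_parents))))))"

lemma solver_mods [simp]:
  "nmods copy_input = {vN, vI}" "rmods copy_input = {rE, rX, rY}"
  "nmods flags = {vI, vJ, vL, aFL}" "rmods flags = {}"
  "nmods rank = {vI, vJ, vRK, aPM}" "rmods rank = {}"
  "nmods init = {vI, aHS}" "rmods init = {rF}"
  "nmods dp = {vD, vU, vU1, vV1, vU2, vV2, vCN, vLD, vP, aHS, aLB, 0} \<union> nmods W"
  "rmods dp = {0, 1, 2, rC, rF, rS, rT} \<union> rmods W"
  "nmods choose_start = {vBU, vI}" "rmods choose_start = {}"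
  "nmods number_groups = {1, vP, aIX}" "rmods number_groups = {3, 4}"
  "nmods write_parents = {2, vP}" "rmods write_parents = {}"
  by (auto simp: copy_input_def flags_def rank_def init_def dp_def choose_start_def number_groups_def write_parents_def)

lemma tab_frame:
  assumes "frame c s s'" "aHS \<notin> nmods c" "aLB \<notin> nmods c" "rF \<notin> rmods c" "rS \<notin> rmods c" "rT \<notin> rmods c"
  shows "tab s' = tab s"
  using assms by (simp add: tab_def frame_def)

definition solver_time :: "nat \<Rightarrow> real \<Rightarrow> real" where
  "solver_time n \<epsilon> = (4 * real n + 6) + ((real n * (real n * (real n * 4 + 4) + 5) + 2) + ((real n * (real n * 4 + 7) + 2) +
     ((real ((2 * n + 1) * (2 * n + 1)) * 3 + 8 * real n + 8) +
     ((real n * ((loop_time n ^^ 5) (28 * real n + T n \<epsilon> + 41) + 2) + 2) +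
     ((4 * real n + 7) + ((14 * real n + 10) + (14 * real n + 11)))))))"

lemma runs_solver:
  assumes \<epsilon>: "\<epsilon> > 0" and I: "sinks I = [t]" "layers I = 1" "alpha I = 0" "convex_instance I"
    and inp: "holds_input \<epsilon> t (sources I) s"
  shows "runs solver (solver_time (length (sources I)) \<epsilon>) (\<lambda>s'. is_layout I (output_layout I s') \<and>
     layout_cost I (output_layout I s') \<le> (1 + \<epsilon>) * min_cost I) s"
    (is "runs _ _ ?Q s")
proof -
  define A where "A = sources I"
  define n where "n = length A"
  have inp': "holds_input \<epsilon> t A s" using inp by (simp add: A_def)
  let ?B7 = "(14 * real n + 10) + (14 * real n + 11)"
  let ?B6 = "(4 * real n + 7) + ?B7"
  let ?B5 = "(real n * ((loop_time n ^^ 5) (28 * real n + T n \<epsilon> + 41) + 2) + 2) + ?B6"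
  let ?B4 = "(real ((2 * n + 1) * (2 * n + 1)) * 3 + 8 * real n + 8) + ?B5"
  let ?B3 = "(real n * (real n * 4 + 7) + 2) + ?B4"
  let ?B2 = "(real n * (real n * (real n * 4 + 4) + 5) + 2) + ?B3"
  show ?thesis
    unfolding solver_def solver_time_def A_def[symmetric] n_def[symmetric]
  proof (rule runs_SeqI[OF runs_copy_input[OF inp', folded n_def] _ order_refl])
    fix s1 assume b1: "base_ok \<epsilon> t A s1"
    show "runs (Seq flags (Seq rank (Seq init (Seq dp (Seq choose_start (Seq number_groups write_parents)))))) ?B2 ?Q s1"
    proof (rule runs_SeqI[OF runs_flags[OF b1 n_def] _ order_refl])
      fix s2 assume f2: "frame flags s1 s2" and fl2: "flags_ok A s2"
      have b2: "base_ok \<epsilon> t A s2" using base_frame[OF b1 f2] by simp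
      show "runs (Seq rank (Seq init (Seq dp (Seq choose_start (Seq number_groups write_parents))))) ?B3 ?Q s2"
      proof (rule runs_SeqI[OF runs_rank[OF b2 fl2 n_def] _ order_refl])
        fix s3 assume f3: "frame rank s2 s3" and o3: "order_ok A s3"
        have b3: "base_ok \<epsilon> t A s3" using base_frame[OF b2 f3] by simp
        define X where "X p = A ! nmem s3 aPM (p mod n)" for p
        have N3: "nmem s3 vN 0 = n" using b3 by (simp add: base_ok_def n_def)
        have c3: "context_ok n \<epsilon> t X s3"
        proof -
          have "rmem s3 rX (nmem s3 aPM p) = fst (X p) \<and> rmem s3 rY (nmem s3 aPM p) = snd (X p)" if "p < 2 * n" for p
          proof -
            have m: "p mod n < n" using that by simp
            have "nmem s3 aPM p = nmem s3 aPM (p mod n)"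
            proof (cases "p < n")
              case False
              then have "p mod n = p - n" "p - n < n" "p = (p - n) + n" using that by (auto simp: le_mod_geq)
              then show ?thesis using o3 unfolding order_ok_def n_def[symmetric] by metis
            qed simp
            moreover have "nmem s3 aPM (p mod n) < n" using o3 m by (simp add: order_ok_def n_def)
            ultimately show ?thesis using b3 by (simp add: base_ok_def X_def n_def)
          qed
          then show ?thesis using b3 by (simp add: context_ok_def base_ok_def n_def)
        qed
        show "runs (Seq init (Seq dp (Seq choose_start (Seq number_groups write_parents)))) ?B4 ?Q s3"
        proof (rule runs_SeqI[OF runs_init[OF N3] _ order_refl])
          fix s4 assume f4: "frame init s3 s4"
            and t4: "table_ok n X t 0 (tab s4) \<and> (\<forall>u\<le>2 * n. val (tab s4) (ix2 n u u) = 0)"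
          have c4: "context_ok n \<epsilon> t X s4" using context_frame[OF c3 f4] by simp
          have d4: "val (tab s4) (ix2 n u u) = 0" if "u \<le> 2 * n" for u using t4 that by blast
          show "runs (Seq dp (Seq choose_start (Seq number_groups write_parents))) ?B5 ?Q s4"
          proof (rule runs_SeqI[OF runs_dp[OF \<epsilon> c4 conjunct1[OF t4] d4] _ order_refl])
            fix s5 assume f5: "frame dp s4 s5"
              and t5: "table_ok n X t n (tab s5) \<and> (\<forall>u\<le>2 * n. val (tab s5) (ix2 n u u) = 0) \<and>
                (\<forall>d<n. \<forall>u u1 v1 u2 v2. bounded_by n \<epsilon> t X d u u1 v1 u2 v2 (tab s5))"
            have N5: "nmem s5 vN 0 = n" using N3 f4 f5 by (simp add: frame_def)
            have p5: "nmem s5 aPM = nmem s3 aPM" using f4 f5 by (simp add: frame_def)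
            have o5: "order_ok A s5" using o3 p5 by (simp add: order_ok_def)
            show "runs (Seq choose_start (Seq number_groups write_parents)) ?B6 ?Q s5"
            proof (rule runs_SeqI[OF runs_choose_start[OF N5] _ order_refl])
              fix s6 assume f6: "frame choose_start s5 s6" and r6: "nmem s6 vBU 0 \<le> n \<and>
                (\<forall>r\<le>n. val (tab s5) (ix2 n (nmem s6 vBU 0) (nmem s6 vBU 0 + n)) \<le> val (tab s5) (ix2 n r (r + n)))"
              define b where "b = nmem s6 vBU 0"
              define x where "x = tab s5"
              have x6: "tab s6 = x" unfolding x_def by (rule tab_frame[OF f6]) simp_all
              have b: "b \<le> n" "\<And>r. r \<le> n \<Longrightarrow> val x (ix2 n b (b + n)) \<le> val x (ix2 n r (r + n))"
                using r6 by (auto simp: b_def x_def)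
              have N6: "nmem s6 vN 0 = n" using N5 f6 by (simp add: frame_def)
              have p6: "nmem s6 aPM = nmem s3 aPM" using p5 f6 by (simp add: frame_def)
              define l where "l p = lab x (ix3 n b (b + n) p)" for p
              define L where "L = filter (\<lambda>p. b \<le> p \<and> p < b + n \<and> l p = p) [0..<Suc (2 * n)]"
              have l6: "l p = lab (tab s6) (ix3 n b (b + n) p)" for p by (simp add: l_def x6)
              show "runs (Seq number_groups write_parents) ?B7 ?Q s6"
              proof (rule runs_SeqI[OF runs_number_groups[OF N6 b_def[symmetric] b(1) l6 L_def] _ order_refl])
                fix s7 assume f7: "frame number_groups s6 s7"
                  and g7: "nmem s7 1 0 = length L \<and> (\<forall>j<length L. nmem s7 aIX (L ! j) = j \<and>
                    rmem s7 3 j = sx (tab s6) (ix3 n b (b + n) (L ! j)) \<and> rmem s7 4 j = sy (tab s6) (ix3 n b (b + n) (L ! j)))"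
                have p7: "nmem s7 aPM = nmem s3 aPM" "nmem s7 vN 0 = n" "nmem s7 vBU 0 = b" "tab s7 = x"
                  using p6 f7 N6 x6 tab_frame[OF f7] by (simp_all add: frame_def b_def)
                have l7: "l p = lab (tab s7) (ix3 n b (b + n) p)" for p by (simp add: l_def p7)
                have bij: "bij_betw (nmem s7 aPM) {b..<b + n} {..<n}"
                  using order_ok_bij[OF o3 n_def b(1)] p7 by simp
                have "length L \<le> 2 * n + 1" unfolding L_def by (rule order_trans[OF length_filter_le]) simp
                then have len: "real (length L) \<le> 2 * real n + 1" by linarith
                have "runs write_parents (8 * real n + 3 * real (length L) + 8) (\<lambda>s'.
                    (\<forall>p. b \<le> p \<longrightarrow> p < b + n \<longrightarrow> nmem s' 2 (nmem s7 aPM p) = n + nmem s7 aIX (l p)) \<and>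
                    (\<forall>j<length L. nmem s' 2 (n + j) = n + length L)) s7"
                  by (rule runs_write_parents[OF p7(2,3) conjunct1[OF g7] b(1) _ _ l7])
                    (use bij in \<open>auto simp: bij_betw_def\<close>)
                then show "runs write_parents (14 * real n + 11) ?Q s7"
                proof (rule runs_mono)
                  fix s8 assume f8: "frame write_parents s7 s8"
                    and w: "(\<forall>p. b \<le> p \<longrightarrow> p < b + n \<longrightarrow> nmem s8 2 (nmem s7 aPM p) = n + nmem s7 aIX (l p)) \<and>
                      (\<forall>j<length L. nmem s8 2 (n + j) = n + length L)"
                  have m8: "nmem s8 1 0 = length L" "rmem s8 3 = rmem s7 3" "rmem s8 4 = rmem s7 4"
                    using g7 f8 by (auto simp: frame_def)
                  have "has x (ix2 n b (b + n)) \<noteq> 0 \<and> sound n X t x b (b + n)"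
                    using t5 b(1) unfolding table_ok_def x_def by auto
                  then have sd: "sound n X t x b (b + n)" by blast
                  have st: "\<forall>j<length L. nmem s7 aIX (L ! j) = j \<and> rmem s8 3 j = sx x (ix3 n b (b + n) (L ! j)) \<and>
                      rmem s8 4 j = sy x (ix3 n b (b + n) (L ! j))"
                    using g7 m8 x6 by simp
                  have w1: "\<forall>p. b \<le> p \<longrightarrow> p < b + n \<longrightarrow> nmem s8 2 (nmem s3 aPM p) = n + nmem s7 aIX (l p)"
                    using w p7 by simp
                  note out = output_of_solution[OF I(1-3) A_def n_def o3 X_def b(1) l_def sd L_def m8(1) st w1 conjunct2[OF w]]
                  have "val x (ix2 n b (b + n)) \<le> (1 + \<epsilon>) * layout_cost I L'" if "is_layout I L'" for L'
                    using dp_lower_bound[OF \<epsilon> I A_def n_def o3 X_def _ _ that, of x] t5 b(2) unfolding x_def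
                    by (meson order_trans)
                  then have "val x (ix2 n b (b + n)) / (1 + \<epsilon>) \<le> layout_cost I L'" if "is_layout I L'" for L'
                    using that \<epsilon> by (simp add: divide_le_eq mult.commute)
                  \<comment> \<open>A lower bound for all layouts passes to the infimum because the
                    set of layouts is nonempty: it contains the computed one.\<close>
                  then have "val x (ix2 n b (b + n)) / (1 + \<epsilon>) \<le> min_cost I"
                    unfolding min_cost_def using out(1) by (intro cInf_greatest) auto
                  then have "val x (ix2 n b (b + n)) \<le> (1 + \<epsilon>) * min_cost I"
                    using \<epsilon> by (simp add: divide_le_eq mult.commute)
                  then show "?Q s8" using out by linarith
                qed (use len in simp)
              qed
            qed
          qed
        qed
      qed
    qed
  qed
qed

section \<open>Bounding the running time\<close>

lemma solver_time_le:
  assumes \<epsilon>: "\<epsilon> > 0" and n: "1 \<le> n"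
  shows "solver_time n \<epsilon> \<le> (161051 * (28 * real (csize W) + 42) + 145) * (real n ^ 6 * T n \<epsilon>)"
proof -
  define N \<tau> c where "N = real n" and "\<tau> = T n \<epsilon>" and "c = real (csize W)"
  have N: "1 \<le> N" using n by (simp add: N_def)
  have \<tau>: "1 \<le> \<tau>" "N \<le> c * \<tau>" using weber_program_linear_time[OF W \<epsilon>] by (simp_all add: \<tau>_def N_def c_def)
  have c0: "0 \<le> c" by (simp add: c_def)
  \<comment> \<open>Expanded, \<open>loop_time n B\<close> is
    \<open>2 * N * B + 4 * N + B + 4\<close>, and each of \<open>N\<close>, \<open>B\<close> and 1
    is at most \<open>N * B\<close>: 2 + 4 + 1 + 4 = 11.\<close>
  have step: "loop_time n B \<le> 11 * N * B" if "1 \<le> B" for B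
  proof -
    have "1 * 1 \<le> N * B" using N that by (intro mult_mono) auto
    then have "1 \<le> N * B" by simp
    moreover have "B \<le> N * B" "N \<le> N * B" using N that by (simp_all add: mult_le_cancel_left1 mult_le_cancel_right1)
    ultimately show ?thesis unfolding loop_time_def N_def[symmetric] by (simp add: N_def[symmetric] algebra_simps)
  qed
  have step1: "1 \<le> 11 * N * B" if "1 \<le> B" for B
  proof -
    have "1 * 1 \<le> (11 * N) * B" using N that by (intro mult_mono) auto
    then show ?thesis by simp
  qed
  have mono: "loop_time n B \<le> loop_time n B'" if "B \<le> B'" for B B'
    unfolding loop_time_def using that by (intro add_right_mono mult_left_mono) auto
  define B where "B = 28 * N + \<tau> + 41"
  have B1: "1 \<le> B" using N \<tau> by (simp add: B_def)
  have "(loop_time n ^^ k) B \<le> (11 * N) ^ k * B \<and> 1 \<le> (11 * N) ^ k * B" for k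
  proof (induction k)
    case 0
    then show ?case using B1 by simp
  next
    case (Suc k)
    have "(loop_time n ^^ Suc k) B \<le> loop_time n ((11 * N) ^ k * B)" using Suc mono by simp
    also have "\<dots> \<le> 11 * N * ((11 * N) ^ k * B)" using step Suc by blast
    finally show ?case using step1[of "(11 * N) ^ k * B"] Suc by (simp add: mult.assoc)
  qed
  \<comment> \<open>161051 is the fifth power of 11, one factor for each nested loop.\<close>
  from this[of 5] have r5: "(loop_time n ^^ 5) B \<le> 161051 * N ^ 5 * B" by (simp add: power_mult_distrib)
  \<comment> \<open>Here the linear overhead of a candidate is absorbed: \<open>N\<close> is at most
    \<open>c * \<tau>\<close> because a Weber program reads its entire input. The constant is 42 = 1
    + 41.\<close>
  have Ble: "B \<le> (28 * c + 42) * \<tau>"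
  proof -
    have "28 * N \<le> 28 * (c * \<tau>)" using \<tau> by simp
    then show ?thesis using \<tau> unfolding B_def by (simp add: algebra_simps)
  qed
  have pw: "N ^ k \<le> N ^ 6 * \<tau>" if "k \<le> 6" for k
  proof -
    have "N ^ k * 1 \<le> N ^ 6 * \<tau>" using N \<tau> that by (intro mult_mono power_increasing) auto
    then show ?thesis by simp
  qed
  have p: "1 \<le> N ^ 6 * \<tau>" "N \<le> N ^ 6 * \<tau>" "N ^ 2 \<le> N ^ 6 * \<tau>" "N ^ 3 \<le> N ^ 6 * \<tau>"
    using pw[of 0] pw[of 1] pw[of 2] pw[of 3] by auto
  have "N * (loop_time n ^^ 5) B \<le> N * (161051 * N ^ 5 * ((28 * c + 42) * \<tau>))"
    using r5 Ble N by (intro mult_left_mono order_trans[OF r5]) auto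
  also have "\<dots> = 161051 * (28 * c + 42) * (N ^ 6 * \<tau>)" by (simp add: power_numeral_reduce algebra_simps)
  finally have main: "N * (loop_time n ^^ 5) B \<le> 161051 * (28 * c + 42) * (N ^ 6 * \<tau>)" .
  \<comment> \<open>The lower-order terms are each at most their coefficient times
    \<open>N ^ 6 * \<tau>\<close>, and 4 + 20 + 70 + 51 = 145.\<close>
  have "solver_time n \<epsilon> = N * (loop_time n ^^ 5) B + 4 * N ^ 3 + 20 * N ^ 2 + 70 * N + 51"
    unfolding solver_time_def N_def[symmetric] \<tau>_def[symmetric] B_def[symmetric]
    by (simp add: N_def[symmetric] power2_eq_square power3_eq_cube algebra_simps)
  also have "\<dots> \<le> 161051 * (28 * c + 42) * (N ^ 6 * \<tau>) + 145 * (N ^ 6 * \<tau>)"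
    using main p by linarith
  finally show ?thesis by (simp add: N_def \<tau>_def c_def algebra_simps)
qed

end

theorem theorem32:
  fixes T_Weber :: "nat \<Rightarrow> real \<Rightarrow> real"
  assumes "\<exists>W. weber_program W T_Weber"
  shows "\<exists>P. \<exists>C::real. \<forall>\<epsilon>>0. \<forall>I t s.
           sinks I = [t] \<and> layers I = 1 \<and> alpha I = 0 \<and> convex_instance I \<and>
           holds_input \<epsilon> t (sources I) s \<longrightarrow>
           (\<exists>k s'. exec P s k s' \<and>
              is_layout I (output_layout I s') \<and>
              layout_cost I (output_layout I s') \<le> (1 + \<epsilon>) * min_cost I \<and>
              (let n = length (sources I) in
                 1 \<le> n \<longrightarrow> real k \<le> C * (real n ^ 6 * T_Weber n \<epsilon>)))"
proof -
  obtain W where W: "weber_program W T_Weber" using assms by blast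
  obtain K where K: "\<And>a. a \<in> nmods W \<union> rmods W \<Longrightarrow> a < K"
    using finite_nat_set_iff_bounded[of "nmods W \<union> rmods W"] finite_nmods[of W] finite_rmods[of W] by auto
  interpret weber_machine W T_Weber K by unfold_locales (use W K in auto)
  show ?thesis
  proof (intro exI[of _ solver] exI[of _ "161051 * (28 * real (csize W) + 42) + 145"] allI impI, elim conjE)
    fix \<epsilon> :: real and I t s
    assume \<epsilon>: "0 < \<epsilon>" and I: "sinks I = [t]" "layers I = 1" "alpha I = 0" "convex_instance I"
      and inp: "holds_input \<epsilon> t (sources I) s"
    obtain k s' where k: "exec solver s k s'" "real k \<le> solver_time (length (sources I)) \<epsilon>"
      "is_layout I (output_layout I s')" "layout_cost I (output_layout I s') \<le> (1 + \<epsilon>) * min_cost I"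
      using runs_solver[OF \<epsilon> I inp] unfolding runs_def by blast
    then show "\<exists>k s'. exec solver s k s' \<and> is_layout I (output_layout I s') \<and>
        layout_cost I (output_layout I s') \<le> (1 + \<epsilon>) * min_cost I \<and>
        (let n = length (sources I) in 1 \<le> n \<longrightarrow>
          real k \<le> (161051 * (28 * real (csize W) + 42) + 145) * (real n ^ 6 * T_Weber n \<epsilon>))"
      using solver_time_le[OF \<epsilon>, of "length (sources I)"] unfolding Let_def by (meson order_trans)
  qed
qed

end
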